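(* Let $n\ge 2$ and $q\in\left(1,\frac{n+2}{n-2}\right)$ (where $\frac{n+2}{n-2}$ is read as $\infty$ if $n=2$). For any positive integer $k$, the equation $$-\Delta_{g_{FS}}u+\lambda u=\lambda u^q$$ on $(\mathbf{CP}^n,g_{FS})$ has at least $k$ different positive $SO(n+1)$-invariant solutions if $\lambda\in\left(\frac{4k(4k+2n)}{q-1},\frac{4(k+1)(4(k+1)+2n)}{q-1}\right]$.
   Context: $g_{FS}$ is the Fubini–Study metric on $\mathbf{CP}^n$ (real dimension $2n$), normalized so that the Hopf fibration $\mathbb S^{2n+1}\to\mathbf{CP}^n$ from the round sphere of curvature one is a Riemannian submersion. $\Delta_{g_{FS}}$ is the Laplace–Beltrami operator, with the sign convention that $-\Delta_{g_{FS}}$ is nonnegative. $SO(n+1)$ acts isometrically on $\mathbf{CP}^n$ via the inclusion $SO(n+1)\subset U(n+1)$ as real matrices acting on $\mathbb C^{n+1}$; this is a cohomogeneity one action. *)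

theory Defs
  imports "HOL-Analysis.Analysis"
begin

text \<open>
  Points are the complex lines through the origin of \<open>complex ^ 'N\<close>. For \<open>'N = 'm option\<close> this is
  the projective space of complex dimension \<open>CARD('m)\<close>, the index \<open>None\<close> playing the role of the
  zeroth homogeneous coordinate.
\<close>

typedef ('N :: finite) cproj = "{vec.span {z} | z :: complex ^ 'N. z \<noteq> 0}"
  morphisms line_of Cproj
proof -
  have "axis undefined 1 \<noteq> (0 :: complex ^ 'N)"
    by (simp add: axis_eq_0_iff)
  then show ?thesis by blast
qed

definition proj :: "complex ^ 'N \<Rightarrow> ('N :: finite) cproj" where
  "proj z = Cproj (vec.span {z})"

text \<open>Only meaningful for invertible \<open>A\<close>, where the image of a line is again a line.\<close>

definition cproj_map :: "complex ^ 'N ^ 'N \<Rightarrow> ('N :: finite) cproj \<Rightarrow> 'N cproj" where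
  "cproj_map A p = Cproj ((*v) A ` line_of p)"

definition complex_matrix :: "real ^ 'N ^ 'N \<Rightarrow> complex ^ 'N ^ ('N :: finite)" where
  "complex_matrix R = (\<chi> i j. complex_of_real (R $ i $ j))"

definition SO_invariant :: "(('N :: finite) cproj \<Rightarrow> real) \<Rightarrow> bool" where
  "SO_invariant u \<longleftrightarrow>
     (\<forall>R :: real ^ 'N ^ 'N. rotation_matrix R \<longrightarrow> (\<forall>p. u (cproj_map (complex_matrix R) p) = u p))"

definition unitary_matrix :: "complex ^ 'N ^ ('N :: finite) \<Rightarrow> bool" where
  "unitary_matrix A \<longleftrightarrow> (\<chi> i j. cnj (A $ j $ i)) ** A = mat 1"

text \<open>
  The vector \<open>(1, w)\<close>, where \<open>w = a + \<i> b\<close> and \<open>x = (a, b)\<close> collects the \<open>2 CARD('m)\<close> real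
  coordinates.
\<close>

definition affine_vec :: "real ^ ('m + 'm) \<Rightarrow> complex ^ (('m :: finite) option)" where
  "affine_vec x = (\<chi> i. case i of None \<Rightarrow> 1 | Some j \<Rightarrow> Complex (x $ Inl j) (x $ Inr j))"

text \<open>
  The parametrizations \<open>x \<mapsto> A [1 : w]\<close>, for \<open>A\<close> unitary, form a smooth atlas; permutation matrices
  give the standard affine charts.
\<close>

definition chart :: "complex ^ ('m option) ^ ('m option) \<Rightarrow> real ^ ('m + 'm) \<Rightarrow>
    (('m :: finite) option) cproj" where
  "chart A x = proj (A *v affine_vec x)"

definition C2_fun :: "('a :: real_normed_vector \<Rightarrow> real) \<Rightarrow> bool" where
  "C2_fun f \<longleftrightarrow> (\<exists>(f' :: 'a \<Rightarrow> 'a \<Rightarrow>\<^sub>L real) (f'' :: 'a \<Rightarrow> 'a \<Rightarrow>\<^sub>L ('a \<Rightarrow>\<^sub>L real)).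
     (\<forall>x. (f has_derivative blinfun_apply (f' x)) (at x)) \<and>
     (\<forall>x. (f' has_derivative blinfun_apply (f'' x)) (at x)) \<and>
     continuous_on UNIV f'')"

definition C2_cproj :: "((('m :: finite) option) cproj \<Rightarrow> real) \<Rightarrow> bool" where
  "C2_cproj u \<longleftrightarrow> (\<forall>A. unitary_matrix A \<longrightarrow> C2_fun (u \<circ> chart A))"

definition herm :: "complex ^ 'N \<Rightarrow> complex ^ ('N :: finite) \<Rightarrow> complex" where
  "herm v w = (\<Sum>i\<in>UNIV. v $ i * cnj (w $ i))"

text \<open>
  For \<open>z\<close> on the unit sphere the Hopf fibre through \<open>z\<close> has tangent line spanned (over the reals)
  by \<open>\<i> z\<close>. On vectors tangent to the sphere at \<open>z\<close> the following map is the orthogonal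
  projection onto the horizontal space, the orthogonal complement of that line.
\<close>

definition hopf_horizontal :: "complex ^ 'N \<Rightarrow> complex ^ 'N \<Rightarrow> complex ^ ('N :: finite)" where
  "hopf_horizontal z v = v - herm v z *s z"

definition partial :: "'d \<Rightarrow> (real ^ 'd \<Rightarrow> 'b :: real_normed_vector) \<Rightarrow> real ^ ('d :: finite) \<Rightarrow> 'b" where
  "partial a f x = frechet_derivative f (at x) (axis a 1)"

text \<open>A local section of the Hopf fibration over the chart \<open>A\<close>, with values in the unit sphere.\<close>

definition hopf_section :: "complex ^ ('m option) ^ ('m option) \<Rightarrow> real ^ ('m + 'm) \<Rightarrow>
    complex ^ (('m :: finite) option)" where
  "hopf_section A x = (1 / norm (A *v affine_vec x)) *\<^sub>R (A *v affine_vec x)"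

text \<open>
  The Gram matrix of the coordinate fields of the chart \<open>A\<close>. The Hopf map sends the partial
  derivatives of the section to the coordinate fields and is a Riemannian submersion from the round
  unit sphere, so that the metric is the Euclidean inner product of their horizontal parts.
\<close>

definition fubini_study :: "complex ^ ('m option) ^ ('m option) \<Rightarrow> real ^ ('m + 'm) \<Rightarrow>
    real ^ ('m + 'm) ^ (('m :: finite) + 'm)" where
  "fubini_study A x = (\<chi> a b.
     hopf_horizontal (hopf_section A x) (partial a (hopf_section A) x) \<bullet>
     hopf_horizontal (hopf_section A x) (partial b (hopf_section A) x))"

definition laplace_beltrami :: "(real ^ 'd \<Rightarrow> real ^ 'd ^ 'd) \<Rightarrow> (real ^ 'd \<Rightarrow> real) \<Rightarrow>
    real ^ ('d :: finite) \<Rightarrow> real" where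
  "laplace_beltrami G f x =
     1 / sqrt (det (G x)) *
     (\<Sum>a\<in>UNIV. \<Sum>b\<in>UNIV.
        partial a (\<lambda>y. sqrt (det (G y)) * matrix_inv (G y) $ a $ b * partial b f y) x)"

text \<open>
  On projective space the coordinate expression is evaluated in a chart centred at the point, which
  exists by \<open>ex_centred_chart\<close> below; for functions of class \<open>C2\<close> the value is independent of
  the chart.
\<close>

definition laplace_FS :: "((('m :: finite) option) cproj \<Rightarrow> real) \<Rightarrow> ('m option) cproj \<Rightarrow> real" where
  "laplace_FS u p =
     (let A = (SOME A. unitary_matrix A \<and> chart A 0 = p)
      in laplace_beltrami (fubini_study A) (u \<circ> chart A) 0)"

lemma proj_scale:
  assumes "c \<noteq> 0"
  shows "proj (c *s z) = proj z"
proof -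
  have "vec.span {c *s z} = vec.span {z}"
  proof (intro vec.span_eq[THEN iffD2] conjI)
    show "{c *s z} \<subseteq> vec.span {z}"
      by (simp add: vec.span_base vec.span_scale)
    have "inverse c *s (c *s z) \<in> vec.span {c *s z}"
      by (intro vec.span_scale vec.span_base) simp
    moreover have "inverse c *s (c *s z) = z"
      using assms by (simp add: vec_eq_iff)
    ultimately show "{z} \<subseteq> vec.span {c *s z}" by simp
  qed
  then show ?thesis by (simp add: proj_def)
qed

lemma proj_cases:
  obtains z where "z \<noteq> 0" "p = proj z"
  using line_of[of p] by (auto simp: proj_def) (metis line_of_inverse)

lemma norm_square_herm: "complex_of_real ((norm v)\<^sup>2) = (\<Sum>i\<in>UNIV. cnj (v $ i) * v $ i)"
  by (simp add: power2_norm_eq_inner inner_vec_def flip: of_real_sum)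
     (simp add: complex_norm_square[symmetric] power2_norm_eq_inner[symmetric] mult.commute)

lemma ex_unitary_first_column:
  fixes z :: "complex ^ (('m :: finite) option)"
  assumes "z \<noteq> 0"
  obtains A c where "unitary_matrix A" "c \<noteq> 0" "A *v axis None 1 = c *s z"
proof -
  define t where "t = (if z $ None = 0 then 1 else cnj (z $ None) / norm (z $ None))"
  define c where "c = t / norm z"
  define w where "w = c *s z"
  have t: "norm t = 1" by (auto simp: t_def norm_divide)
  have c0: "c \<noteq> 0" using t assms by (auto simp: c_def)
  have nsv: "norm (c *s z) = norm c * norm z"
    by (simp add: norm_vec_def L2_set_right_distrib norm_mult)
  have nw: "norm w = 1" unfolding w_def nsv using t assms by (simp add: c_def norm_divide)
  obtain r where r: "w $ None = complex_of_real r"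
  proof (cases "z $ None = 0")
    case True
    then show ?thesis using that[of 0] by (simp add: w_def)
  next
    case False
    have "w $ None = complex_of_real (norm (z $ None) / norm z)"
    proof -
      have "w $ None = z $ None * cnj (z $ None) / (norm (z $ None) * norm z)"
        using False by (simp add: w_def c_def t_def)
      also have "\<dots> = (complex_of_real (norm (z $ None)))\<^sup>2 / (norm (z $ None) * norm z)"
        by (simp add: complex_norm_square[symmetric] del: of_real_mult)
      also have "\<dots> = complex_of_real (norm (z $ None) / norm z)"
        using False by (simp add: power2_eq_square)
      finally show ?thesis .
    qed
    then show ?thesis by (rule that)
  qed
  show ?thesis
  proof (cases "w = axis None 1")
    case True
    have "unitary_matrix (mat 1 :: complex ^ ('m option) ^ ('m option))"
    proof -
      have "(\<chi> i j. cnj ((mat 1 :: complex ^ ('m option) ^ ('m option)) $ j $ i)) = mat 1"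
        by (auto simp: vec_eq_iff mat_def)
      then show ?thesis by (simp add: unitary_matrix_def)
    qed
    then show ?thesis using that[of "mat 1" c] c0 True by (simp add: w_def)
  next
    case False
    define v where "v = axis None 1 - w"
    define s where "s = (norm v)\<^sup>2"
    have s0: "s \<noteq> 0" using False by (auto simp: s_def v_def)
    have "s = 2 - 2 * r"
    proof -
      have "axis None 1 \<bullet> w = r"
        using r by (simp add: inner_axis' )
      then show ?thesis
        using nw by (simp add: s_def v_def power2_norm_eq_inner inner_diff inner_commute
            norm_eq_1 inner_axis_axis)
    qed
    then have v0: "v $ None = complex_of_real (s / 2)"
      using r by (simp add: v_def axis_def)
    define A :: "complex ^ ('m option) ^ ('m option)"
      where "A = (\<chi> i j. (if i = j then 1 else 0) - 2 / complex_of_real s * v $ i * cnj (v $ j))"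
    have sv: "(\<Sum>k\<in>UNIV. cnj (v $ k) * v $ k) = complex_of_real s"
      unfolding s_def by (rule norm_square_herm[symmetric])
    have "(\<Sum>k\<in>UNIV. cnj (A $ k $ i) * A $ k $ j) = (if i = j then 1 else 0)" for i j
    proof -
      let ?d = "2 / complex_of_real s"
      have d: "?d * ?d * complex_of_real s = 2 * ?d"
        using s0 by simp
      have cd: "cnj ?d = ?d" by simp
      have term_eq: "cnj (A $ k $ i) * A $ k $ j =
          (if k = i then (if i = j then 1 else 0) - ?d * v $ i * cnj (v $ j) else 0)
          - (if k = j then ?d * v $ i * cnj (v $ j) else 0)
          + ?d * ?d * v $ i * cnj (v $ j) * (cnj (v $ k) * v $ k)" for k
      proof -
        have *: "(a - d * x * y') * (b - d * x' * y) =
            a * b - d * (b * (x * y')) - d * (a * (x' * y)) + d * d * y' * y * (x * x')"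
          for a b d x x' y y' :: complex
          by (simp add: algebra_simps)
        have "cnj (A $ k $ i) = (if k = i then 1 else 0) - ?d * cnj (v $ k) * v $ i"
          by (simp add: A_def cd)
        moreover have "A $ k $ j = (if k = j then 1 else 0) - ?d * v $ k * cnj (v $ j)"
          by (simp add: A_def)
        ultimately have "cnj (A $ k $ i) * A $ k $ j =
            (if k = i then 1 else 0) * (if k = j then 1 else 0)
            - ?d * ((if k = j then 1 else 0) * (cnj (v $ k) * v $ i))
            - ?d * ((if k = i then 1 else 0) * (v $ k * cnj (v $ j)))
            + ?d * ?d * v $ i * cnj (v $ j) * (cnj (v $ k) * v $ k)"
          by (simp only: *)
        then show ?thesis
          by (cases "k = i"; cases "k = j") (simp_all add: mult_ac)
      qed
      have "(\<Sum>k\<in>UNIV. cnj (A $ k $ i) * A $ k $ j) =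
          (if i = j then 1 else 0) - ?d * v $ i * cnj (v $ j) - ?d * v $ i * cnj (v $ j)
          + ?d * ?d * v $ i * cnj (v $ j) * complex_of_real s"
        unfolding term_eq sum.distrib sum_subtractf sum_distrib_left[symmetric] sv
        by (simp only: sum.delta finite UNIV_I if_True)
      also have "\<dots> = (if i = j then 1 else 0)"
      proof -
        have "x - d * p * q - d * p * q + d * d * p * q * S = x - 2 * d * (p * q) + d * d * S * (p * q)"
          for x d p q S :: complex
          by (simp add: algebra_simps)
        then show ?thesis by (simp only: d) simp
      qed
      finally show ?thesis .
    qed
    then have "unitary_matrix A"
      by (simp add: unitary_matrix_def vec_eq_iff matrix_matrix_mult_def mat_def)
    moreover have "A *v axis None 1 = axis None 1 - v"
    proof -
      have "A *v axis None 1 = (\<chi> i. A $ i $ None)"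
        by (simp add: vec_eq_iff matrix_vector_mult_def axis_def if_distrib[of "\<lambda>y. _ * y"]
            cong: if_cong)
      then show ?thesis
        using s0 v0 by (simp add: vec_eq_iff A_def axis_def)
    qed
    ultimately show ?thesis using that[of A c] c0 by (simp add: v_def w_def)
  qed
qed

lemma ex_centred_chart: "\<exists>A. unitary_matrix A \<and> chart A 0 = p"
proof -
  obtain z where z: "z \<noteq> 0" "p = proj z" by (rule proj_cases)
  obtain A c where A: "unitary_matrix A" "c \<noteq> 0" "A *v axis None 1 = c *s z"
    using ex_unitary_first_column[OF z(1)] by blast
  have "affine_vec 0 = (axis None 1 :: complex ^ ('a option))"
    by (auto simp: vec_eq_iff affine_vec_def axis_def complex_eq_iff split: option.split)
  then have "chart A 0 = p"
    using A z by (simp add: chart_def proj_scale)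
  then show ?thesis using A by blast
qed

definition positive_solution :: "real \<Rightarrow> real \<Rightarrow> ((('m :: finite) option) cproj \<Rightarrow> real) \<Rightarrow> bool" where
  "positive_solution lam q u \<longleftrightarrow>
     C2_cproj u \<and> (\<forall>p. u p > 0) \<and>
     (\<forall>p. - laplace_FS u p + lam * u p = lam * u p powr q)"

end

theory Submission
  imports Defs "HOL-Computational_Algebra.Polynomial"
begin

text \<open>
  The invariant functions are functions of \<open>y = 1 - |z\<^sub>0\<^sup>2 + \<dots> + z\<^sub>n\<^sup>2|\<^sup>2 / |z|\<^sup>4\<close>, which runs through
  \<open>[0, 1]\<close> from the real projective space (\<open>y = 0\<close>, codimension \<open>n\<close>) to the quadric (\<open>y = 1\<close>,
  codimension 2). For \<open>u = G(y)\<close> the equation becomes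
  \<open>y (1 - y) G'' + (n/2 - (n/2 + 1) y) G' = \<kappa> (G - G\<^sup>q)\<close> with \<open>\<kappa> = \<lambda> / 16\<close>, singular at both ends.
  One shoots from \<open>y = 0\<close> with initial value \<open>d \<in> [0, 1)\<close>. With \<open>m = (1 - y) G'\<close> and
  \<open>r = 1 - G - m ln (1 - y)\<close> the curve \<open>(r, m)\<close> stays away from the origin and extends continuously
  to \<open>y = 1\<close>; the solution is regular there iff the terminal angle of this curve is a multiple of
  \<open>\<pi>\<close>. The terminal angle is less than \<open>\<pi>/2\<close> for \<open>d = 0\<close>, and for \<open>d\<close> close to 1 it is at least
  \<open>(k - 1) \<pi>\<close> by Sturm comparison of \<open>G - 1\<close> with the eigenfunction of eigenvalue
  \<open>4k(4k + 2n)\<close>, a Jacobi polynomial with \<open>k\<close> zeros. The intermediate value theorem gives \<open>k - 1\<close>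
  nonconstant solutions, and the constant 1 is the \<open>k\<close>-th.

  No a priori bound from above is needed during shooting because the nonlinearity can be truncated:
  regular solutions with \<open>d \<le> 1\<close> obey an explicit bound that does not depend on the truncation.
\<close>

section \<open>Shooting from the singular orbit\<close>

text \<open>The obstacle is the end \<open>y = 1\<close>: in general m has a nonzero limit there, so
  G itself diverges logarithmically and \<open>y = 1\<close> carries no initial data. Adding the
  logarithm back gives r' = - ln (1 - y) m', which is integrable; hence (r, m), unlike (1 - G, G'),
  has a limit, attained uniformly in d. The winding counts critical points because the angle passes
  each multiple j\<pi> (j a natural number) only upwards: there m = 0, r = 1 - G has the sign of
  (-1)^j, and since G > 0 at such a point, m' = h(G) / y has that sign too. Positivity holds because
  a solution that reaches 0 is trapped below it by the negative reaction and never has zero flux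
  again. Closeness of G to 1 is uniform only on intervals [0, b] with b < 1, so the comparison stops
  at the last zero of the Jacobi polynomial: k zeros of G - 1, hence k - 1 critical points between
  them. The threshold for \<lambda> enters through the linearization at 1: the slope of \<kappa> (v
  - v^q) is - \<kappa> (q - 1), and 4k(4k + 2n) = 16 k (k + n/2), so the strict lower bound says
  that G - 1 oscillates faster than the k-th Jacobi polynomial.\<close>

locale shooting =
  fixes n :: nat and h :: "real \<Rightarrow> real" and B L :: real
  assumes n_ge: "n \<ge> 2"
    and L_pos: "L > 0" and B_pos: "B > 0"
    and h_lipschitz: "\<bar>h x - h y\<bar> \<le> L * \<bar>x - y\<bar>"
    and h_bounded: "\<bar>h x\<bar> \<le> B"
    and h_0: "h 0 = 0" and h_1: "h 1 = 0"
    and h_pos: "0 < x \<Longrightarrow> x < 1 \<Longrightarrow> h x > 0"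
    and h_neg: "x < 0 \<or> x > 1 \<Longrightarrow> h x < 0"
begin

text \<open>This is \<open>y powr (-n/2)\<close> times the integral of \<open>t powr (n/2 - 1) * h (u t)\<close> over \<open>[0, y]\<close>; the
  substitution \<open>t = y s\<^sup>2\<close> removes the singularity at 0 and all half-integer powers.\<close>

definition flux :: "(real \<Rightarrow> real) \<Rightarrow> real \<Rightarrow> real" where
  "flux u y = 2 * integral {0..1} (\<lambda>s. s ^ (n - Suc 0) * h (u (y * s\<^sup>2)))"

definition step :: "real \<Rightarrow> (real \<Rightarrow> real) \<Rightarrow> real \<Rightarrow> real" where
  "step d u y = d + integral {0..y} (\<lambda>t. flux u t / (1 - t))"

primrec iter :: "real \<Rightarrow> nat \<Rightarrow> real \<Rightarrow> real" where
  "iter d 0 = (\<lambda>_. d)"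
| "iter d (Suc k) = step d (iter d k)"

definition sol :: "real \<Rightarrow> real \<Rightarrow> real" where
  "sol d y = lim (\<lambda>k. iter d k y)"

text \<open>A Bielecki weight. The flux is Lipschitz with constant \<open>2 * L / n\<close>, and
  integrating \<open>weight t / (1 - t)\<close> gains the factor \<open>1 / (4 * L / n)\<close>, so
  that \<open>step\<close> halves weighted distances on all of [0, 1) at once, in spite of the
  factor \<open>1 / (1 - t)\<close>.\<close>

definition weight :: "real \<Rightarrow> real" where
  "weight y = (1 - y) powr (- (4 * L / n))"

lemma h_continuous: "continuous_on S h"
proof -
  have "L-lipschitz_on UNIV h"
    by (rule lipschitz_onI) (use h_lipschitz L_pos in \<open>auto simp: dist_real_def\<close>)
  then show ?thesis
    using continuous_on_subset lipschitz_on_continuous_on by blast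
qed

lemma integral_power_n: "integral {0..1} (\<lambda>s::real. s ^ (n - Suc 0)) = 1 / n"
proof -
  have "((\<lambda>s::real. s ^ (n - Suc 0)) has_integral (1 ^ n / n - 0 ^ n / n)) {0..1}"
    using n_ge by (intro fundamental_theorem_of_calculus)
      (auto intro!: derivative_eq_intros simp flip: has_real_derivative_iff_has_vector_derivative)
  then show ?thesis using n_ge by (simp add: integral_unique)
qed

section \<open>The flux of a continuous function\<close>

lemma integrand_continuous:
  assumes "continuous_on {0..<1} u" "0 \<le> y" "y < 1"
  shows "continuous_on {0..1} (\<lambda>s. s ^ (n - Suc 0) * h (u (y * s\<^sup>2)))"
proof -
  have "y * s\<^sup>2 \<in> {0..<1}" if "s \<in> {0..1}" for s
    using that assms mult_left_le[of "s\<^sup>2" y] by (auto simp: power_le_one)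
  then show ?thesis
    by (intro continuous_intros continuous_on_compose2[OF h_continuous[of UNIV]]
        continuous_on_compose2[OF assms(1)]) auto
qed

lemma integrable_integrand:
  assumes "continuous_on {0..<1} u" "0 \<le> y" "y < 1"
  shows "(\<lambda>s. s ^ (n - Suc 0) * h (u (y * s\<^sup>2))) integrable_on {0..1}"
  using integrand_continuous[OF assms] by (rule integrable_continuous_real)

lemma flux_bound:
  assumes "continuous_on {0..<1} u" "0 \<le> y" "y < 1"
    and "\<And>x. 0 \<le> x \<Longrightarrow> x < 1 \<Longrightarrow> h (u x) \<le> C"
  shows "flux u y \<le> 2 * C / n"
proof -
  have "y * s\<^sup>2 \<in> {0..<1}" if "s \<in> {0..1}" for s
    using that assms mult_left_le[of "s\<^sup>2" y] by (auto simp: power_le_one)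
  then have "integral {0..1} (\<lambda>s. s ^ (n - Suc 0) * h (u (y * s\<^sup>2))) \<le> integral {0..1} (\<lambda>s. s ^ (n - Suc 0) * C)"
    using assms by (intro integral_le integrable_integrand mult_left_mono)
      (auto intro!: integrable_continuous_real continuous_intros)
  then show ?thesis by (simp add: flux_def integral_power_n)
qed

text \<open>Only the values on [0, y] enter. With an increasing weight a weighted bound can
  therefore be replaced by its value at the right end y.\<close>

lemma flux_diff:
  assumes "continuous_on {0..<1} u" "continuous_on {0..<1} v" "0 \<le> y" "y < 1"
    and "\<And>x. 0 \<le> x \<Longrightarrow> x \<le> y \<Longrightarrow> \<bar>u x - v x\<bar> \<le> C"
  shows "\<bar>flux u y - flux v y\<bar> \<le> 2 * L / n * C"
proof -
  have *: "\<bar>h (u (y * s\<^sup>2)) - h (v (y * s\<^sup>2))\<bar> \<le> L * C" if "s \<in> {0..1}" for s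
  proof -
    have "0 \<le> y * s\<^sup>2" "y * s\<^sup>2 \<le> y"
      using that assms mult_left_le[of "s\<^sup>2" y] by (auto simp: power_le_one)
    then have "\<bar>u (y * s\<^sup>2) - v (y * s\<^sup>2)\<bar> \<le> C" using assms by auto
    then show ?thesis
      using h_lipschitz[of "u (y * s\<^sup>2)" "v (y * s\<^sup>2)"] L_pos
        mult_left_mono[of "\<bar>u (y * s\<^sup>2) - v (y * s\<^sup>2)\<bar>" C L] by linarith
  qed
  have "flux u y - flux v y = 2 * integral {0..1} (\<lambda>s. s ^ (n - Suc 0) * h (u (y * s\<^sup>2)) - s ^ (n - Suc 0) * h (v (y * s\<^sup>2)))"
    unfolding flux_def using assms by (subst Henstock_Kurzweil_Integration.integral_diff) (auto intro!: integrable_integrand)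
  moreover have "norm (integral {0..1} (\<lambda>s. s ^ (n - Suc 0) * h (u (y * s\<^sup>2)) - s ^ (n - Suc 0) * h (v (y * s\<^sup>2))))
      \<le> integral {0..1} (\<lambda>s. s ^ (n - Suc 0) * (L * C))"
  proof (rule integral_norm_bound_integral)
    show "norm (s ^ (n - Suc 0) * h (u (y * s\<^sup>2)) - s ^ (n - Suc 0) * h (v (y * s\<^sup>2))) \<le> s ^ (n - Suc 0) * (L * C)"
      if "s \<in> {0..1}" for s
      using *[OF that] that by (simp add: abs_mult mult_left_mono flip: right_diff_distrib)
    show "(\<lambda>s. s ^ (n - Suc 0) * (L * C)) integrable_on {0..1}"
      by (intro integrable_continuous_real continuous_intros)
  qed (use assms in \<open>intro integrable_diff integrable_integrand; simp\<close>)
  ultimately show ?thesis by (simp add: integral_power_n)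
qed

lemma flux_continuous:
  assumes "continuous_on {0..<1} u"
  shows "continuous_on {0..<1} (flux u)"
proof -
  have "continuous_on ({0..<1} \<times> cbox 0 1) (\<lambda>(y, s). s ^ (n - Suc 0) * h (u (y * s\<^sup>2)))"
  proof -
    have "y * s\<^sup>2 \<in> {0..<1}" if "s \<in> {0..1}" "y \<in> {0..<1}" for s y :: real
      using that mult_left_le[of "s\<^sup>2" y] by (auto simp: power_le_one)
    then show ?thesis
      by (auto simp: case_prod_unfold intro!: continuous_intros
          continuous_on_compose2[OF h_continuous[of UNIV]] continuous_on_compose2[OF assms])
  qed
  from integral_continuous_on_param[OF this] show ?thesis
    unfolding flux_def by (auto intro!: continuous_intros)
qed

section \<open>Picard iteration in the weighted norm\<close>

lemma weight_ge_1: "0 \<le> y \<Longrightarrow> y < 1 \<Longrightarrow> weight y \<ge> 1"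
  unfolding weight_def powr_minus_divide using L_pos n_ge
  by (simp add: field_simps powr_le1)

lemma weight_mono: "0 \<le> x \<Longrightarrow> x \<le> y \<Longrightarrow> y < 1 \<Longrightarrow> weight x \<le> weight y"
  unfolding weight_def using L_pos n_ge by (intro powr_mono2') auto

lemma weight_integral:
  assumes "0 \<le> y" "y < 1"
  shows "((\<lambda>t. weight t / (1 - t)) has_integral (weight y - 1) / (4 * L / n)) {0..y}"
proof -
  have "((\<lambda>t. weight t / (1 - t)) has_integral
      (weight y / (4 * L / n) - weight 0 / (4 * L / n))) {0..y}"
  proof (rule fundamental_theorem_of_calculus)
    fix x assume "x \<in> {0..y}"
    then have "x < 1" using assms by auto
    moreover define p where "p = 4 * L / n"
    moreover have "p > 0" using L_pos n_ge by (simp add: p_def)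
    ultimately have "((\<lambda>t. weight t / (4 * L / n)) has_real_derivative weight x / (1 - x)) (at x within {0..y})"
      unfolding weight_def p_def[symmetric]
      by (auto intro!: derivative_eq_intros simp: powr_diff)
    then show "((\<lambda>t. weight t / (4 * L / n)) has_vector_derivative weight x / (1 - x)) (at x within {0..y})"
      by (simp add: has_real_derivative_iff_has_vector_derivative)
  qed (use assms in auto)
  then show ?thesis by (simp add: weight_def[of 0] diff_divide_distrib left_diff_distrib)
qed

lemma weight_integrable:
  assumes "0 \<le> y" "y < 1"
  shows "(\<lambda>t. c * (weight t / (1 - t))) integrable_on {0..y}"
  using has_integral_mult_right[OF weight_integral[OF assms]] by (rule has_integral_integrable)

lemma integral_weight:
  assumes "0 \<le> y" "y < 1"
  shows "integral {0..y} (\<lambda>t. c * (weight t / (1 - t))) = c * ((weight y - 1) / (4 * L / n))"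
  using has_integral_mult_right[OF weight_integral[OF assms]] by (rule integral_unique)

lemma flux_quotient_continuous:
  assumes "continuous_on {0..<1} u"
  shows "continuous_on {0..<1} (\<lambda>t. flux u t / (1 - t))"
  using flux_continuous[OF assms] by (auto intro!: continuous_intros)

lemma flux_quotient_integrable:
  assumes "continuous_on {0..<1} u" "y < 1"
  shows "(\<lambda>t. flux u t / (1 - t)) integrable_on {0..y}"
  using assms by (intro integrable_continuous_real continuous_on_subset[OF flux_quotient_continuous]) auto

lemma step_deriv:
  assumes "continuous_on {0..<1} u" "0 \<le> y" "y < 1"
  shows "(step d u has_real_derivative flux u y / (1 - y)) (at y within {0..<1})"
proof -
  obtain b where b: "y < b" "b < 1" using assms dense by blast
  have "((\<lambda>x. integral {0..x} (\<lambda>t. flux u t / (1 - t))) has_real_derivative flux u y / (1 - y))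
      (at y within {0..b})"
    using assms b by (intro integral_has_real_derivative continuous_on_subset[OF flux_quotient_continuous]) auto
  then have "(step d u has_real_derivative flux u y / (1 - y)) (at y within {0..b})"
    unfolding step_def by (auto intro!: derivative_eq_intros)
  moreover have "at y within {0..b} = at y within {0..<1}"
    using assms b by (intro at_within_nhd[where S="{..<b}"]) auto
  ultimately show ?thesis by simp
qed

lemma step_continuous:
  assumes "continuous_on {0..<1} u"
  shows "continuous_on {0..<1} (step d u)"
  using step_deriv[OF assms] by (intro DERIV_continuous_on) auto

text \<open>One estimate for both contraction (\<open>d = d'\<close>) and dependence on the initial
  value: the factor 1/2 is the quotient of \<open>2 * L / n\<close> by the exponent
  \<open>4 * L / n\<close> of the weight.\<close>

lemma step_diff:
  assumes u: "continuous_on {0..<1} u" and v: "continuous_on {0..<1} v" and y: "0 \<le> y" "y < 1"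
    and C: "\<And>x. 0 \<le> x \<Longrightarrow> x < 1 \<Longrightarrow> \<bar>u x - v x\<bar> \<le> C * weight x"
  shows "\<bar>step d u y - step d' v y\<bar> \<le> \<bar>d - d'\<bar> + C / 2 * weight y"
proof -
  have "0 \<le> C * weight 0" using C[of 0] by linarith
  then have "C \<ge> 0" using weight_ge_1[of 0] by (simp add: zero_le_mult_iff)
  have "step d u y - step d' v y = d - d' + integral {0..y} (\<lambda>t. flux u t / (1 - t) - flux v t / (1 - t))"
    unfolding step_def using u v y
    by (subst Henstock_Kurzweil_Integration.integral_diff) (auto intro!: flux_quotient_integrable)
  moreover have "norm (integral {0..y} (\<lambda>t. flux u t / (1 - t) - flux v t / (1 - t)))
      \<le> integral {0..y} (\<lambda>t. 2 * L / n * C * (weight t / (1 - t)))"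
  proof (rule integral_norm_bound_integral)
    fix t assume t: "t \<in> {0..y}"
    then have t1: "0 \<le> t" "t < 1" using y by auto
    have "\<bar>flux u t - flux v t\<bar> \<le> 2 * L / n * (C * weight t)"
    proof (rule flux_diff[OF u v])
      fix x assume "0 \<le> x" "x \<le> t"
      then show "\<bar>u x - v x\<bar> \<le> C * weight t"
        using C[of x] t1 weight_mono[of x t] \<open>C \<ge> 0\<close> mult_left_mono[of "weight x" "weight t" C] by fastforce
    qed (use t1 in auto)
    then show "norm (flux u t / (1 - t) - flux v t / (1 - t)) \<le> 2 * L / n * C * (weight t / (1 - t))"
      using t1 divide_right_mono[of "\<bar>flux u t - flux v t\<bar>" "2 * L / n * (C * weight t)" "1 - t"]
      by (simp add: mult_ac flip: diff_divide_distrib)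
  qed (rule integrable_diff weight_integrable flux_quotient_integrable u v y)+
  moreover have "integral {0..y} (\<lambda>t. 2 * L / n * C * (weight t / (1 - t))) = C / 2 * (weight y - 1)"
    unfolding integral_weight[OF y] using L_pos n_ge by simp
  ultimately show ?thesis using \<open>C \<ge> 0\<close> by (simp add: algebra_simps)
qed

lemma iter_continuous: "continuous_on {0..<1} (iter d k)"
  by (induction k) (auto simp: step_continuous)

lemma iter_const: "h d = 0 \<Longrightarrow> iter d k = (\<lambda>_. d)"
  by (induction k) (auto simp: step_def flux_def fun_eq_iff)

text \<open>The constant 2 is the fixed point of C = 1 + C/2, the recursion that
  \<open>step_diff\<close> produces; it is preserved by every iteration and so passes to the
  limit.\<close>

lemma iter_dependence:
  "0 \<le> y \<Longrightarrow> y < 1 \<Longrightarrow> \<bar>iter d k y - iter d' k y\<bar> \<le> 2 * \<bar>d - d'\<bar> * weight y"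
proof (induction k arbitrary: y)
  case 0
  then show ?case using mult_left_mono[OF weight_ge_1[of y], of "\<bar>d - d'\<bar>"] by auto
next
  case (Suc k)
  from step_diff[OF iter_continuous iter_continuous Suc.prems Suc.IH]
  have "\<bar>iter d (Suc k) y - iter d' (Suc k) y\<bar> \<le> \<bar>d - d'\<bar> + \<bar>d - d'\<bar> * weight y" by simp
  then show ?case using mult_left_mono[OF weight_ge_1[OF Suc.prems], of "\<bar>d - d'\<bar>"] by auto
qed

lemma iter_Suc_diff: "\<exists>C. \<forall>k y. 0 \<le> y \<longrightarrow> y < 1 \<longrightarrow> \<bar>iter d (Suc k) y - iter d k y\<bar> \<le> C * (1/2) ^ k * weight y"
proof -
  define C where "C = 2 * (2 * \<bar>h d\<bar> / n) / (4 * L / n)"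
  have "0 \<le> y \<Longrightarrow> y < 1 \<Longrightarrow> \<bar>iter d (Suc k) y - iter d k y\<bar> \<le> C * (1/2) ^ k * weight y" for k y
  proof (induction k arbitrary: y)
    case 0
    have "\<bar>step d (\<lambda>_. d) y - d\<bar> = norm (integral {0..y} (\<lambda>t. 2 / n * h d * (1 / (1 - t))))"
      by (simp add: step_def flux_def integral_power_n field_simps)
    also have "\<dots> \<le> integral {0..y} (\<lambda>t. 2 / n * \<bar>h d\<bar> * (weight t / (1 - t)))"
    proof (rule integral_norm_bound_integral)
      show "(\<lambda>t. 2 / n * h d * (1 / (1 - t))) integrable_on {0..y}"
        using 0 by (intro integrable_continuous_real continuous_intros) auto
      show "(\<lambda>t. 2 / n * \<bar>h d\<bar> * (weight t / (1 - t))) integrable_on {0..y}"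
        by (rule weight_integrable[OF 0])
      show "norm (2 / n * h d * (1 / (1 - t))) \<le> 2 / n * \<bar>h d\<bar> * (weight t / (1 - t))" if "t \<in> {0..y}" for t
        using that 0 weight_ge_1[of t] mult_left_mono[of 1 "weight t" "\<bar>h d\<bar>"]
        by (auto simp: abs_mult intro!: divide_right_mono)
    qed
    also have "\<dots> = C / 2 * (weight y - 1)"
      unfolding integral_weight[OF 0] using L_pos n_ge by (simp add: C_def)
    also have "\<dots> \<le> C * weight y"
      using weight_ge_1[OF 0] L_pos by (simp add: C_def field_simps)
    finally show ?case by simp
  next
    case (Suc k)
    from step_diff[OF iter_continuous iter_continuous Suc.prems Suc.IH, where d=d and d'=d]
    show ?case by simp
  qed
  then show ?thesis by blast
qed

lemma sol_iter_bound:
  "\<exists>C. \<forall>k y. 0 \<le> y \<longrightarrow> y < 1 \<longrightarrow> \<bar>sol d y - iter d k y\<bar> \<le> C * (1/2) ^ k * weight y"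
proof -
  obtain C where C: "\<And>k y. 0 \<le> y \<Longrightarrow> y < 1 \<Longrightarrow> \<bar>iter d (Suc k) y - iter d k y\<bar> \<le> C * (1/2) ^ k * weight y"
    using iter_Suc_diff by blast
  have "\<bar>sol d y - iter d k y\<bar> \<le> 2 * C * (1/2) ^ k * weight y" if y: "0 \<le> y" "y < 1" for k y
  proof -
    define f where "f i = iter d (Suc i) y - iter d i y" for i
    have geo: "(\<lambda>i. C * weight y * (1/2) ^ i) sums (C * weight y * 2)"
      using sums_mult[OF geometric_sums[of "1/2::real"], of "C * weight y"] by simp
    have fb: "norm (f i) \<le> C * weight y * (1/2) ^ i" for i
      using C[OF y, of i] by (simp add: f_def mult_ac)
    have sf: "summable f"
      by (rule summable_comparison_test'[OF sums_summable[OF geo]]) (use fb in auto)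
    have "(\<lambda>k. \<Sum>i<k. f i) \<longlonglongrightarrow> suminf f" using sf by (rule summable_LIMSEQ)
    moreover have ps: "(\<Sum>i<k. f i) = iter d k y - d" for k
      unfolding f_def by (subst sum_lessThan_telescope) simp
    ultimately have "(\<lambda>k. iter d k y - d + d) \<longlonglongrightarrow> suminf f + d" by (intro tendsto_add) auto
    then have lim: "sol d y = suminf f + d" by (simp add: sol_def limI)
    have "sol d y - iter d k y = (\<Sum>i. f (i + k))"
      using suminf_minus_initial_segment[OF sf, of k] ps[of k] by (simp add: lim)
    \<comment> \<open>The tail of a geometric series of ratio 1/2; its sum doubles the
      constant.\<close>
    also have "norm \<dots> \<le> (\<Sum>i. C * weight y * (1/2) ^ k * (1/2) ^ i)"
    proof (rule norm_suminf_le)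
      show "norm (f (i + k)) \<le> C * weight y * (1/2) ^ k * (1/2) ^ i" for i
        using fb[of "i + k"] by (simp add: power_add mult_ac)
    qed (auto intro!: summable_mult summable_geometric)
    also have "\<dots> = 2 * C * (1/2) ^ k * weight y"
      by (subst suminf_mult) (auto intro!: summable_geometric simp: suminf_geometric)
    finally show ?thesis by simp
  qed
  then show ?thesis by blast
qed

lemma sol_LIMSEQ:
  assumes "0 \<le> y" "y < 1"
  shows "(\<lambda>k. iter d k y) \<longlonglongrightarrow> sol d y"
proof -
  obtain C where C: "\<And>k y. 0 \<le> y \<Longrightarrow> y < 1 \<Longrightarrow> \<bar>sol d y - iter d k y\<bar> \<le> C * (1/2) ^ k * weight y"
    using sol_iter_bound[of d] by blast
  have "(\<lambda>k. C * (1/2) ^ k * weight y) \<longlonglongrightarrow> C * 0 * weight y"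
    by (intro tendsto_intros LIMSEQ_power_zero) auto
  then have null: "(\<lambda>k. C * (1/2) ^ k * weight y) \<longlonglongrightarrow> 0" by simp
  have "(\<lambda>k. iter d k y - sol d y) \<longlonglongrightarrow> 0"
  proof (rule Lim_null_comparison[OF _ null])
    show "\<forall>\<^sub>F k in sequentially. norm (iter d k y - sol d y) \<le> C * (1/2) ^ k * weight y"
      using C[OF assms] by (simp add: abs_minus_commute)
  qed
  then show ?thesis by (simp add: LIM_zero_iff)
qed

lemma sol_dependence:
  assumes "0 \<le> y" "y < 1"
  shows "\<bar>sol d y - sol d' y\<bar> \<le> 2 * \<bar>d - d'\<bar> * weight y"
  using iter_dependence[OF assms]
  by (intro LIMSEQ_le_const2[OF tendsto_rabs[OF tendsto_diff[OF sol_LIMSEQ[OF assms] sol_LIMSEQ[OF assms]]]]) auto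

lemma sol_const: "h d = 0 \<Longrightarrow> 0 \<le> y \<Longrightarrow> y < 1 \<Longrightarrow> sol d y = d"
  using sol_LIMSEQ[of y d] iter_const[of d] by (simp add: LIMSEQ_const_iff)

lemma sol_continuous: "continuous_on {0..<1} (sol d)"
proof -
  obtain C where C: "\<And>k y. 0 \<le> y \<Longrightarrow> y < 1 \<Longrightarrow> \<bar>sol d y - iter d k y\<bar> \<le> C * (1/2) ^ k * weight y"
    using sol_iter_bound[of d] by blast
  have "0 \<le> C * weight 0" using C[of 0 0] by simp
  then have C0: "C \<ge> 0" using weight_ge_1[of 0] by (simp add: zero_le_mult_iff)
  \<comment> \<open>The weight is unbounded near 1, so convergence is uniform only on compact
    subintervals; continuity is local and loses nothing.\<close>
  have "continuous_on {0..b} (sol d)" if "0 \<le> b" "b < 1" for b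
  proof (rule uniform_limit_theorem[where F=sequentially and f="iter d"])
    show "\<forall>\<^sub>F k in sequentially. continuous_on {0..b} (iter d k)"
      using that by (auto intro!: always_eventually continuous_on_subset[OF iter_continuous])
    show "uniform_limit {0..b} (iter d) (sol d) sequentially"
    proof (rule uniform_limitI)
      fix e :: real assume "e > 0"
      have "(\<lambda>k. C * (1/2) ^ k * weight b) \<longlonglongrightarrow> C * 0 * weight b"
        by (intro tendsto_intros LIMSEQ_power_zero) auto
      then have "\<forall>\<^sub>F k in sequentially. C * (1/2) ^ k * weight b < e"
        using \<open>e > 0\<close> by (auto dest: order_tendstoD)
      then show "\<forall>\<^sub>F k in sequentially. \<forall>x\<in>{0..b}. dist (iter d k x) (sol d x) < e"
      proof eventually_elim
        case (elim k)
        show ?case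
        proof
          fix x assume x: "x \<in> {0..b}"
          have "C * (1/2) ^ k * weight x \<le> C * (1/2) ^ k * weight b"
            using x that C0 by (intro mult_left_mono weight_mono) auto
          then show "dist (iter d k x) (sol d x) < e"
            using C[of x k] x that elim by (auto simp: dist_real_def abs_minus_commute)
        qed
      qed
    qed
  qed auto
  then have *: "continuous_on {0..b} (sol d)" if "b < 1" for b
    using that by (cases "0 \<le> b") auto
  show ?thesis
    unfolding continuous_on_eq_continuous_within
  proof
    fix y :: real assume y: "y \<in> {0..<1}"
    obtain b where b: "y < b" "b < 1" using y dense[of y 1] by auto
    have "at y within {0..b} = at y within {0..<1}"
      using y b by (intro at_within_nhd[where S="{..<b}"]) auto
    moreover have "continuous (at y within {0..b}) (sol d)"
      using *[OF b(2)] y b unfolding continuous_on_eq_continuous_within by simp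
    ultimately show "continuous (at y within {0..<1}) (sol d)" by simp
  qed
qed

lemma sol_fixed:
  assumes y: "0 \<le> y" "y < 1"
  shows "sol d y = step d (sol d) y"
proof -
  obtain C where C: "\<And>k y. 0 \<le> y \<Longrightarrow> y < 1 \<Longrightarrow> \<bar>sol d y - iter d k y\<bar> \<le> C * (1/2) ^ k * weight y"
    using sol_iter_bound[of d] by blast
  have "\<bar>step d (sol d) y - iter d (Suc k) y\<bar> \<le> \<bar>d - d\<bar> + C * (1/2) ^ k / 2 * weight y" for k
    unfolding iter.simps by (rule step_diff[OF sol_continuous iter_continuous y C])
  then have *: "\<bar>iter d (Suc k) y - step d (sol d) y\<bar> \<le> C * (1/2) ^ k / 2 * weight y" for k
    by (simp add: abs_minus_commute)
  have "(\<lambda>k. C * (1/2) ^ k / 2 * weight y) \<longlonglongrightarrow> C * 0 / 2 * weight y"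
    by (intro tendsto_intros LIMSEQ_power_zero) auto
  then have null: "(\<lambda>k. C * (1/2) ^ k / 2 * weight y) \<longlonglongrightarrow> 0" by simp
  have "(\<lambda>k. iter d (Suc k) y - step d (sol d) y) \<longlonglongrightarrow> 0"
    by (rule Lim_null_comparison[OF _ null]) (use * in \<open>simp del: iter.simps\<close>)
  then have "(\<lambda>k. iter d (Suc k) y) \<longlonglongrightarrow> step d (sol d) y" by (simp add: LIM_zero_iff)
  then show ?thesis using LIMSEQ_Suc[OF sol_LIMSEQ[OF y]] LIMSEQ_unique by blast
qed

lemma sol_0: "sol d 0 = d"
  using sol_fixed[of 0 d] by (simp add: step_def)

section \<open>The first-order system for the shots\<close>

abbreviation fl :: "real \<Rightarrow> real \<Rightarrow> real" where
  "fl d \<equiv> flux (sol d)"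

lemma sol_deriv:
  assumes "0 < y" "y < 1"
  shows "(sol d has_real_derivative fl d y / (1 - y)) (at y)"
proof -
  have "(step d (sol d) has_real_derivative fl d y / (1 - y)) (at y within {0<..<1})"
    by (rule DERIV_subset[OF step_deriv[OF sol_continuous]]) (use assms in auto)
  then have "(sol d has_real_derivative fl d y / (1 - y)) (at y within {0<..<1})"
  proof (rule has_field_derivative_transform_within[where d=1])
    show "step d (sol d) x = sol d x" if "x \<in> {0<..<1}" for x
      using that by (intro sol_fixed[symmetric]) auto
  qed (use assms in auto)
  then show ?thesis
    using assms at_within_open[of y "{0<..<1}"] by simp
qed

text \<open>In the variable \<open>x = sqrt y\<close> the flux times its integrating factor is an
  ordinary integral with a movable upper limit and integer powers, which makes it differentiable by
  the fundamental theorem.\<close>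

lemma flux_scaled:
  assumes u: "continuous_on {0..<1} u" and x: "0 < x" "x < 1"
  shows "x ^ n * flux u (x\<^sup>2) = 2 * integral {0..x} (\<lambda>t. t ^ (n - Suc 0) * h (u (t\<^sup>2)))"
proof -
  define g where "g t = t ^ (n - Suc 0) * h (u (t\<^sup>2))" for t
  have im: "(\<lambda>t. t / x) ` {0..x} = {0..1}"
  proof (intro equalityI subsetI)
    fix s :: real assume "s \<in> {0..1}"
    then show "s \<in> (\<lambda>t. t / x) ` {0..x}"
      using x by (intro image_eqI[of _ _ "s * x"]) (auto simp: mult_left_le_one_le)
  qed (use x in auto)
  have "integral {0..1} (\<lambda>s. g (x * s)) = integral {0..x} g / x"
    using integral_stretch_real[of x 0 x g] x by (simp add: im)
  moreover have "g (x * s) = x ^ (n - Suc 0) * (s ^ (n - Suc 0) * h (u (x\<^sup>2 * s\<^sup>2)))" for s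
    by (simp add: g_def power_mult_distrib)
  ultimately have "x ^ (n - Suc 0) * integral {0..1} (\<lambda>s. s ^ (n - Suc 0) * h (u (x\<^sup>2 * s\<^sup>2))) = integral {0..x} g / x"
    by simp
  moreover have "x ^ n = x * x ^ (n - Suc 0)" using n_ge by (simp add: power_eq_if)
  ultimately show ?thesis
    using x by (simp add: flux_def g_def[abs_def] field_simps)
qed

lemma flux_deriv:
  assumes u: "continuous_on {0..<1} u" and y: "0 < y" "y < 1"
  shows "(flux u has_real_derivative (h (u y) - n / 2 * flux u y) / y) (at y)"
proof -
  define J where "J x = 2 * integral {0..x} (\<lambda>t. t ^ (n - Suc 0) * h (u (t\<^sup>2)))" for x
  have sq: "sqrt y < 1" "0 < sqrt y" using y by auto
  obtain b where b: "sqrt y < b" "b < 1" using dense[OF sq(1)] by blast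
  have cg: "continuous_on {0..b} (\<lambda>t. t ^ (n - Suc 0) * h (u (t\<^sup>2)))"
    using b abs_square_less_1
    by (intro continuous_intros continuous_on_compose2[OF h_continuous[of UNIV]] continuous_on_compose2[OF u])
       (auto simp: abs_square_less_1)
  have "(J has_real_derivative 2 * (sqrt y ^ (n - Suc 0) * h (u ((sqrt y)\<^sup>2)))) (at (sqrt y) within {0..b})"
    unfolding J_def using sq b by (intro DERIV_cmult integral_has_real_derivative[OF cg]) auto
  moreover have "at (sqrt y) within {0..b} = at (sqrt y)"
    using sq b by (intro at_within_interior) auto
  ultimately have dJ: "(J has_real_derivative 2 * (sqrt y ^ (n - Suc 0) * h (u y))) (at (sqrt y))"
    using y by simp
  have "((\<lambda>x. J (sqrt x) / sqrt x ^ n) has_real_derivative (h (u y) - n / 2 * flux u y) / y) (at y)"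
  proof -
    have fx: "J (sqrt y) = sqrt y ^ n * flux u y"
      using flux_scaled[OF u sq(2,1)] y by (simp add: J_def)
    have "sqrt y ^ n = sqrt y * sqrt y ^ (n - Suc 0)" using n_ge by (simp add: power_eq_if)
    moreover have sq2: "sqrt y * (sqrt y * z) = y * z" for z using y by (simp flip: mult.assoc)
    moreover have "((\<lambda>x. J (sqrt x)) has_real_derivative
        2 * (sqrt y ^ (n - Suc 0) * h (u y)) * (inverse (sqrt y) / 2)) (at y)"
      using DERIV_chain2[where g=sqrt and x=y and s=UNIV, OF dJ DERIV_real_sqrt] y by simp
    ultimately show ?thesis
      using y n_ge fx
      by (auto intro!: derivative_eq_intros simp: field_simps sq2)
  qed
  then show ?thesis
  proof (rule has_field_derivative_transform_within_open[of _ _ _ "{0<..<1}"])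
    fix x :: real assume "x \<in> {0<..<1}"
    then show "J (sqrt x) / sqrt x ^ n = flux u x"
      using flux_scaled[OF u, of "sqrt x"] by (simp add: J_def field_simps)
  qed (use y in auto)
qed

lemma fl_deriv:
  assumes "0 < y" "y < 1"
  shows "(fl d has_real_derivative (h (sol d y) - n / 2 * fl d y) / y) (at y)"
  by (rule flux_deriv[OF sol_continuous assms])

end

section \<open>Tools for the end point y = 1\<close>

lemma first_zero:
  fixes f :: "real \<Rightarrow> real"
  assumes "continuous_on {a..b} f" "a \<le> b" "f a < 0" "f b \<ge> 0"
  obtains z where "a < z" "z \<le> b" "f z = 0" "\<And>x. a \<le> x \<Longrightarrow> x < z \<Longrightarrow> f x < 0"
proof -
  define S where "S = {x \<in> {a..b}. f x = 0}"
  have "closed S"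
    unfolding S_def using continuous_closed_preimage_constant[OF assms(1)] by auto
  moreover have "bounded S" unfolding S_def by (rule bounded_subset[of "{a..b}"]) auto
  ultimately have "compact S" by (simp add: compact_eq_bounded_closed)
  moreover obtain w where "w \<in> S"
    using IVT'[of f a 0 b] assms unfolding S_def by auto
  ultimately obtain z where z: "z \<in> S" "\<And>x. x \<in> S \<Longrightarrow> z \<le> x"
    using compact_attains_inf[of S] by blast
  have "f x < 0" if "a \<le> x" "x < z" for x
  proof (rule ccontr)
    assume "\<not> f x < 0"
    moreover have "x \<le> b" using that z(1) unfolding S_def by auto
    then have "continuous_on {a..x} f" by (intro continuous_on_subset[OF assms(1)]) auto
    ultimately have "\<exists>w\<ge>a. w \<le> x \<and> f w = 0"
      using assms that by (intro IVT') auto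
    then obtain w where "a \<le> w" "w \<le> x" "f w = 0" by blast
    then show False using z(2)[of w] that z(1) unfolding S_def by auto
  qed
  moreover have "a < z" using z(1) assms unfolding S_def by (cases "a = z") auto
  ultimately show thesis using that[of z] z(1) unfolding S_def by auto
qed

text \<open>The functions f + 2 C sqrt (1 - t) and f - 2 C sqrt (1 - t) are monotone, which replaces
  integrating the derivative bound.\<close>

lemma diff_bound_sqrt:
  fixes f f' :: "real \<Rightarrow> real"
  assumes "x \<le> y" "y < 1"
    and der: "\<And>t. x \<le> t \<Longrightarrow> t \<le> y \<Longrightarrow> (f has_real_derivative f' t) (at t)"
    and bound: "\<And>t. x \<le> t \<Longrightarrow> t \<le> y \<Longrightarrow> \<bar>f' t\<bar> \<le> C / sqrt (1 - t)"
  shows "\<bar>f x - f y\<bar> \<le> 2 * C * sqrt (1 - x)"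
proof -
  have "0 \<le> C / sqrt (1 - y)" using bound[of y] assms(1) by (meson abs_ge_zero order_refl order_trans)
  then have "C \<ge> 0" using assms(2) by (simp add: zero_le_divide_iff)
  have 1: "f y + 2 * C * sqrt (1 - y) \<le> f x + 2 * C * sqrt (1 - x)"
  proof (rule DERIV_nonpos_imp_nonincreasing[OF assms(1)])
    fix t assume t: "x \<le> t" "t \<le> y"
    have "((\<lambda>t. f t + 2 * C * sqrt (1 - t)) has_real_derivative f' t - C / sqrt (1 - t)) (at t)"
      using t assms(2) by (auto intro!: derivative_eq_intros der simp: field_simps)
    then show "\<exists>D. ((\<lambda>t. f t + 2 * C * sqrt (1 - t)) has_real_derivative D) (at t) \<and> D \<le> 0"
      using bound[OF t] by (intro exI conjI) auto
  qed
  have 2: "f x - 2 * C * sqrt (1 - x) \<le> f y - 2 * C * sqrt (1 - y)"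
  proof (rule DERIV_nonneg_imp_nondecreasing[OF assms(1)])
    fix t assume t: "x \<le> t" "t \<le> y"
    have "((\<lambda>t. f t - 2 * C * sqrt (1 - t)) has_real_derivative f' t + C / sqrt (1 - t)) (at t)"
      using t assms(2) by (auto intro!: derivative_eq_intros der simp: field_simps)
    then show "\<exists>D. ((\<lambda>t. f t - 2 * C * sqrt (1 - t)) has_real_derivative D) (at t) \<and> 0 \<le> D"
      using bound[OF t] by (intro exI conjI) auto
  qed
  have "0 \<le> 2 * C * sqrt (1 - y)" using \<open>C \<ge> 0\<close> assms by simp
  with 1 2 show ?thesis by linarith
qed

text \<open>From 1 + s \<le> 4 exp (s / 4) with s = - ln (1 - y). The square is there because the
  Gronwall estimate in \<open>nondegenerate\<close> meets the logarithm twice; any integrable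
  right-hand side would serve.\<close>

lemma ln_le_sqrt:
  assumes "0 \<le> y" "y < (1::real)"
  shows "(1 - ln (1 - y))\<^sup>2 \<le> 16 / sqrt (1 - y)"
proof -
  define t where "t = 1 - y"
  have t: "0 < t" "t \<le> 1" using assms by (auto simp: t_def)
  have l: "ln t \<le> 0" using t by simp
  have "1 - ln t \<le> 4 * exp (- ln t / 4)"
    using exp_ge_add_one_self[of "- ln t / 4"] l by linarith
  then have "(1 - ln t)\<^sup>2 \<le> (4 * exp (- ln t / 4))\<^sup>2"
    using l by (intro power_mono) auto
  also have "\<dots> = 16 * exp (- (ln t / 2))"
    by (simp add: power_mult_distrib flip: exp_double)
  also have "exp (- (ln t / 2)) = 1 / sqrt t"
    using t by (simp add: exp_minus inverse_eq_divide flip: ln_sqrt)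
  finally show ?thesis by (simp add: t_def)
qed

lemma sqrt_power_deriv:
  assumes "0 < y" "n > 0"
  shows "((\<lambda>y. sqrt y ^ n) has_real_derivative real n / 2 * sqrt y ^ n / y) (at y)"
proof -
  have "sqrt y ^ n = sqrt y * sqrt y ^ (n - Suc 0)" using assms by (simp add: power_eq_if)
  moreover have sq2: "sqrt y * (sqrt y * z) = y * z" for z using assms by (simp flip: mult.assoc)
  ultimately show ?thesis
    using assms by (auto intro!: derivative_eq_intros simp: field_simps sq2)
qed

text \<open>Freezing \<open>Z\<close> beyond \<open>b k\<close> gives continuous functions on the
  closed strip. The Hoelder bound is independent of the parameter, hence they are uniformly Cauchy
  and the limit is jointly continuous up to 1.\<close>

lemma continuous_extension_right_end:
  fixes Z :: "real \<times> 'b::topological_space \<Rightarrow> 'c::banach"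
  assumes cont: "continuous_on ({0..<1} \<times> D) Z"
    and holder: "\<And>x y d. d \<in> D \<Longrightarrow> 1/2 \<le> x \<Longrightarrow> x \<le> y \<Longrightarrow> y < 1 \<Longrightarrow> norm (Z (x, d) - Z (y, d)) \<le> K * sqrt (1 - x)"
  obtains E where "continuous_on ({0..1} \<times> D) E" "\<And>y d. 0 \<le> y \<Longrightarrow> y < 1 \<Longrightarrow> d \<in> D \<Longrightarrow> E (y, d) = Z (y, d)"
proof -
  define b where "b k = 1 - inverse (real (Suc k)) / 2" for k
  define F where "F k p = Z (min (fst p) (b k), snd p)" for k p
  have b: "1/2 \<le> b k" "b k < 1" for k by (auto simp: b_def field_simps)
  have bmono: "b j \<le> b k" if "j \<le> k" for j k using that by (auto simp: b_def field_simps)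
  have near: "norm (F j p - F k p) \<le> \<bar>K\<bar> * sqrt (inverse (real (Suc j)) / 2)" if "p \<in> {0..1} \<times> D" "j \<le> k" for j k p
  proof (cases "fst p \<le> b j")
    case True
    then have "fst p \<le> b k" using bmono[OF that(2)] by simp
    then show ?thesis using True by (simp add: F_def)
  next
    case False
    have "norm (Z (b j, snd p) - Z (min (fst p) (b k), snd p)) \<le> K * sqrt (1 - b j)"
      using that False b[of j] b[of k] bmono[OF that(2)] by (intro holder) (auto simp: min_def)
    also have "\<dots> \<le> \<bar>K\<bar> * sqrt (1 - b j)" by (intro mult_right_mono) (use b[of j] in auto)
    finally show ?thesis using False by (simp add: F_def b_def min_def)
  qed
  have small: "(\<lambda>j. \<bar>K\<bar> * sqrt (inverse (real (Suc j)) / 2)) \<longlonglongrightarrow> 0"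
  proof -
    have "(\<lambda>j. \<bar>K\<bar> * sqrt (inverse (real (Suc j)) / 2)) \<longlonglongrightarrow> \<bar>K\<bar> * sqrt (0 / 2)"
      by (intro tendsto_intros LIMSEQ_inverse_real_of_nat) auto
    then show ?thesis by simp
  qed
  have "uniformly_Cauchy_on ({0..1} \<times> D) F"
    unfolding uniformly_Cauchy_on_def
  proof (intro allI impI)
    fix e :: real assume "e > 0"
    then obtain N where N: "\<And>j. j \<ge> N \<Longrightarrow> \<bar>K\<bar> * sqrt (inverse (real (Suc j)) / 2) < e"
      using order_tendstoD(2)[OF small, of e] by (auto simp: eventually_sequentially)
    show "\<exists>M. \<forall>x\<in>{0..1} \<times> D. \<forall>m\<ge>M. \<forall>n\<ge>M. dist (F m x) (F n x) < e"
    proof (intro exI[of _ N] ballI allI impI)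
      fix p :: "real \<times> 'b" and m n :: nat assume p: "p \<in> {0..1} \<times> D" and mn: "N \<le> m" "N \<le> n"
      show "dist (F m p) (F n p) < e"
      proof (cases "m \<le> n")
        case True
        then show ?thesis using near[OF p, of m n] N[of m] mn by (simp add: dist_norm)
      next
        case False
        then show ?thesis using near[OF p, of n m] N[of n] mn by (simp add: dist_norm norm_minus_commute)
      qed
    qed
  qed
  then have "uniformly_convergent_on ({0..1} \<times> D) F" by (rule Cauchy_uniformly_convergent)
  then obtain E where E: "uniform_limit ({0..1} \<times> D) F E sequentially"
    by (auto simp: uniformly_convergent_on_def)
  have "continuous_on ({0..1} \<times> D) E"
  proof (rule uniform_limit_theorem[OF _ E])
    have "continuous_on ({0..1} \<times> D) (F k)" for k
      unfolding F_def
      by (rule continuous_on_compose2[OF cont]) (use b[of k] in \<open>auto intro!: continuous_intros\<close>)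
    then show "\<forall>\<^sub>F k in sequentially. continuous_on ({0..1} \<times> D) (F k)" by simp
  qed simp
  moreover have "E (y, d) = Z (y, d)" if "0 \<le> y" "y < 1" "d \<in> D" for y d
  proof -
    have "(\<lambda>k. F k (y, d)) \<longlonglongrightarrow> E (y, d)"
      using that by (intro tendsto_uniform_limitI[OF E]) auto
    moreover have "(\<lambda>k. F k (y, d)) \<longlonglongrightarrow> Z (y, d)"
    proof (rule tendsto_eventually)
      have "b \<longlonglongrightarrow> 1 - 0 / 2"
        unfolding b_def by (intro tendsto_intros LIMSEQ_inverse_real_of_nat) auto
      then have "\<forall>\<^sub>F k in sequentially. b k > y" using that by (intro order_tendstoD) auto
      then show "\<forall>\<^sub>F k in sequentially. F k (y, d) = Z (y, d)"
        by eventually_elim (simp add: F_def)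
    qed
    ultimately show ?thesis by (rule LIMSEQ_unique)
  qed
  ultimately show thesis by (rule that)
qed

section \<open>Nondegeneracy of the phase curve and positivity\<close>

context shooting
begin

abbreviation lg :: "real \<Rightarrow> real" where
  "lg y \<equiv> - ln (1 - y)"

definition res :: "real \<Rightarrow> real \<Rightarrow> real" where
  "res d y = 1 - sol d y + lg y * fl d y"

lemma fl_deriv_bound:
  assumes "0 < y" "y < 1"
  shows "\<bar>(h (sol d y) - n / 2 * fl d y) / y\<bar> \<le> 2 * B / y"
proof -
  have "fl d y \<le> 2 * B / n"
    using h_bounded by (intro flux_bound sol_continuous) (use assms in \<open>auto simp: abs_le_iff\<close>)
  moreover have "- fl d y \<le> 2 * B / n"
  proof -
    have "integral {0..1} (\<lambda>s. s ^ (n - Suc 0) * - B) \<le> integral {0..1} (\<lambda>s. s ^ (n - Suc 0) * h (sol d (y * s\<^sup>2)))"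
    proof (rule integral_le)
      show "s ^ (n - Suc 0) * - B \<le> s ^ (n - Suc 0) * h (sol d (y * s\<^sup>2))" if "s \<in> {0..1}" for s
        using that h_bounded by (intro mult_left_mono) (auto simp: abs_le_iff minus_le_iff)
      show "(\<lambda>s. s ^ (n - Suc 0) * - B) integrable_on {0..1}"
        by (intro integrable_continuous_real continuous_intros)
      show "(\<lambda>s. s ^ (n - Suc 0) * h (sol d (y * s\<^sup>2))) integrable_on {0..1}"
        using assms by (intro integrable_integrand sol_continuous) auto
    qed
    then show ?thesis by (simp add: flux_def integral_power_n)
  qed
  ultimately have "\<bar>n / 2 * fl d y\<bar> \<le> B"
    using n_ge by (simp add: abs_le_iff field_simps)
  then have "\<bar>h (sol d y) - n / 2 * fl d y\<bar> \<le> 2 * B"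
    using h_bounded[of "sol d y"] by linarith
  then show ?thesis using assms by (simp add: abs_mult divide_right_mono)
qed

lemma lg_deriv: "y < 1 \<Longrightarrow> (lg has_real_derivative 1 / (1 - y)) (at y)"
  by (auto intro!: derivative_eq_intros simp: field_simps)

text \<open>The singular terms \<open>fl d y / (1 - y)\<close> coming from \<open>sol\<close> and
  from the logarithm cancel; what remains is a logarithm times a bounded derivative.\<close>

lemma res_deriv:
  assumes "0 < y" "y < 1"
  shows "(res d has_real_derivative lg y * ((h (sol d y) - n / 2 * fl d y) / y)) (at y)"
proof -
  define m' where "m' = (h (sol d y) - n / 2 * fl d y) / y"
  have "(fl d has_real_derivative m') (at y)" unfolding m'_def by (rule fl_deriv[OF assms])
  then have "(res d has_real_derivative 0 - fl d y / (1 - y) + (1 / (1 - y) * fl d y + m' * lg y)) (at y)"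
    unfolding res_def[abs_def]
    by (intro DERIV_add DERIV_diff DERIV_const sol_deriv DERIV_mult lg_deriv assms)
  then show ?thesis by (simp add: m'_def mult.commute)
qed

text \<open>With the integrating factor y^(n/2) the derivative has the sign of the reaction, so sign
  information on \<open>h\<close> becomes monotonicity.\<close>

lemma fl_weighted_deriv:
  assumes "0 < y" "y < 1"
  shows "((\<lambda>y. sqrt y ^ n * fl d y) has_real_derivative sqrt y ^ n / y * h (sol d y)) (at y)"
proof -
  have "((\<lambda>y. sqrt y ^ n) has_real_derivative n / 2 * sqrt y ^ n / y) (at y)"
    using assms n_ge by (intro sqrt_power_deriv) auto
  from DERIV_mult[OF this fl_deriv[OF assms]] show ?thesis
    by (rule DERIV_cong) (use assms in \<open>simp add: field_simps\<close>)
qed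

text \<open>A quantitative form of uniqueness for the singular problem: a shot cannot approach the
  rest point \<open>e\<close> in the regularized coordinates, not even in the limit
  \<open>y = 1\<close>. It is used with \<open>e = 1\<close> to define the angle and with
  \<open>e = 0\<close> for positivity.\<close>

lemma nondegenerate:
  assumes e: "h e = 0" "d \<noteq> e" and y: "0 < y" "y < 1"
  shows "\<exists>c>0. \<forall>x. y \<le> x \<longrightarrow> x < 1 \<longrightarrow> (sol d x - e - lg x * fl d x)\<^sup>2 + (fl d x)\<^sup>2 \<ge> c"
proof -
  define r where "r x = sol d x - e - lg x * fl d x" for x
  define m' where "m' x = (h (sol d x) - n / 2 * fl d x) / x" for x
  define G where "G x = (r x)\<^sup>2 + (fl d x)\<^sup>2" for x
  \<comment> \<open>If \<open>G\<close> vanished near 0, the shot would equal \<open>e\<close>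
    there, and by continuity its initial value would be \<open>e\<close>.\<close>
  obtain y0 where y0: "0 < y0" "y0 \<le> y" "G y0 > 0"
  proof (rule ccontr)
    assume "\<not> thesis"
    then have G0: "G x \<le> 0" if "0 < x" "x \<le> y" for x
      using that not_less \<open>\<And>y0. \<lbrakk>0 < y0; y0 \<le> y; 0 < G y0\<rbrakk> \<Longrightarrow> thesis\<close> by metis
    have "sol d x = e" if "x \<in> {0<..y}" for x
    proof -
      have "r x = 0" "fl d x = 0"
        using G0[of x] that by (auto simp: G_def sum_power2_le_zero_iff)
      then show ?thesis by (simp add: r_def)
    qed
    then have "(sol d \<longlongrightarrow> e) (at 0 within {0<..y})"
      by (intro tendsto_eventually) (auto simp: eventually_at_filter)
    moreover have "(sol d \<longlongrightarrow> sol d 0) (at 0 within {0..<1})"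
      using sol_continuous[of d] unfolding continuous_on_def by (rule bspec) simp
    then have "(sol d \<longlongrightarrow> sol d 0) (at 0 within {0<..y})"
      by (rule tendsto_within_subset) (use y in auto)
    moreover have "at 0 within {0<..y} \<noteq> bot"
    proof -
      have "at 0 within {0<..y} = at_right (0::real)"
        using y by (intro at_within_nhd[where S="{..<y}"]) auto
      then show ?thesis by simp
    qed
    ultimately have "sol d 0 = e" using tendsto_unique by blast
    then show False using e sol_0 by simp
  qed
  \<comment> \<open>64 = 2 * 16 * 2: the derivative of a square, the constant of
    \<open>ln_le_sqrt\<close>, and (R + M)^2 \<le> 2 (R^2 + M^2).\<close>
  define K where "K = 64 * (L + n / 2) / y0"
  have Gd: "(G has_real_derivative 2 * r x * (- lg x * m' x) + 2 * fl d x * m' x) (at x)" if "0 < x" "x < 1" for x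
  proof -
    have "(r has_real_derivative - lg x * m' x) (at x)"
    proof -
      have "((\<lambda>x. 1 - e - res d x) has_real_derivative 0 - lg x * m' x) (at x)"
        unfolding m'_def by (intro DERIV_diff DERIV_const res_deriv that)
      moreover have "(\<lambda>x. 1 - e - res d x) = r" by (auto simp: r_def res_def)
      ultimately show ?thesis by simp
    qed
    then show ?thesis
      unfolding G_def[abs_def] m'_def
      by (auto intro!: derivative_eq_intros fl_deriv that simp: mult_ac)
  qed
  have Gb: "\<bar>2 * r x * (- lg x * m' x) + 2 * fl d x * m' x\<bar> \<le> K / sqrt (1 - x) * G x" if "y0 \<le> x" "x < 1" for x
  proof -
    define s where "s = lg x"
    have x: "0 < x" "x < 1" using that y0 by auto
    have s: "s \<ge> 0" using x by (simp add: s_def)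
    have "\<bar>h (sol d x)\<bar> \<le> L * \<bar>sol d x - e\<bar>" using h_lipschitz[of "sol d x" e] e by simp
    also have "sol d x - e = r x + s * fl d x" by (simp add: r_def s_def)
    also have "\<bar>\<dots>\<bar> \<le> \<bar>r x\<bar> + s * \<bar>fl d x\<bar>" using s by (simp add: abs_mult order_trans[OF abs_triangle_ineq])
    finally have hb: "\<bar>h (sol d x)\<bar> \<le> L * (\<bar>r x\<bar> + s * \<bar>fl d x\<bar>)" using L_pos by simp
    define R M where "R = \<bar>r x\<bar>" and "M = \<bar>fl d x\<bar>"
    have RM: "R \<ge> 0" "M \<ge> 0" by (auto simp: R_def M_def)
    have "\<bar>h (sol d x) - n / 2 * fl d x\<bar> \<le> L * (R + s * M) + n / 2 * M"
      using hb by (simp add: R_def M_def abs_mult order_trans[OF abs_triangle_ineq4])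
    also have "\<dots> \<le> (L + n / 2) * ((1 + s) * (R + M))"
    proof -
      have "0 \<le> L * (M + s * R) + n / 2 * (R + s * M + s * R)"
        using RM s L_pos by auto
      then show ?thesis by (simp add: algebra_simps)
    qed
    finally have "\<bar>m' x\<bar> \<le> (L + n / 2) * ((1 + s) * (R + M)) / x"
      using x by (simp add: m'_def divide_right_mono)
    also have "\<dots> \<le> (L + n / 2) * ((1 + s) * (R + M)) / y0"
      using that y0 RM s L_pos by (intro divide_left_mono) auto
    finally have m'b: "\<bar>m' x\<bar> \<le> (L + n / 2) / y0 * ((1 + s) * (R + M))" by simp
    have "\<bar>2 * r x * (- lg x * m' x) + 2 * fl d x * m' x\<bar> \<le> 2 * (s * R + M) * \<bar>m' x\<bar>"
    proof -
      have "2 * r x * (- lg x * m' x) + 2 * fl d x * m' x = 2 * (fl d x - s * r x) * m' x"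
        by (simp add: s_def algebra_simps)
      moreover have "\<bar>fl d x - s * r x\<bar> \<le> s * R + M"
        using s abs_triangle_ineq4[of "fl d x" "s * r x"] by (simp add: R_def M_def abs_mult)
      ultimately show ?thesis by (simp add: abs_mult mult_right_mono)
    qed
    also have "\<dots> \<le> 2 * ((1 + s) * (R + M)) * ((L + n / 2) / y0 * ((1 + s) * (R + M)))"
    proof (intro mult_mono m'b)
      show "s * R + M \<le> (1 + s) * (R + M)" using RM s by (simp add: algebra_simps)
    qed (use RM s in auto)
    also have "\<dots> = 2 * ((L + n / 2) / y0) * ((1 + s)\<^sup>2 * (R + M)\<^sup>2)"
    proof -
      have "2 * X * (c * X) = 2 * c * X\<^sup>2" for X c :: real by (simp add: power2_eq_square)
      then show ?thesis by (simp only: power_mult_distrib)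
    qed
    also have "\<dots> \<le> 2 * ((L + n / 2) / y0) * (16 / sqrt (1 - x) * (2 * G x))"
    proof (intro mult_left_mono mult_mono)
      show "(1 + s)\<^sup>2 \<le> 16 / sqrt (1 - x)" using ln_le_sqrt[of x] x by (simp add: s_def)
      have "(R + M)\<^sup>2 = 2 * (R\<^sup>2 + M\<^sup>2) - (R - M)\<^sup>2"
        by (simp add: power2_eq_square algebra_simps)
      also have "\<dots> \<le> 2 * (R\<^sup>2 + M\<^sup>2)" by simp
      also have "R\<^sup>2 + M\<^sup>2 = G x" by (simp add: G_def R_def M_def)
      finally show "(R + M)\<^sup>2 \<le> 2 * G x" .
    qed (use y0 L_pos x in auto)
    finally show ?thesis by (simp add: K_def field_simps)
  qed
  \<comment> \<open>Gronwall with the integrating factor exp (- 2 K sqrt (1 - x)). Its logarithmic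
    derivative K / sqrt (1 - x) is integrable at 1, so nothing is lost in the limit.\<close>
  have mono: "G y0 * exp (- 2 * K * sqrt (1 - y0)) \<le> G x * exp (- 2 * K * sqrt (1 - x))" if "y0 \<le> x" "x < 1" for x
  proof (rule DERIV_nonneg_imp_nondecreasing[OF that(1)])
    fix t assume t: "y0 \<le> t" "t \<le> x"
    then have t1: "0 < t" "t < 1" using that y0 by auto
    define g where "g = 2 * r t * (- lg t * m' t) + 2 * fl d t * m' t"
    have "(G has_real_derivative g) (at t)" unfolding g_def by (rule Gd[OF t1])
    moreover have "((\<lambda>x. exp (- 2 * K * sqrt (1 - x))) has_real_derivative
        K / sqrt (1 - t) * exp (- 2 * K * sqrt (1 - t))) (at t)"
      using t1 by (auto intro!: derivative_eq_intros simp: field_simps)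
    ultimately have "((\<lambda>x. G x * exp (- 2 * K * sqrt (1 - x))) has_real_derivative
        g * exp (- 2 * K * sqrt (1 - t)) + K / sqrt (1 - t) * exp (- 2 * K * sqrt (1 - t)) * G t) (at t)"
      by (rule DERIV_mult)
    then have "((\<lambda>x. G x * exp (- 2 * K * sqrt (1 - x))) has_real_derivative
        (g + K / sqrt (1 - t) * G t) * exp (- 2 * K * sqrt (1 - t))) (at t)"
      by (simp add: ring_distribs mult_ac)
    moreover have "g + K / sqrt (1 - t) * G t \<ge> 0" using Gb[of t] t t1 by (simp add: g_def)
    ultimately show "\<exists>D. ((\<lambda>x. G x * exp (- 2 * K * sqrt (1 - x))) has_real_derivative D) (at t) \<and> 0 \<le> D"
      by (intro exI[of _ "(g + K / sqrt (1 - t) * G t) * exp (- 2 * K * sqrt (1 - t))"]) simp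
  qed
  have "G x \<ge> G y0 * exp (- 2 * K * sqrt (1 - y0))" if "y \<le> x" "x < 1" for x
  proof -
    have "K \<ge> 0" using y0 L_pos by (simp add: K_def)
    then have "exp (- 2 * K * sqrt (1 - x)) \<le> 1" using that by simp
    then have "G x * exp (- 2 * K * sqrt (1 - x)) \<le> G x"
      by (intro mult_left_le) (auto simp: G_def)
    then show ?thesis using mono[of x] that y0 by linarith
  qed
  then show ?thesis
    using y0 by (intro exI[of _ "G y0 * exp (- 2 * K * sqrt (1 - y0))"]) (auto simp: G_def r_def)
qed

lemma fl_continuous: "continuous_on {0..<1} (fl d)"
  by (rule flux_continuous[OF sol_continuous])

text \<open>As long as the flux is negative the shot decreases, so it stays nonpositive, where
  \<open>h\<close> is nonpositive; then the weighted flux decreases as well, which in turn prevents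
  a first zero of the flux.\<close>

lemma negative_forever:
  assumes y1: "0 < y1" "y1 < 1" "sol d y1 \<le> 0" "fl d y1 < 0" and y: "y1 \<le> y" "y < 1"
  shows "sqrt y ^ n * fl d y \<le> sqrt y1 ^ n * fl d y1"
proof -
  have main: "sqrt z ^ n * fl d z \<le> sqrt y1 ^ n * fl d y1"
    if z: "y1 \<le> z" "z < 1" and neg: "\<And>x. y1 \<le> x \<Longrightarrow> x < z \<Longrightarrow> fl d x < 0" for z
  proof (rule DERIV_nonpos_imp_decreasing_open[OF z(1)])
    fix x assume x: "y1 < x" "x < z"
    have "sol d x \<le> sol d y1"
    proof (rule DERIV_nonpos_imp_nonincreasing[where f="sol d"])
      fix t assume t: "y1 \<le> t" "t \<le> x"
      then have "fl d t / (1 - t) \<le> 0" using neg[of t] x z by (simp add: divide_nonpos_pos)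
      then show "\<exists>D. (sol d has_real_derivative D) (at t) \<and> D \<le> 0"
        using sol_deriv[of t d] t x z y1 by (intro exI[of _ "fl d t / (1 - t)"]) auto
    qed (use x in auto)
    then have "h (sol d x) \<le> 0" using y1 h_neg[of "sol d x"] h_0 by (cases "sol d x = 0") auto
    then have "sqrt x ^ n / x * h (sol d x) \<le> 0" using x y1 by (intro mult_nonneg_nonpos) auto
    then show "\<exists>D. ((\<lambda>y. sqrt y ^ n * fl d y) has_real_derivative D) (at x) \<and> D \<le> 0"
      using fl_weighted_deriv[of x d] x z y1 by (intro exI[of _ "sqrt x ^ n / x * h (sol d x)"]) auto
  next
    show "continuous_on {y1..z} (\<lambda>y. sqrt y ^ n * fl d y)"
      using y1 z by (intro continuous_intros continuous_on_subset[OF fl_continuous]) auto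
  qed
  show ?thesis
  proof (cases "\<exists>x. y1 \<le> x \<and> x < y \<and> fl d x \<ge> 0")
    case True
    then obtain w where w: "y1 \<le> w" "w < y" "fl d w \<ge> 0" by blast
    have "continuous_on {y1..w} (fl d)"
      using w y1 y by (intro continuous_on_subset[OF fl_continuous]) auto
    from first_zero[OF this w(1) y1(4) w(3)]
    obtain z where z: "y1 < z" "z \<le> w" "fl d z = 0" "\<And>x. y1 \<le> x \<Longrightarrow> x < z \<Longrightarrow> fl d x < 0"
      by blast
    have "sqrt z ^ n * fl d z \<le> sqrt y1 ^ n * fl d y1" using main[of z] z w y by auto
    moreover have "sqrt y1 ^ n * fl d y1 < 0" using y1 by (simp add: mult_pos_neg)
    ultimately show ?thesis using z by simp
  next
    case False
    then show ?thesis using main[OF y] by (meson not_less)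
  qed
qed

text \<open>At the first zero of the shot the flux is at most 0, since the shot comes from above,
  and it is not 0 by \<open>nondegenerate\<close> with \<open>e = 0\<close>. From there on
  \<open>negative_forever\<close> applies, with a bound uniform up to 1.\<close>

lemma nonpositive_imp_flux_negative:
  assumes "d > 0" "0 \<le> y" "y < 1" "sol d y \<le> 0"
  shows "\<exists>c<0. \<forall>x. y \<le> x \<longrightarrow> x < 1 \<longrightarrow> sqrt x ^ n * fl d x \<le> c"
proof -
  have "continuous_on {0..y} (\<lambda>x. - sol d x)"
    using assms by (intro continuous_intros continuous_on_subset[OF sol_continuous]) auto
  from first_zero[OF this] obtain z where z: "0 < z" "z \<le> y" "sol d z = 0" "\<And>x. 0 \<le> x \<Longrightarrow> x < z \<Longrightarrow> - sol d x < 0"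
    using assms sol_0[of d] by auto
  then have z1: "z < 1" using assms by simp
  have "fl d z / (1 - z) \<le> 0"
  proof (rule ccontr)
    assume "\<not> ?thesis"
    then have "0 < fl d z / (1 - z)" by simp
    from DERIV_pos_inc_left[OF sol_deriv[OF z(1) z1] this]
    obtain \<epsilon> where "\<epsilon> > 0" "\<And>k. 0 < k \<Longrightarrow> k < \<epsilon> \<Longrightarrow> sol d (z - k) < sol d z"
      by blast
    define k where "k = min (\<epsilon> / 2) (z / 2)"
    have "0 < k" "k < \<epsilon>" "k < z" using \<open>\<epsilon> > 0\<close> z(1) by (auto simp: k_def min_def)
    then show False
      using \<open>\<And>k. 0 < k \<Longrightarrow> k < \<epsilon> \<Longrightarrow> sol d (z - k) < sol d z\<close>[of k] z(3) z(4)[of "z - k"] by simp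
  qed
  then have "fl d z \<le> 0" using z1 by (simp add: divide_le_0_iff)
  moreover have "fl d z \<noteq> 0"
    using nondegenerate[OF h_0, of d z] z z1 assms by auto
  ultimately have neg: "fl d z < 0" by simp
  show ?thesis
  proof (intro exI[of _ "sqrt z ^ n * fl d z"] conjI allI impI)
    show "sqrt z ^ n * fl d z < 0" using neg z by (simp add: mult_pos_neg)
    show "sqrt x ^ n * fl d x \<le> sqrt z ^ n * fl d z" if "y \<le> x" "x < 1" for x
      using z that z1 neg by (intro negative_forever) auto
  qed
qed

lemma positive_at_critical_point:
  assumes "d > 0" "0 < y" "y < 1" "fl d y = 0"
  shows "sol d y > 0"
proof (rule ccontr)
  assume "\<not> ?thesis"
  then obtain c where "c < 0" "\<forall>x. y \<le> x \<longrightarrow> x < 1 \<longrightarrow> sqrt x ^ n * fl d x \<le> c"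
    using nonpositive_imp_flux_negative[of d y] assms by auto
  then show False using assms by auto
qed

lemma regular_imp_positive:
  assumes "d > 0" "(fl d \<longlongrightarrow> 0) (at_left 1)" "0 \<le> y" "y < 1"
  shows "sol d y > 0"
proof (rule ccontr)
  assume "\<not> ?thesis"
  then obtain c where c: "c < 0" "\<forall>x. y \<le> x \<longrightarrow> x < 1 \<longrightarrow> sqrt x ^ n * fl d x \<le> c"
    using nonpositive_imp_flux_negative[of d y] assms by auto
  have "((\<lambda>x. sqrt x ^ n * fl d x) \<longlongrightarrow> sqrt 1 ^ n * 0) (at_left 1)"
    by (intro tendsto_intros assms)
  moreover have "\<forall>\<^sub>F x in at_left 1. sqrt x ^ n * fl d x \<le> c"
    using c eventually_at_left_real[of y 1] assms by (auto elim!: eventually_mono)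
  ultimately have "sqrt 1 ^ n * 0 \<le> c" by (intro tendsto_upperbound) auto
  then show False using c by simp
qed

end

section \<open>The phase angle\<close>

lemma cos_pos_imp_abs_less_pi_half:
  fixes f :: "real \<Rightarrow> real"
  assumes "continuous_on {a..b} f" "f a = 0" "\<And>x. a \<le> x \<Longrightarrow> x \<le> b \<Longrightarrow> cos (f x) > 0" "a \<le> x" "x \<le> b"
  shows "\<bar>f x\<bar> < pi / 2"
proof (rule ccontr)
  assume "\<not> ?thesis"
  moreover have cont: "continuous_on {a..x} (\<lambda>x. \<bar>f x\<bar>)"
    using assms(5) by (intro continuous_on_rabs continuous_on_subset[OF assms(1)]) auto
  ultimately have "\<exists>z\<ge>a. z \<le> x \<and> \<bar>f z\<bar> = pi / 2"
    using assms by (intro IVT') auto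
  then obtain z where z: "a \<le> z" "z \<le> x" "\<bar>f z\<bar> = pi / 2" by blast
  then have "f z = pi / 2 \<or> f z = - (pi / 2)" by linarith
  then have "cos (f z) = 0" by (elim disjE) (simp_all only: cos_pi_half cos_minus)
  then show False using assms(3)[of z] z assms(5) by simp
qed

context shooting
begin

text \<open>Continuity in y for fixed d, together with a Lipschitz bound in d whose constant is
  locally bounded in y.\<close>

lemma jointly_continuous:
  fixes f :: "real \<Rightarrow> real \<Rightarrow> real"
  assumes cont: "\<And>d. continuous_on {0..<1} (f d)"
    and lip: "\<And>d d' y. 0 \<le> y \<Longrightarrow> y < 1 \<Longrightarrow> \<bar>f d y - f d' y\<bar> \<le> C * \<bar>d - d'\<bar> * weight y"
  shows "continuous_on ({0..<1} \<times> UNIV) (\<lambda>p. f (snd p) (fst p))"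
  unfolding continuous_on_def
proof
  fix p0 :: "real \<times> real" assume p0: "p0 \<in> {0..<1} \<times> UNIV"
  let ?F = "at p0 within {0..<1} \<times> UNIV"
  have "continuous_on ({0..<1} \<times> UNIV) (\<lambda>p. f (snd p0) (fst p))"
    by (rule continuous_on_compose2[OF cont]) (auto intro!: continuous_intros)
  then have 1: "((\<lambda>p. f (snd p0) (fst p)) \<longlongrightarrow> f (snd p0) (fst p0)) ?F"
    using p0 unfolding continuous_on_def by (rule bspec)
  have "continuous_on ({0..<1} \<times> UNIV) (\<lambda>p. C * \<bar>snd p - snd p0\<bar> * weight (fst p))"
    unfolding weight_def by (intro continuous_intros) auto
  then have "((\<lambda>p. C * \<bar>snd p - snd p0\<bar> * weight (fst p)) \<longlongrightarrow> C * \<bar>snd p0 - snd p0\<bar> * weight (fst p0)) ?F"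
    using p0 unfolding continuous_on_def by (rule bspec)
  then have null: "((\<lambda>p. C * \<bar>snd p - snd p0\<bar> * weight (fst p)) \<longlongrightarrow> 0) ?F" by simp
  have "((\<lambda>p. f (snd p) (fst p) - f (snd p0) (fst p)) \<longlongrightarrow> 0) ?F"
  proof (rule Lim_null_comparison[OF _ null])
    show "\<forall>\<^sub>F p in ?F. norm (f (snd p) (fst p) - f (snd p0) (fst p)) \<le> C * \<bar>snd p - snd p0\<bar> * weight (fst p)"
      unfolding eventually_at_filter using lip by (intro always_eventually) auto
  qed
  from tendsto_add[OF this 1]
  show "((\<lambda>p. f (snd p) (fst p)) \<longlongrightarrow> f (snd p0) (fst p0)) ?F" by simp
qed

lemma fl_dependence:
  assumes "0 \<le> y" "y < 1"
  shows "\<bar>fl d y - fl d' y\<bar> \<le> (4 * L / n) * \<bar>d - d'\<bar> * weight y"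
proof -
  have "\<bar>fl d y - fl d' y\<bar> \<le> 2 * L / n * (2 * \<bar>d - d'\<bar> * weight y)"
  proof (rule flux_diff[OF sol_continuous sol_continuous assms])
    fix x assume x: "0 \<le> x" "x \<le> y"
    then have "\<bar>sol d x - sol d' x\<bar> \<le> 2 * \<bar>d - d'\<bar> * weight x" using sol_dependence assms by auto
    also have "\<dots> \<le> 2 * \<bar>d - d'\<bar> * weight y" using weight_mono[of x y] x assms by (intro mult_left_mono) auto
    finally show "\<bar>sol d x - sol d' x\<bar> \<le> 2 * \<bar>d - d'\<bar> * weight y" .
  qed
  then show ?thesis by (simp add: mult_ac)
qed

lemma fl_const:
  assumes "h d = 0" "0 \<le> y" "y < 1"
  shows "fl d y = 0"
proof -
  have "integral {0..1} (\<lambda>s. s ^ (n - Suc 0) * h (sol d (y * s\<^sup>2))) = integral {0..1} (\<lambda>s::real. 0::real)"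
  proof (rule integral_cong)
    fix s :: real assume "s \<in> {0..1}"
    then have "0 \<le> y * s\<^sup>2" "y * s\<^sup>2 < 1"
      using assms mult_left_le[of "s\<^sup>2" y] by (auto simp: power_le_one)
    then show "s ^ (n - Suc 0) * h (sol d (y * s\<^sup>2)) = 0" using sol_const[OF assms(1)] assms(1) by simp
  qed
  then show ?thesis by (simp add: flux_def)
qed

text \<open>Both derivatives are at most a logarithm times a bounded function near 1, hence bounded
  by a multiple of 1 / sqrt (1 - t) with a constant free of d. The extension is thus jointly
  continuous up to \<open>y = 1\<close>, as the intermediate value argument in d requires.\<close>

lemma phase_extension:
  obtains E where "continuous_on ({0..1} \<times> UNIV) E"
    "\<And>y d. 0 \<le> y \<Longrightarrow> y < 1 \<Longrightarrow> E (y, d) = Complex (res d y) (fl d y)"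
proof -
  have sol_joint: "continuous_on ({0..<1} \<times> UNIV) (\<lambda>p. sol (snd p) (fst p))"
    by (rule jointly_continuous[OF sol_continuous sol_dependence])
  have fl_joint: "continuous_on ({0..<1} \<times> UNIV) (\<lambda>p. fl (snd p) (fst p))"
    by (rule jointly_continuous[OF fl_continuous fl_dependence])
  have "continuous_on ({0..<1} \<times> UNIV) (\<lambda>p. Complex (res (snd p) (fst p)) (fl (snd p) (fst p)))"
    unfolding res_def by (intro continuous_intros sol_joint fl_joint) auto
  \<comment> \<open>On [1/2, 1) the flux has derivative at most 4 B; the factor 16 of
    \<open>ln_le_sqrt\<close> makes it 64 B, integration doubles it, and there are two
    components.\<close>
  moreover have "norm (Complex (res d x) (fl d x) - Complex (res d y) (fl d y)) \<le> (256 * B) * sqrt (1 - x)"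
    if "1/2 \<le> x" "x \<le> y" "y < 1" for x y d
  proof -
    have lgb: "1 \<le> (1 + lg t)\<^sup>2" "lg t \<le> (1 + lg t)\<^sup>2" "(1 + lg t)\<^sup>2 \<le> 16 / sqrt (1 - t)" "0 \<le> lg t" if "0 \<le> t" "t < 1" for t
    proof -
      show l: "0 \<le> lg t" using that by simp
      show "1 \<le> (1 + lg t)\<^sup>2" using l by (intro one_le_power) auto
      have "1 + lg t \<le> (1 + lg t)\<^sup>2" using l by (intro self_le_power) auto
      then show "lg t \<le> (1 + lg t)\<^sup>2" by linarith
      show "(1 + lg t)\<^sup>2 \<le> 16 / sqrt (1 - t)" using ln_le_sqrt[OF that] by simp
    qed
    have mb: "\<bar>(h (sol d t) - n / 2 * fl d t) / t\<bar> \<le> 4 * B" if "x \<le> t" "t \<le> y" for t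
    proof -
      have "\<bar>(h (sol d t) - n / 2 * fl d t) / t\<bar> \<le> 2 * B / t" using that \<open>1/2 \<le> x\<close> \<open>y < 1\<close> by (intro fl_deriv_bound) auto
      also have "\<dots> \<le> 2 * B / (1/2)" using that \<open>1/2 \<le> x\<close> B_pos by (intro divide_left_mono) auto
      finally show ?thesis by simp
    qed
    have "\<bar>fl d x - fl d y\<bar> \<le> 2 * (64 * B) * sqrt (1 - x)"
    proof (rule diff_bound_sqrt[OF that(2,3)])
      fix t assume t: "x \<le> t" "t \<le> y"
      show "(fl d has_real_derivative (h (sol d t) - n / 2 * fl d t) / t) (at t)"
        using t that by (intro fl_deriv) auto
      have "4 * B * 1 \<le> 4 * B * (16 / sqrt (1 - t))"
        using t that B_pos by (intro mult_left_mono order_trans[OF lgb(1) lgb(3)]) auto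
      then show "\<bar>(h (sol d t) - n / 2 * fl d t) / t\<bar> \<le> 64 * B / sqrt (1 - t)"
        using mb[OF t] by simp
    qed
    moreover have "\<bar>res d x - res d y\<bar> \<le> 2 * (64 * B) * sqrt (1 - x)"
    proof (rule diff_bound_sqrt[OF that(2,3)])
      fix t assume t: "x \<le> t" "t \<le> y"
      show "(res d has_real_derivative lg t * ((h (sol d t) - n / 2 * fl d t) / t)) (at t)"
        using t that by (intro res_deriv) auto
      have "lg t * \<bar>(h (sol d t) - n / 2 * fl d t) / t\<bar> \<le> 16 / sqrt (1 - t) * (4 * B)"
        using t that lgb[of t] by (intro mult_mono mb) auto
      then show "\<bar>lg t * ((h (sol d t) - n / 2 * fl d t) / t)\<bar> \<le> 64 * B / sqrt (1 - t)"
        using t that lgb[of t] by (simp add: abs_mult)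
    qed
    moreover have "norm (Complex (res d x) (fl d x) - Complex (res d y) (fl d y)) \<le> \<bar>res d x - res d y\<bar> + \<bar>fl d x - fl d y\<bar>"
      using cmod_le[of "Complex (res d x - res d y) (fl d x - fl d y)"] by (simp add: minus_complex.ctr)
    ultimately show ?thesis by simp
  qed
  ultimately have "\<exists>E. continuous_on ({0..1} \<times> UNIV) E \<and>
      (\<forall>y d. 0 \<le> y \<longrightarrow> y < 1 \<longrightarrow> E (y, d) = Complex (res d y) (fl d y))"
    by (rule_tac continuous_extension_right_end[of UNIV "\<lambda>p. Complex (res (snd p) (fst p)) (fl (snd p) (fst p))" "256 * B"])
       auto
  then show thesis using that by blast
qed

text \<open>Staying away from \<open>d = 1\<close> keeps the phase curve off the origin on the whole
  closed rectangle, including the edge \<open>y = 1\<close>. The rectangle is contractible, so the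
  curve has a continuous logarithm and the angle is defined jointly in y and d.\<close>

lemma phase_angle:
  assumes d1: "0 < d1" "d1 < 1"
  obtains \<theta> \<rho> where "continuous_on ({0..1} \<times> {0..d1}) \<theta>"
    "\<And>y d. 0 \<le> y \<Longrightarrow> y < 1 \<Longrightarrow> 0 \<le> d \<Longrightarrow> d \<le> d1 \<Longrightarrow>
       \<rho> (y, d) > 0 \<and> res d y = \<rho> (y, d) * cos (\<theta> (y, d)) \<and> fl d y = \<rho> (y, d) * sin (\<theta> (y, d))"
    "\<And>d. 0 \<le> d \<Longrightarrow> d \<le> d1 \<Longrightarrow> sin (\<theta> (1, d)) = 0 \<Longrightarrow> (fl d \<longlongrightarrow> 0) (at_left 1)"
    "\<bar>\<theta> (0, d1)\<bar> < pi / 2" "\<bar>\<theta> (1, 0)\<bar> < pi / 2"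
proof -
  obtain E where E: "continuous_on ({0..1} \<times> UNIV) E"
    "\<And>y d. 0 \<le> y \<Longrightarrow> y < 1 \<Longrightarrow> E (y, d) = Complex (res d y) (fl d y)"
    using phase_extension by blast
  have E1: "((\<lambda>y. E (y, d)) \<longlongrightarrow> E (1, d)) (at_left 1)" for d
  proof -
    have "continuous_on {0..1} (\<lambda>y. E (y, d))"
      by (rule continuous_on_compose2[OF E(1)]) (auto intro!: continuous_intros)
    then have "((\<lambda>y. E (y, d)) \<longlongrightarrow> E (1, d)) (at 1 within {0..1})" by (auto simp: continuous_on_def)
    moreover have "at 1 within {0..1} = at_left (1::real)" by (rule at_within_Icc_at_left) simp
    ultimately show ?thesis by simp
  qed
  have near1: "\<forall>\<^sub>F y in at_left (1::real). y0 < y \<and> y < 1" if "y0 < 1" for y0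
    using eventually_at_left_real[OF that] by (auto elim!: eventually_mono)
  have E_nz: "E p \<noteq> 0" if p: "p \<in> {0..1} \<times> {0..d1}" for p
  proof -
    obtain y d where p': "p = (y, d)" "0 \<le> y" "y \<le> 1" "0 \<le> d" "d \<le> d1" using p by auto
    have low: "\<exists>c>0. \<forall>x. z \<le> x \<longrightarrow> x < 1 \<longrightarrow> (norm (E (x, d)))\<^sup>2 \<ge> c" if "0 < z" "z < 1" for z
    proof -
      have "(sol d x - 1 - lg x * fl d x)\<^sup>2 = (res d x)\<^sup>2" for x
        by (simp add: res_def power2_eq_square algebra_simps)
      then show ?thesis
        using nondegenerate[OF h_1 _ that, of d] that E(2) p' d1 by (auto simp: cmod_power2)
    qed
    consider "y = 0" | "0 < y" "y < 1" | "y = 1" using p' by linarith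
    then show ?thesis
    proof cases
      case 1
      then have "Re (E p) = 1 - d" using E(2)[of 0 d] p' by (simp add: res_def sol_0)
      then show ?thesis using p' d1 by auto
    next
      case 2
      then show ?thesis using low[of y] p' by fastforce
    next
      case 3
      obtain c where c: "c > 0" "\<forall>x. 1/2 \<le> x \<longrightarrow> x < 1 \<longrightarrow> (norm (E (x, d)))\<^sup>2 \<ge> c"
        using low[of "1/2"] by auto
      have "((\<lambda>y. (norm (E (y, d)))\<^sup>2) \<longlongrightarrow> (norm (E (1, d)))\<^sup>2) (at_left 1)"
        by (intro tendsto_intros E1)
      moreover have "\<forall>\<^sub>F y in at_left 1. c \<le> (norm (E (y, d)))\<^sup>2"
        using near1[of "1/2"] c(2) by (auto elim!: eventually_mono)
      ultimately have "c \<le> (norm (E (1, d)))\<^sup>2" by (intro tendsto_lowerbound) auto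
      then show ?thesis using c 3 p' by auto
    qed
  qed
  have "contractible ({0..1::real} \<times> {0..d1})" by (intro convex_imp_contractible convex_Times) auto
  moreover have "continuous_on ({0..1} \<times> {0..d1}) E" by (rule continuous_on_subset[OF E(1)]) auto
  ultimately obtain g0 where g0: "continuous_on ({0..1} \<times> {0..d1}) g0" "\<And>p. p \<in> {0..1} \<times> {0..d1} \<Longrightarrow> E p = exp (g0 p)"
    using continuous_logarithm_on_contractible[of "{0..1} \<times> {0..d1}" E] E_nz by blast
  \<comment> \<open>Subtracting the value at the corner, a period of exp because
    \<open>E (0, 0) = 1\<close>, normalizes the angle to 0 there.\<close>
  define g where "g p = g0 p - g0 (0, 0)" for p
  have E_axis: "E (y, 0) = 1" if "0 \<le> y" "y < 1" for y
    using that E(2)[of y 0] by (simp add: res_def sol_const[OF h_0] fl_const[OF h_0] complex_eq_iff)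
  have "exp (g0 (0, 0)) = 1" using g0(2)[of "(0, 0)"] E_axis[of 0] d1 by simp
  then have g: "E p = exp (g p)" if "p \<in> {0..1} \<times> {0..d1}" for p
    using g0(2)[OF that] by (simp add: g_def exp_diff)
  define \<theta> where "\<theta> p = Im (g p)" for p
  define \<rho> where "\<rho> p = exp (Re (g p))" for p
  have cont: "continuous_on ({0..1} \<times> {0..d1}) \<theta>"
    unfolding \<theta>_def g_def by (intro continuous_intros g0(1))
  have Re_E: "Re (E p) = \<rho> p * cos (\<theta> p)" and Im_E: "Im (E p) = \<rho> p * sin (\<theta> p)"
    if "p \<in> {0..1} \<times> {0..d1}" for p
    using g[OF that] by (auto simp: \<rho>_def \<theta>_def Re_exp Im_exp)
  have E10: "E (1, 0) = 1"
  proof (rule tendsto_unique[OF _ E1])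
    show "((\<lambda>y. E (y, 0)) \<longlongrightarrow> 1) (at_left 1)"
      using near1[of 0] E_axis by (intro tendsto_eventually) (auto elim!: eventually_mono)
  qed simp
  have \<theta>0: "\<theta> (0, 0) = 0" by (simp add: \<theta>_def g_def)
  show thesis
  proof (rule that[of \<theta> \<rho>])
    show "continuous_on ({0..1} \<times> {0..d1}) \<theta>" by (rule cont)
    show "\<rho> (y, d) > 0 \<and> res d y = \<rho> (y, d) * cos (\<theta> (y, d)) \<and> fl d y = \<rho> (y, d) * sin (\<theta> (y, d))"
      if "0 \<le> y" "y < 1" "0 \<le> d" "d \<le> d1" for y d
      using Re_E[of "(y, d)"] Im_E[of "(y, d)"] E(2)[of y d] that by (simp add: \<rho>_def)
    show "(fl d \<longlongrightarrow> 0) (at_left 1)" if "0 \<le> d" "d \<le> d1" "sin (\<theta> (1, d)) = 0" for d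
    proof -
      have "((\<lambda>y. Im (E (y, d))) \<longlongrightarrow> Im (E (1, d))) (at_left 1)" by (intro tendsto_intros E1)
      moreover have "Im (E (1, d)) = 0" using Im_E[of "(1, d)"] that by simp
      moreover have "\<forall>\<^sub>F y in at_left 1. Im (E (y, d)) = fl d y"
        using near1[of 0] E(2) by (auto elim!: eventually_mono)
      ultimately show ?thesis by (simp add: filterlim_cong)
    qed
    \<comment> \<open>On the edge \<open>y = 0\<close> the real part is 1 - d > 0; on the edge
      \<open>d = 0\<close> the shot vanishes identically and the curve is constantly 1. So the angle
      stays within a quarter turn of its corner value along both edges.\<close>
    show "\<bar>\<theta> (0, d1)\<bar> < pi / 2"
    proof (rule cos_pos_imp_abs_less_pi_half[of 0 d1 "\<lambda>d. \<theta> (0, d)"])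
      show "continuous_on {0..d1} (\<lambda>d. \<theta> (0, d))"
        by (rule continuous_on_compose2[OF cont]) (auto intro!: continuous_intros)
      show "0 < cos (\<theta> (0, d))" if "0 \<le> d" "d \<le> d1" for d
        using Re_E[of "(0, d)"] E(2)[of 0 d] that d1 zero_less_mult_pos[of "\<rho> (0, d)" "cos (\<theta> (0, d))"]
        by (simp add: res_def sol_0 \<rho>_def)
    qed (use \<theta>0 d1 in auto)
    show "\<bar>\<theta> (1, 0)\<bar> < pi / 2"
    proof (rule cos_pos_imp_abs_less_pi_half[of 0 1 "\<lambda>y. \<theta> (y, 0)"])
      show "continuous_on {0..1} (\<lambda>y. \<theta> (y, 0))"
        by (rule continuous_on_compose2[OF cont]) (use d1 in \<open>auto intro!: continuous_intros\<close>)
      show "0 < cos (\<theta> (y, 0))" if "0 \<le> y" "y \<le> 1" for y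
        using Re_E[of "(y, 0)"] E_axis[of y] E10 that d1 zero_less_mult_pos[of "\<rho> (y, 0)" "cos (\<theta> (y, 0))"]
        by (cases "y = 1") (auto simp: \<rho>_def)
    qed (use \<theta>0 d1 in auto)
  qed
qed

end

section \<open>Counting zeros\<close>

text \<open>Consecutive points of \<open>A\<close> separated by a point with \<open>Q\<close> yield
  at least \<open>card A - 1\<close> such points. It serves three times: for zeros of successive
  Jacobi polynomials, for zeros of a shot minus 1, and for critical points by Rolle.\<close>

lemma gaps:
  fixes A :: "real set"
  assumes "finite A"
    and "\<And>x y. x \<in> A \<Longrightarrow> y \<in> A \<Longrightarrow> x < y \<Longrightarrow> A \<inter> {x<..<y} = {} \<Longrightarrow> \<exists>z. x < z \<and> z < y \<and> Q z"
  shows "\<exists>Z. finite Z \<and> card A \<le> Suc (card Z) \<and> (\<forall>z\<in>Z. Q z \<and> (\<exists>x\<in>A. x < z) \<and> (\<exists>y\<in>A. z < y))"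
  using assms
proof (induction A rule: finite_linorder_max_induct)
  case empty
  show ?case by (intro exI[of _ "{}"]) auto
next
  case (insert b A)
  have "\<exists>z. x < z \<and> z < y \<and> Q z" if "x \<in> A" "y \<in> A" "x < y" "A \<inter> {x<..<y} = {}" for x y
    using insert.prems[of x y] that insert.hyps(2) by auto
  then obtain Z where Z: "finite Z" "card A \<le> Suc (card Z)"
    "\<forall>z\<in>Z. Q z \<and> (\<exists>x\<in>A. x < z) \<and> (\<exists>y\<in>A. z < y)"
    using insert.IH by blast
  show ?case
  proof (cases "A = {}")
    case True
    then show ?thesis by (intro exI[of _ "{}"]) auto
  next
    case False
    define a where "a = Max A"
    have a: "a \<in> A" "\<And>x. x \<in> A \<Longrightarrow> x \<le> a" using insert.hyps(1) False by (auto simp: a_def)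
    have "insert b A \<inter> {a<..<b} = {}" using a(2) by fastforce
    then obtain z where z: "a < z" "z < b" "Q z"
      using insert.prems[of a b] a(1) insert.hyps(2) by auto
    have "z \<notin> Z" using Z(3) a(2) z(1) by fastforce
    then have "card (insert b A) \<le> Suc (card (insert z Z))"
      using Z insert.hyps by (simp add: card_insert_if)
    then show ?thesis
      using Z z a(1) by (intro exI[of _ "insert z Z"]) auto
  qed
qed

section \<open>Sturm comparison\<close>

text \<open>The second-order equation as a first-order system, with an arbitrary right-hand side
  \<open>H\<close>. Continuity is asked on the closed interval but the equations only inside, so
  that the singular points 0 and 1 may be end points.\<close>

definition flux_pair :: "nat \<Rightarrow> real \<Rightarrow> real \<Rightarrow> (real \<Rightarrow> real) \<Rightarrow> (real \<Rightarrow> real) \<Rightarrow> (real \<Rightarrow> real) \<Rightarrow> bool" where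
  "flux_pair n a b \<phi> f H \<longleftrightarrow> continuous_on {a..b} \<phi> \<and> continuous_on {a..b} f \<and>
    (\<forall>y\<in>{a<..<b}. (\<phi> has_real_derivative f y / (1 - y)) (at y) \<and>
       (f has_real_derivative (H y - n / 2 * f y) / y) (at y))"

lemma flux_pair_cmult:
  assumes "flux_pair n a b \<phi> f H"
  shows "flux_pair n a b (\<lambda>y. c * \<phi> y) (\<lambda>y. c * f y) (\<lambda>y. c * H y)"
proof -
  have "((\<lambda>y. c * \<phi> y) has_real_derivative c * f y / (1 - y)) (at y)"
    "((\<lambda>y. c * f y) has_real_derivative (c * H y - n / 2 * (c * f y)) / y) (at y)" if "y \<in> {a<..<b}" for y
    using assms that DERIV_cmult[of \<phi> "f y / (1 - y)" y UNIV c] DERIV_cmult[of f "(H y - n / 2 * f y) / y" y UNIV c]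
    unfolding flux_pair_def by (auto simp: algebra_simps)
  then show ?thesis
    using assms unfolding flux_pair_def by (auto intro!: continuous_intros)
qed

text \<open>The weighted Wronskian \<open>D\<close> is strictly decreasing because
  \<open>\<psi>\<close> oscillates faster than \<open>\<phi>\<close>, whereas the end conditions
  give D \<alpha> \<le> 0 \<le> D \<beta>.\<close>

lemma sturm_positive:
  assumes ab: "0 \<le> \<alpha>" "\<alpha> < \<beta>" "\<beta> \<le> 1" and n: "n > 0"
    and \<phi>f: "flux_pair n \<alpha> \<beta> \<phi> f (\<lambda>y. - K * \<phi> y)" and \<psi>g: "flux_pair n \<alpha> \<beta> \<psi> g H"
    and pos: "\<And>y. \<alpha> < y \<Longrightarrow> y < \<beta> \<Longrightarrow> \<phi> y > 0 \<and> \<psi> y > 0 \<and> H y + K * \<psi> y < 0"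
    and left: "\<alpha> = 0 \<or> \<phi> \<alpha> = 0" and right: "\<beta> = 1 \<and> f \<beta> = 0 \<and> g \<beta> = 0 \<or> \<phi> \<beta> = 0"
  shows False
proof -
  have cont: "continuous_on {\<alpha>..\<beta>} \<phi>" "continuous_on {\<alpha>..\<beta>} \<psi>" "continuous_on {\<alpha>..\<beta>} f" "continuous_on {\<alpha>..\<beta>} g"
    using \<phi>f \<psi>g by (auto simp: flux_pair_def)
  have d\<phi>: "(\<phi> has_real_derivative f y / (1 - y)) (at y)"
    and d\<psi>: "(\<psi> has_real_derivative g y / (1 - y)) (at y)"
    and df: "(f has_real_derivative (- K * \<phi> y - real n / 2 * f y) / y) (at y)"
    and dg: "(g has_real_derivative (H y - real n / 2 * g y) / y) (at y)" if "\<alpha> < y" "y < \<beta>" for y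
    using \<phi>f \<psi>g that by (auto simp: flux_pair_def)
  define W where "W y = sqrt y ^ n" for y
  define D where "D y = W y * (\<phi> y * g y - \<psi> y * f y)" for y
  have nonneg: "u y \<ge> 0" if "continuous_on {\<alpha>..\<beta>} u" "\<And>y. \<alpha> < y \<Longrightarrow> y < \<beta> \<Longrightarrow> u y \<ge> 0" "y \<in> {\<alpha>..\<beta>}" for u :: "real \<Rightarrow> real" and y
  proof (rule continuous_ge_on_closure[of "{\<alpha><..<\<beta>}" u y 0])
    show "continuous_on (closure {\<alpha><..<\<beta>}) u" using that ab by simp
    show "y \<in> closure {\<alpha><..<\<beta>}" using that ab by simp
  qed (use that in auto)
  have \<psi>0: "\<psi> y \<ge> 0" if "y \<in> {\<alpha>..\<beta>}" for y
    using nonneg[OF cont(2) _ that] pos by force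
  have "D \<beta> < D \<alpha>"
  proof (rule DERIV_neg_imp_decreasing_open[OF ab(2)])
    fix y assume y: "\<alpha> < y" "y < \<beta>"
    then have y1: "0 < y" "y < 1" using ab by auto
    have "(D has_real_derivative
        (real n / 2 * W y / y) * (\<phi> y * g y - \<psi> y * f y)
        + ((f y / (1 - y) * g y + (H y - real n / 2 * g y) / y * \<phi> y)
           - (g y / (1 - y) * f y + (- K * \<phi> y - real n / 2 * f y) / y * \<psi> y)) * W y) (at y)"
      unfolding D_def[abs_def] W_def
      by (intro DERIV_mult DERIV_diff sqrt_power_deriv d\<phi> d\<psi> df dg y y1 n)
    moreover have "(real n / 2 * W y / y) * (\<phi> y * g y - \<psi> y * f y)
        + ((f y / (1 - y) * g y + (H y - real n / 2 * g y) / y * \<phi> y)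
           - (g y / (1 - y) * f y + (- K * \<phi> y - real n / 2 * f y) / y * \<psi> y)) * W y
        = W y / y * \<phi> y * (H y + K * \<psi> y)"
    proof -
      have alg: "(c * w / y) * (p * b - q * a) + ((C + (r - c * b) / y * p) - (C + (- K * p - c * a) / y * q)) * w
          = w / y * p * (r + K * q)" if "0 < y" for c w y p q a b r C :: real
        using that by (simp add: field_simps)
      have "g y / (1 - y) * f y = f y / (1 - y) * g y" by simp
      then show ?thesis using alg[OF y1(1)] by (simp only:)
    qed
    moreover have "W y / y * \<phi> y * (H y + K * \<psi> y) < 0"
      using pos[OF y] y1 by (intro mult_pos_neg) (auto simp: W_def)
    ultimately show "\<exists>m. (D has_real_derivative m) (at y) \<and> m < 0" by (intro exI conjI) auto
  next
    show "continuous_on {\<alpha>..\<beta>} D"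
      unfolding D_def[abs_def] W_def by (intro continuous_intros cont)
  qed
  \<comment> \<open>At 0 the weight vanishes. Elsewhere \<open>\<phi>\<close> starts from a zero and
    is positive afterwards, so its flux is nonnegative and only the term - \<psi> f
    survives.\<close>
  moreover have "D \<alpha> \<le> 0"
  proof (cases "\<alpha> = 0")
    case True
    then show ?thesis using n by (simp add: D_def W_def zero_power)
  next
    case False
    then have z: "\<phi> \<alpha> = 0" using left by simp
    have "f \<alpha> \<ge> 0"
    proof (rule ccontr)
      assume "\<not> ?thesis"
      then have "\<forall>\<^sub>F y in at \<alpha> within {\<alpha>..\<beta>}. f y < 0"
        using cont(3) ab by (intro order_tendstoD(2)[of f "f \<alpha>"]) (auto simp: continuous_on_def)
      then obtain \<epsilon> where \<epsilon>: "\<epsilon> > 0" "\<And>y. \<alpha> < y \<Longrightarrow> y < \<alpha> + \<epsilon> \<Longrightarrow> y \<le> \<beta> \<Longrightarrow> f y < 0"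
        by (auto simp: eventually_at dist_real_def)
      define w where "w = \<alpha> + min (\<epsilon> / 2) ((\<beta> - \<alpha>) / 2)"
      have w: "\<alpha> < w" "w < \<beta>" "w < \<alpha> + \<epsilon>" using \<epsilon>(1) ab by (auto simp: w_def min_def field_simps)
      have "\<phi> w < \<phi> \<alpha>"
      proof (rule DERIV_neg_imp_decreasing_open[OF w(1)])
        fix y assume y: "\<alpha> < y" "y < w"
        then have "f y / (1 - y) < 0" using \<epsilon>(2)[of y] w ab by (auto simp: divide_neg_pos)
        then show "\<exists>m. (\<phi> has_real_derivative m) (at y) \<and> m < 0" using d\<phi>[of y] y w by auto
      next
        show "continuous_on {\<alpha>..w} \<phi>" using w by (intro continuous_on_subset[OF cont(1)]) auto
      qed
      then show False using pos[of w] w z by simp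
    qed
    then show ?thesis using z \<psi>0[of \<alpha>] ab by (simp add: D_def W_def)
  qed
  moreover have "D \<beta> \<ge> 0"
    using right
  proof
    assume z: "\<phi> \<beta> = 0"
    have "f \<beta> \<le> 0"
    proof (rule ccontr)
      assume "\<not> ?thesis"
      then have "\<forall>\<^sub>F y in at \<beta> within {\<alpha>..\<beta>}. f y > 0"
        using cont(3) ab by (intro order_tendstoD(1)[of f "f \<beta>"]) (auto simp: continuous_on_def)
      then obtain \<epsilon> where \<epsilon>: "\<epsilon> > 0" "\<And>y. \<beta> - \<epsilon> < y \<Longrightarrow> y < \<beta> \<Longrightarrow> \<alpha> \<le> y \<Longrightarrow> f y > 0"
        by (auto simp: eventually_at dist_real_def)
      define w where "w = \<beta> - min (\<epsilon> / 2) ((\<beta> - \<alpha>) / 2)"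
      have w: "\<alpha> < w" "w < \<beta>" "\<beta> - \<epsilon> < w" using \<epsilon>(1) ab by (auto simp: w_def min_def field_simps)
      have "\<phi> w < \<phi> \<beta>"
      proof (rule DERIV_pos_imp_increasing_open[OF w(2)])
        fix y assume y: "w < y" "y < \<beta>"
        then have "f y / (1 - y) > 0" using \<epsilon>(2)[of y] w ab by auto
        then show "\<exists>m. (\<phi> has_real_derivative m) (at y) \<and> m > 0" using d\<phi>[of y] y w by auto
      next
        show "continuous_on {w..\<beta>} \<phi>" using w by (intro continuous_on_subset[OF cont(1)]) auto
      qed
      then show False using pos[of w] w z by simp
    qed
    then show ?thesis using z \<psi>0[of \<beta>] ab by (simp add: D_def W_def mult_nonneg_nonpos)
  qed (auto simp: D_def)
  ultimately show False by simp
qed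

lemma constant_sign:
  fixes u :: "real \<Rightarrow> real"
  assumes "continuous_on {\<alpha><..<\<beta>} u" "\<And>y. \<alpha> < y \<Longrightarrow> y < \<beta> \<Longrightarrow> u y \<noteq> 0"
  obtains c :: real where "c = 1 \<or> c = - 1" "\<And>y. \<alpha> < y \<Longrightarrow> y < \<beta> \<Longrightarrow> c * u y > 0"
proof -
  have same: "u x * u y > 0" if "\<alpha> < x" "x \<le> y" "y < \<beta>" for x y
  proof (rule ccontr)
    assume "\<not> ?thesis"
    then have "u x \<le> 0 \<and> 0 \<le> u y \<or> u y \<le> 0 \<and> 0 \<le> u x"
      by (auto simp: zero_less_mult_iff not_less)
    moreover have "continuous_on {x..y} u" using that by (intro continuous_on_subset[OF assms(1)]) auto
    ultimately have "\<exists>z. x \<le> z \<and> z \<le> y \<and> u z = 0"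
      using IVT'[of u x 0 y] IVT2'[of u y 0 x] that by blast
    then show False using assms(2) that by auto
  qed
  show thesis
  proof (cases "\<exists>x. \<alpha> < x \<and> x < \<beta>")
    case True
    then obtain x where x: "\<alpha> < x" "x < \<beta>" by blast
    have *: "sgn (u x) * u y > 0" if "\<alpha> < y" "y < \<beta>" for y
    proof -
      have "u x * u y > 0" using same[of x y] same[of y x] x that by (cases "x \<le> y") (auto simp: mult.commute)
      then show ?thesis by (auto simp: zero_less_mult_iff sgn_if)
    qed
    show thesis by (rule that[of "sgn (u x)"]) (use * assms(2)[of x] x in \<open>auto simp: sgn_if\<close>)
  next
    case False
    then show thesis using that[of 1] by auto
  qed
qed

text \<open>Boundary terms vanish at \<open>0\<close> because of the weight and at \<open>1\<close> because of the vanishing fluxes,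
  so that singular end points need no boundary condition on the functions themselves.\<close>

lemma sturm:
  assumes ab: "0 \<le> \<alpha>" "\<alpha> < \<beta>" "\<beta> \<le> 1" and n: "n > 0"
    and \<phi>f: "flux_pair n \<alpha> \<beta> \<phi> f (\<lambda>y. - K * \<phi> y)" and \<psi>g: "flux_pair n \<alpha> \<beta> \<psi> g H"
    and nz: "\<And>y. \<alpha> < y \<Longrightarrow> y < \<beta> \<Longrightarrow> \<phi> y \<noteq> 0"
    and faster: "\<And>y. \<alpha> < y \<Longrightarrow> y < \<beta> \<Longrightarrow> \<psi> y \<noteq> 0 \<Longrightarrow> \<psi> y * (H y + K * \<psi> y) < 0"
    and left: "\<alpha> = 0 \<or> \<phi> \<alpha> = 0" and right: "\<beta> = 1 \<and> f \<beta> = 0 \<and> g \<beta> = 0 \<or> \<phi> \<beta> = 0"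
  shows "\<exists>z. \<alpha> < z \<and> z < \<beta> \<and> \<psi> z = 0"
proof (rule ccontr)
  assume "\<not> ?thesis"
  then have nz': "\<psi> y \<noteq> 0" if "\<alpha> < y" "y < \<beta>" for y using that by blast
  obtain a where a: "a = 1 \<or> a = - 1" "\<And>y. \<alpha> < y \<Longrightarrow> y < \<beta> \<Longrightarrow> a * \<phi> y > 0"
    by (rule constant_sign[of \<alpha> \<beta> \<phi>]) (use nz \<phi>f in \<open>auto simp: flux_pair_def intro: continuous_on_subset\<close>)
  obtain b where b: "b = 1 \<or> b = - 1" "\<And>y. \<alpha> < y \<Longrightarrow> y < \<beta> \<Longrightarrow> b * \<psi> y > 0"
    by (rule constant_sign[of \<alpha> \<beta> \<psi>]) (use nz' \<psi>g in \<open>auto simp: flux_pair_def intro: continuous_on_subset\<close>)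
  show False
  proof (rule sturm_positive[OF ab n _ flux_pair_cmult[OF \<psi>g, of b]])
    show "flux_pair n \<alpha> \<beta> (\<lambda>y. a * \<phi> y) (\<lambda>y. a * f y) (\<lambda>y. - K * (a * \<phi> y))"
      using flux_pair_cmult[OF \<phi>f, of a] by (simp add: mult_ac)
    fix y assume y: "\<alpha> < y" "y < \<beta>"
    have "b * H y + K * (b * \<psi> y) < 0"
      using faster[OF y nz'[OF y]] b(1) b(2)[OF y] by (auto simp: mult_less_0_iff)
    then show "0 < a * \<phi> y \<and> 0 < b * \<psi> y \<and> b * H y + K * (b * \<psi> y) < 0"
      using a(2)[OF y] b(2)[OF y] by simp
  qed (use left right in auto)
qed

section \<open>Jacobi polynomials and their zeros\<close>

text \<open>The hypergeometric polynomial with parameters \<open>-k\<close>, \<open>k + n/2\<close> and \<open>n/2\<close>.\<close>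

primrec jac_coeff :: "nat \<Rightarrow> nat \<Rightarrow> nat \<Rightarrow> real" where
  "jac_coeff n k 0 = 1"
| "jac_coeff n k (Suc i) = jac_coeff n k i * (i * (i + n / 2) - k * (k + n / 2)) / ((i + 1) * (i + n / 2))"

definition jac :: "nat \<Rightarrow> nat \<Rightarrow> real poly" where
  "jac n k = (\<Sum>i\<le>k. monom (jac_coeff n k i) i)"

definition jac_eigenvalue :: "nat \<Rightarrow> nat \<Rightarrow> real" where
  "jac_eigenvalue n k = k * (k + n / 2)"

lemma coeff_jac: "coeff (jac n k) i = jac_coeff n k i"
proof -
  \<comment> \<open>The numerator of the recursion at i = k is zero, which stops the series; it
    factors as (i - k) (i + k + n/2).\<close>
  have z: "jac_coeff n k (Suc (k + j)) = 0" for j by (induction j) auto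
  have "jac_coeff n k i = 0" if "i > k" using z[of "i - Suc k"] that by simp
  then show ?thesis unfolding jac_def coeff_sum by (auto simp: coeff_monom)
qed

lemma jac_nonzero: "jac n k \<noteq> 0"
  using coeff_jac[of n k 0] by auto

text \<open>The hypergeometric equation in flux form, y f' = - \<open>jac_eigenvalue n k\<close> p -
  (n/2) f with f = (1 - y) p'. Comparing coefficients gives the recursion of
  \<open>jac_coeff\<close>.\<close>

lemma jac_ode:
  assumes "n > 0"
  shows "y * ((1 - y) * poly (pderiv (pderiv (jac n k))) y - poly (pderiv (jac n k)) y) =
    - jac_eigenvalue n k * poly (jac n k) y - n / 2 * ((1 - y) * poly (pderiv (jac n k)) y)"
proof -
  define p where "p = jac n k"
  define q where "q = pderiv (pderiv p)"
  have "pCons 0 (q - pCons 0 q) - pCons 0 (pderiv p) + smult (jac_eigenvalue n k) p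
      + smult (n / 2) (pderiv p - pCons 0 (pderiv p)) = 0"
  proof (rule poly_eqI)
    fix i
    have rec: "jac_coeff n k (Suc j) * ((j + 1) * (j + n / 2)) =
        jac_coeff n k j * (j * (j + n / 2) - k * (k + n / 2))" for j
      using assms by simp
    show "coeff (pCons 0 (q - pCons 0 q) - pCons 0 (pderiv p) + smult (jac_eigenvalue n k) p
      + smult (n / 2) (pderiv p - pCons 0 (pderiv p))) i = coeff 0 i"
    proof (cases i)
      case 0
      then show ?thesis using rec[of 0]
        by (simp add: p_def coeff_jac coeff_pderiv jac_eigenvalue_def field_simps del: jac_coeff.simps(2))
    next
      case (Suc j)
      then show ?thesis using rec[of i]
        by (cases j) (simp_all add: q_def p_def coeff_jac coeff_pderiv jac_eigenvalue_def algebra_simps add_divide_distrib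
            del: jac_coeff.simps(2))
    qed
  qed
  then have "poly (pCons 0 (q - pCons 0 q) - pCons 0 (pderiv p) + smult (jac_eigenvalue n k) p
      + smult (n / 2) (pderiv p - pCons 0 (pderiv p))) y = 0" by simp
  then show ?thesis by (simp add: q_def p_def algebra_simps)
qed

lemma jac_flux_pair:
  assumes "n > 0" "0 \<le> a" "b \<le> 1"
  shows "flux_pair n a b (poly (jac n k)) (\<lambda>y. (1 - y) * poly (pderiv (jac n k)) y)
    (\<lambda>y. - jac_eigenvalue n k * poly (jac n k) y)"
  unfolding flux_pair_def
proof (intro conjI ballI)
  fix y assume "y \<in> {a<..<b}"
  then have y: "0 < y" "y < 1" using assms by auto
  show "(poly (jac n k) has_real_derivative (1 - y) * poly (pderiv (jac n k)) y / (1 - y)) (at y)"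
    using poly_DERIV[of "jac n k" y] y by simp
  show "((\<lambda>y. (1 - y) * poly (pderiv (jac n k)) y) has_real_derivative
    (- jac_eigenvalue n k * poly (jac n k) y - n / 2 * ((1 - y) * poly (pderiv (jac n k)) y)) / y) (at y)"
    unfolding jac_ode[OF assms(1), of y k, symmetric] using y
    by (auto intro!: derivative_eq_intros poly_DERIV)
qed (auto intro!: continuous_intros)

definition jac_zeros :: "nat \<Rightarrow> nat \<Rightarrow> real set" where
  "jac_zeros n k = {y \<in> {0<..<1}. poly (jac n k) y = 0}"

lemma finite_jac_zeros: "finite (jac_zeros n k)"
  unfolding jac_zeros_def by (rule finite_subset[OF _ poly_roots_finite[OF jac_nonzero]]) auto

lemma jac_eigenvalue_less: "jac_eigenvalue n k < jac_eigenvalue n (Suc k)"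
  unfolding jac_eigenvalue_def by (intro mult_strict_mono) auto

text \<open>By Sturm comparison of consecutive degrees: the k zeros and the two singular end points
  bound k + 1 gaps, and the next polynomial vanishes in each.\<close>

lemma card_jac_zeros:
  assumes "n > 0"
  shows "card (jac_zeros n k) \<ge> k"
proof (induction k)
  case (Suc k)
  \<comment> \<open>Both end points are admissible without a zero of the polynomial: the weight
    vanishes at 0, and the fluxes (1 - y) p' vanish at 1.\<close>
  define A where "A = insert 0 (insert 1 (jac_zeros n k))"
  have "\<exists>z. x < z \<and> z < y \<and> poly (jac n (Suc k)) z = 0"
    if "x \<in> A" "y \<in> A" "x < y" "A \<inter> {x<..<y} = {}" for x y
  proof (rule sturm[OF _ that(3) _ assms jac_flux_pair[OF assms] jac_flux_pair[OF assms]])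
    show xy: "0 \<le> x" "y \<le> 1" using that by (auto simp: A_def jac_zeros_def)
    show "x = 0 \<or> poly (jac n k) x = 0" "y = 1 \<and> (1 - y) * poly (pderiv (jac n k)) y = 0 \<and>
        (1 - y) * poly (pderiv (jac n (Suc k))) y = 0 \<or> poly (jac n k) y = 0"
      using that by (auto simp: A_def jac_zeros_def)
    fix w assume w: "x < w" "w < y"
    then have "w \<notin> A" using that(4) by auto
    then show "poly (jac n k) w \<noteq> 0" using w xy by (auto simp: A_def jac_zeros_def)
    show "poly (jac n (Suc k)) w * (- jac_eigenvalue n (Suc k) * poly (jac n (Suc k)) w +
        jac_eigenvalue n k * poly (jac n (Suc k)) w) < 0" if "poly (jac n (Suc k)) w \<noteq> 0"
    proof -
      have "v * (- a * v + b * v) = - ((a - b) * (v * v))" for a b v :: real by (simp add: algebra_simps)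
      moreover have sq: "0 < poly (jac n (Suc k)) w * poly (jac n (Suc k)) w"
        using that by (simp flip: power2_eq_square)
      then have "0 < (jac_eigenvalue n (Suc k) - jac_eigenvalue n k) * (poly (jac n (Suc k)) w * poly (jac n (Suc k)) w)"
        using mult_pos_pos[OF _ sq] jac_eigenvalue_less[of n k] by simp
      ultimately show ?thesis by simp
    qed
  qed (use that in \<open>auto simp: A_def jac_zeros_def\<close>)
  then obtain Z where Z: "finite Z" "card A \<le> Suc (card Z)"
    "\<forall>z\<in>Z. poly (jac n (Suc k)) z = 0 \<and> (\<exists>x\<in>A. x < z) \<and> (\<exists>y\<in>A. z < y)"
    using gaps[of A "\<lambda>z. poly (jac n (Suc k)) z = 0"] finite_jac_zeros by (auto simp: A_def)
  have "Z \<subseteq> jac_zeros n (Suc k)"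
    using Z(3) by (fastforce simp: A_def jac_zeros_def)
  then have "card Z \<le> card (jac_zeros n (Suc k))" by (rule card_mono[OF finite_jac_zeros])
  moreover have "card A = card (jac_zeros n k) + 2"
    using finite_jac_zeros by (simp add: A_def jac_zeros_def)
  ultimately show ?case using Suc.IH Z(2) by simp
qed simp

section \<open>Counting regular shots by winding\<close>

context shooting
begin

text \<open>Each critical point of the shot from \<open>d1\<close> forces the angle past a further
  multiple of \<pi>, which it never recrosses. The terminal angle thus grows from below \<pi>/2 at
  \<open>d = 0\<close> to at least \<open>card X\<close> * \<pi> at \<open>d1\<close>, and by
  continuity in d takes all values \<pi>, ..., \<open>card X\<close> * \<pi>, each at a regular
  shot.\<close>

lemma many_regular:
  assumes d1: "0 < d1" "d1 < 1" and X: "finite X" "X \<subseteq> {0<..<1}" "\<And>x. x \<in> X \<Longrightarrow> fl d1 x = 0"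
  shows "\<exists>D. finite D \<and> card D = card X \<and> D \<subseteq> {0<..<1} \<and> (\<forall>d\<in>D. (fl d \<longlongrightarrow> 0) (at_left 1))"
proof -
  obtain \<theta> \<rho> where cont: "continuous_on ({0..1} \<times> {0..d1}) \<theta>"
    and polar: "\<And>y d. 0 \<le> y \<Longrightarrow> y < 1 \<Longrightarrow> 0 \<le> d \<Longrightarrow> d \<le> d1 \<Longrightarrow>
       \<rho> (y, d) > 0 \<and> res d y = \<rho> (y, d) * cos (\<theta> (y, d)) \<and> fl d y = \<rho> (y, d) * sin (\<theta> (y, d))"
    and regular: "\<And>d. 0 \<le> d \<Longrightarrow> d \<le> d1 \<Longrightarrow> sin (\<theta> (1, d)) = 0 \<Longrightarrow> (fl d \<longlongrightarrow> 0) (at_left 1)"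
    and corner: "\<bar>\<theta> (0, d1)\<bar> < pi / 2" "\<bar>\<theta> (1, 0)\<bar> < pi / 2"
    using phase_angle[OF d1] by blast
  define t where "t y = \<theta> (y, d1)" for y
  define r where "r y = \<rho> (y, d1)" for y
  have t_cont: "continuous_on {0..1} t"
    unfolding t_def by (rule continuous_on_compose2[OF cont]) (use d1 in \<open>auto intro!: continuous_intros\<close>)
  have r: "r y > 0" "res d1 y = r y * cos (t y)" "fl d1 y = r y * sin (t y)" if "0 \<le> y" "y < 1" for y
    using polar[of y d1] that d1 by (auto simp: t_def r_def)
  \<comment> \<open>The angle is only continuous as constructed, so its increase is read off from
    the flux, which is \<rho> sin \<theta>: near a multiple of \<pi> the sign of the flux decides
    the side.\<close>
  have crossing: "\<exists>\<epsilon>>0. \<forall>x. \<bar>x - y\<bar> < \<epsilon> \<longrightarrow> (x < y \<longrightarrow> t x < j * pi) \<and> (y < x \<longrightarrow> t x > j * pi)"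
    if y: "0 < y" "y < 1" and ty: "t y = real j * pi" for y j
  proof -
    define \<sigma> :: real where "\<sigma> = (-1) ^ j"
    have \<sigma>: "\<sigma> = 1 \<or> \<sigma> = - 1" unfolding \<sigma>_def by (cases "even j") auto
    have fl0: "fl d1 y = 0" using r(3)[of y] y ty by simp
    have pos: "sol d1 y > 0" using positive_at_critical_point[OF d1(1) y fl0] .
    have "res d1 y = r y * \<sigma>" using r(2)[of y] y ty by (simp add: \<sigma>_def)
    then have "1 - sol d1 y = r y * \<sigma>" using fl0 by (simp add: res_def)
    \<comment> \<open>The shot is positive and on the side of 1 given by \<sigma>: in (0, 1) for
      \<sigma> = 1, above 1 for \<sigma> = - 1. This is where the sign pattern of \<open>h\<close>
      makes every crossing upward.\<close>
    then have "\<sigma> * h (sol d1 y) > 0"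
      using \<sigma> r(1)[of y] y pos h_pos[of "sol d1 y"] h_neg[of "sol d1 y"] by auto
    then have dpos: "\<sigma> * ((h (sol d1 y) - n / 2 * fl d1 y) / y) > 0"
      using y fl0 by (simp add: zero_less_divide_iff)
    have der: "((\<lambda>y. \<sigma> * fl d1 y) has_real_derivative \<sigma> * ((h (sol d1 y) - n / 2 * fl d1 y) / y)) (at y)"
      by (intro DERIV_cmult fl_deriv y)
    obtain e1 where e1: "e1 > 0" "\<And>k. k > 0 \<Longrightarrow> k < e1 \<Longrightarrow> \<sigma> * fl d1 (y + k) > 0"
      using DERIV_pos_inc_right[OF der dpos] fl0 by auto
    obtain e2 where e2: "e2 > 0" "\<And>k. k > 0 \<Longrightarrow> k < e2 \<Longrightarrow> \<sigma> * fl d1 (y - k) < 0"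
      using DERIV_pos_inc_left[OF der dpos] fl0 by auto
    obtain e3 where e3: "e3 > 0" "\<And>x. x \<in> {0..1} \<Longrightarrow> \<bar>x - y\<bar> < e3 \<Longrightarrow> \<bar>t x - t y\<bar> < pi"
      using t_cont y pi_gt_zero unfolding continuous_on_iff dist_real_def by (metis atLeastAtMost_iff less_imp_le)
    define \<epsilon> where "\<epsilon> = min (min e1 e2) (min e3 (min y (1 - y)))"
    have "(x < y \<longrightarrow> t x < j * pi) \<and> (y < x \<longrightarrow> t x > j * pi)" if x: "\<bar>x - y\<bar> < \<epsilon>" for x
    proof -
      have x1: "0 < x" "x < 1" using x by (auto simp: \<epsilon>_def)
      define w where "w = t x - j * pi"
      have w: "\<bar>w\<bar> < pi" using e3(2)[of x] x x1 ty by (simp add: w_def \<epsilon>_def)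
      have "sin w = \<sigma> * sin (t x)" by (simp add: w_def sin_diff \<sigma>_def mult.commute)
      then have sw: "r x * sin w = \<sigma> * fl d1 x" using r(3)[of x] x1 by simp
      have rx: "r x > 0" using r(1)[of x] x1 by simp
      have "w > 0" if "y < x"
      proof (rule ccontr)
        assume "\<not> ?thesis"
        then have "sin (- w) \<ge> 0" using w by (intro sin_ge_zero) auto
        then have "r x * sin w \<le> 0" using rx by (simp add: mult_nonneg_nonpos)
        then show False using e1(2)[of "x - y"] that x sw by (simp add: \<epsilon>_def)
      qed
      moreover have "w < 0" if "x < y"
      proof (rule ccontr)
        assume "\<not> ?thesis"
        then have "sin w \<ge> 0" using w by (intro sin_ge_zero) auto
        then have "r x * sin w \<ge> 0" using rx by simp
        then show False using e2(2)[of "y - x"] that x sw by (simp add: \<epsilon>_def)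
      qed
      ultimately show ?thesis by (auto simp: w_def)
    qed
    moreover have "\<epsilon> > 0" using e1 e2 e3 y by (simp add: \<epsilon>_def)
    ultimately show ?thesis by blast
  qed
  \<comment> \<open>At a first return the angle would come down to j \<pi> from above, contrary to
    \<open>crossing\<close>. The alternative start at equality with 0 < y0 is what the induction
    over the critical points supplies.\<close>
  have no_return: "t y > real j * pi"
    if y: "0 \<le> y0" "y0 < y" "y < 1" and start: "t y0 > real j * pi \<or> t y0 = real j * pi \<and> 0 < y0" for y0 y j
  proof (rule ccontr)
    assume neg: "\<not> ?thesis"
    obtain y1 where y1: "y0 \<le> y1" "y1 < y" "t y1 > real j * pi"
    proof (cases "t y0 > real j * pi")
      case False
      then have st: "t y0 = real j * pi" "0 < y0" using start by auto
      then obtain \<epsilon> where \<epsilon>: "\<epsilon> > 0" "\<forall>x. \<bar>x - y0\<bar> < \<epsilon> \<longrightarrow> (x < y0 \<longrightarrow> t x < j * pi) \<and> (y0 < x \<longrightarrow> t x > j * pi)"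
        using crossing[of y0 j] y by auto
      define x where "x = y0 + min (\<epsilon> / 2) ((y - y0) / 2)"
      have "y0 < x" "x < y" "\<bar>x - y0\<bar> < \<epsilon>" using \<epsilon>(1) y by (auto simp: x_def min_def field_simps)
      then show ?thesis using \<epsilon>(2) that[of x] by auto
    qed (use that[of y0] y in auto)
    have "continuous_on {y1..y} (\<lambda>x. real j * pi - t x)"
      using y y1 by (intro continuous_intros continuous_on_subset[OF t_cont]) auto
    from first_zero[OF this] obtain z where z: "y1 < z" "z \<le> y" "real j * pi - t z = 0"
      "\<And>x. y1 \<le> x \<Longrightarrow> x < z \<Longrightarrow> real j * pi - t x < 0"
      using y1 neg by auto
    obtain \<epsilon> where \<epsilon>: "\<epsilon> > 0" "\<forall>x. \<bar>x - z\<bar> < \<epsilon> \<longrightarrow> (x < z \<longrightarrow> t x < j * pi) \<and> (z < x \<longrightarrow> t x > j * pi)"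
      using crossing[of z j] y y1 z by auto
    define x where "x = z - min (\<epsilon> / 2) ((z - y1) / 2)"
    have "y1 \<le> x" "x < z" "\<bar>x - z\<bar> < \<epsilon>" using \<epsilon>(1) z(1) by (auto simp: x_def min_def field_simps)
    then show False using \<epsilon>(2) z(4)[of x] by force
  qed
  \<comment> \<open>The initial flux 2 h(d1) / n is positive, so the curve starts in the upper half
    plane and j = 0 begins the count.\<close>
  have t0: "t 0 > 0"
  proof -
    have "fl d1 0 = 2 * h d1 / n" by (simp add: flux_def sol_0 integral_power_n)
    then have "sin (t 0) > 0"
      using r(1,3)[of 0] h_pos[OF d1] n_ge zero_less_mult_pos[of "r 0" "sin (t 0)"] by simp
    moreover have "sin (- t 0) \<ge> 0" if "t 0 \<le> 0" using that corner(1) by (intro sin_ge_zero) (auto simp: t_def)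
    ultimately show ?thesis by force
  qed
  have count: "\<forall>y. 0 < y \<longrightarrow> y < 1 \<longrightarrow> (\<forall>x\<in>X. x < y) \<longrightarrow> t y > real (card X) * pi"
    using X
  proof (induction X rule: finite_linorder_max_induct)
    case empty
    then show ?case using no_return[of 0 _ 0] t0 by auto
  next
    case (insert b A)
    have b: "0 < b" "b < 1" "fl d1 b = 0" using insert.prems by auto
    have tb: "t b > real (card A) * pi" using insert b by auto
    have "sin (t b) = 0" using r(1,3)[of b] b by simp
    then obtain i :: int where i: "t b = of_int i * pi" by (auto simp: sin_zero_iff_int2)
    have "of_int i > real (card A)" using tb unfolding i by simp
    \<comment> \<open>At a critical point the angle is an integer multiple of \<pi>; exceeding
      \<open>card A\<close> strictly, that integer is at least one more.\<close>
    then have "i \<ge> int (Suc (card A))" by linarith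
    then have "of_int i \<ge> real (Suc (card A))" by linarith
    then have "t b \<ge> real (Suc (card A)) * pi" unfolding i by (intro mult_right_mono) auto
    moreover have "card (insert b A) = Suc (card A)" using insert.hyps by (auto simp: card_insert_if)
    ultimately show ?case using no_return[of b _ "Suc (card A)"] b by (auto simp: less_le)
  qed
  have t1: "t 1 \<ge> real (card X) * pi"
  proof -
    have "(t \<longlongrightarrow> t 1) (at 1 within {0..1})" using t_cont by (auto simp: continuous_on_def)
    then have lim: "(t \<longlongrightarrow> t 1) (at_left 1)" by (simp add: at_within_Icc_at_left)
    define m where "m = Max (insert 0 X)"
    have m: "0 \<le> m" "m < 1" "\<And>x. x \<in> X \<Longrightarrow> x \<le> m" using X by (auto simp: m_def)
    have "\<forall>\<^sub>F y in at_left 1. real (card X) * pi \<le> t y"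
      using eventually_at_left_real[OF m(2)]
    proof eventually_elim
      case (elim y)
      then show ?case using count m by (auto intro!: less_imp_le) (meson le_less_trans)
    qed
    then show ?thesis using lim by (intro tendsto_lowerbound) auto
  qed
  \<comment> \<open>The multiples start at \<pi>, not 0: the terminal angle at \<open>d = 0\<close>
    is below \<pi>/2, so all of them are passed at some d > 0, and different multiples give
    different d.\<close>
  have ex: "\<exists>d. 0 < d \<and> d \<le> d1 \<and> \<theta> (1, d) = real (Suc j) * pi" if "j < card X" for j
  proof -
    have "real (Suc j) * pi \<le> real (card X) * pi" using that by (intro mult_right_mono) auto
    then have le: "real (Suc j) * pi \<le> \<theta> (1, d1)" using t1 unfolding t_def by linarith
    have "1 * pi \<le> real (Suc j) * pi" by (intro mult_right_mono) auto
    then have ge: "\<theta> (1, 0) < real (Suc j) * pi" using corner(2) pi_gt_zero by linarith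
    have "continuous_on {0..d1} (\<lambda>d. \<theta> (1, d))"
      by (rule continuous_on_compose2[OF cont]) (auto intro!: continuous_intros)
    then obtain d where "0 \<le> d" "d \<le> d1" "\<theta> (1, d) = real (Suc j) * pi"
      using IVT'[of "\<lambda>d. \<theta> (1, d)" 0 "real (Suc j) * pi" d1] le ge d1 by auto
    moreover have "d \<noteq> 0" using ge calculation by auto
    ultimately show ?thesis using d1 by (intro exI[of _ d]) auto
  qed
  then obtain \<delta> where \<delta>: "\<And>j. j < card X \<Longrightarrow> 0 < \<delta> j \<and> \<delta> j \<le> d1 \<and> \<theta> (1, \<delta> j) = real (Suc j) * pi"
    by metis
  have inj: "inj_on \<delta> {..<card X}"
  proof (rule inj_onI)
    fix i j assume "i \<in> {..<card X}" "j \<in> {..<card X}" "\<delta> i = \<delta> j"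
    then have "real (Suc i) * pi = real (Suc j) * pi" using \<delta> by (metis lessThan_iff)
    then show "i = j" by simp
  qed
  have "(fl (\<delta> j) \<longlongrightarrow> 0) (at_left 1)" if "j < card X" for j
    using \<delta>[OF that] by (intro regular) (auto simp del: of_nat_Suc)
  moreover have "finite (\<delta> ` {..<card X})" "card (\<delta> ` {..<card X}) = card X"
    using card_image[OF inj] by auto
  moreover have "\<delta> ` {..<card X} \<subseteq> {0<..<1}" using \<delta> d1(2) by force
  ultimately show ?thesis by (intro exI[of _ "\<delta> ` {..<card X}"]) auto
qed

text \<open>Shooting from just below 1, the difference to 1 nearly solves the linearized equation,
  which oscillates faster than the k-th Jacobi polynomial: k zeros of \<open>sol d1 y - 1\<close>,
  hence k - 1 critical points by Rolle.\<close>

theorem regular_solutions: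
  assumes k: "k \<ge> 1"
    and faster: "\<epsilon> > 0" "\<And>v. v \<noteq> 1 \<Longrightarrow> \<bar>v - 1\<bar> < \<epsilon> \<Longrightarrow> (v - 1) * (h v + jac_eigenvalue n k * (v - 1)) < 0"
  shows "\<exists>D. finite D \<and> card D = k - 1 \<and> D \<subseteq> {0<..<1} \<and> (\<forall>d\<in>D. (fl d \<longlongrightarrow> 0) (at_left 1))"
proof -
  define A where "A = insert 0 (jac_zeros n k)"
  have finA: "finite A" using finite_jac_zeros by (simp add: A_def)
  define b where "b = Max A"
  have b_ge: "x \<le> b" if "x \<in> A" for x using that finA by (simp add: b_def)
  have "b \<in> A" using Max_in[OF finA] by (simp add: b_def A_def)
  then have b: "0 \<le> b" "b < 1" by (auto simp: A_def jac_zeros_def)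
  \<comment> \<open>\<delta> is the distance of the initial value from 1. By
    \<open>sol_dependence\<close> the shot then stays within 2 \<delta> \<open>weight b\<close>
    \<le> \<epsilon>/2 of 1 on [0, b], but not beyond.\<close>
  define \<delta> where "\<delta> = min (1/2) (\<epsilon> / (4 * weight b))"
  have wb: "weight b \<ge> 1" using weight_ge_1[OF b] .
  then have \<delta>: "0 < \<delta>" "\<delta> < 1" using faster(1) by (auto simp: \<delta>_def)
  define d1 where "d1 = 1 - \<delta>"
  have d1: "0 < d1" "d1 < 1" using \<delta> by (auto simp: d1_def)
  have close: "\<bar>sol d1 y - 1\<bar> < \<epsilon>" if "0 \<le> y" "y \<le> b" for y
  proof -
    have "\<bar>sol d1 y - 1\<bar> \<le> 2 * \<delta> * weight y"
      using sol_dependence[of y d1 1] sol_const[OF h_1, of y] that b \<delta> by (simp add: d1_def)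
    also have "\<dots> \<le> 2 * \<delta> * weight b" using weight_mono[of y b] that b \<delta> by (intro mult_left_mono) auto
    also have "\<dots> \<le> 2 * (\<epsilon> / (4 * weight b)) * weight b"
      using wb by (intro mult_right_mono mult_left_mono) (auto simp: \<delta>_def)
    also have "\<dots> < \<epsilon>" using wb faster(1) by simp
    finally show ?thesis .
  qed
  have "\<exists>z. x < z \<and> z < y \<and> sol d1 z - 1 = 0"
    if "x \<in> A" "y \<in> A" "x < y" "A \<inter> {x<..<y} = {}" for x y
  proof -
    have xy: "0 \<le> x" "y < 1" "y \<le> b" using that b_ge by (auto simp: A_def jac_zeros_def)
    have n0: "n > 0" using n_ge by simp
    have fp: "flux_pair n x y (\<lambda>y. sol d1 y - 1) (fl d1) (\<lambda>y. h (sol d1 y))"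
      unfolding flux_pair_def
    proof (intro conjI ballI)
      fix w assume "w \<in> {x<..<y}"
      then have w: "0 < w" "w < 1" using xy by auto
      show "((\<lambda>y. sol d1 y - 1) has_real_derivative fl d1 w / (1 - w)) (at w)"
        using DERIV_diff[OF sol_deriv[OF w] DERIV_const] by simp
      show "(fl d1 has_real_derivative (h (sol d1 w) - real n / 2 * fl d1 w) / w) (at w)"
        by (rule fl_deriv[OF w])
    qed (use xy in \<open>auto intro!: continuous_intros continuous_on_subset[OF sol_continuous] continuous_on_subset[OF fl_continuous]\<close>)
    have y1: "y \<le> 1" using xy by simp
    show ?thesis
    proof (rule sturm[OF xy(1) that(3) y1 n0 jac_flux_pair[OF n0 xy(1) y1] fp])
      show "x = 0 \<or> poly (jac n k) x = 0" "y = 1 \<and> (1 - y) * poly (pderiv (jac n k)) y = 0 \<and>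
        fl d1 y = 0 \<or> poly (jac n k) y = 0"
        using that xy by (auto simp: A_def jac_zeros_def)
      fix w assume w: "x < w" "w < y"
      then have "w \<notin> A" using that(4) by auto
      then show "poly (jac n k) w \<noteq> 0" using w xy by (auto simp: A_def jac_zeros_def)
      show "(sol d1 w - 1) * (h (sol d1 w) + jac_eigenvalue n k * (sol d1 w - 1)) < 0" if "sol d1 w - 1 \<noteq> 0"
        using faster(2)[of "sol d1 w"] close[of w] w xy that by auto
    qed
  qed
  from gaps[OF finA this] obtain Z where Z: "finite Z" "card A \<le> Suc (card Z)"
    "\<forall>z\<in>Z. sol d1 z - 1 = 0 \<and> (\<exists>x\<in>A. x < z) \<and> (\<exists>y\<in>A. z < y)"
    by blast
  have Z01: "Z \<subseteq> {0<..<1}" using Z(3) by (fastforce simp: A_def jac_zeros_def)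
  have "card A = Suc (card (jac_zeros n k))"
    using finite_jac_zeros by (simp add: A_def jac_zeros_def)
  then have cZ: "card Z \<ge> k" using Z(2) card_jac_zeros[of n k] n_ge by simp
  have "\<exists>z. x < z \<and> z < y \<and> fl d1 z = 0" if "x \<in> Z" "y \<in> Z" "x < y" for x y
  proof -
    have xy: "0 < x" "y < 1" using that Z01 by auto
    have "\<exists>z>x. z < y \<and> sol d1 y - sol d1 x = (y - x) * (fl d1 z / (1 - z))"
      by (rule MVT2) (use that xy in \<open>auto intro!: sol_deriv\<close>)
    then show ?thesis using Z(3) that xy by auto
  qed
  with gaps[OF Z(1), of "\<lambda>z. fl d1 z = 0"] obtain X where X: "finite X" "card Z \<le> Suc (card X)"
    "\<forall>z\<in>X. fl d1 z = 0 \<and> (\<exists>x\<in>Z. x < z) \<and> (\<exists>y\<in>Z. z < y)"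
    by blast
  have "k - 1 \<le> card X" using X(2) cZ by simp
  \<comment> \<open>There may be more critical points than guaranteed; a subset of the exact size
    gives the exact cardinality claimed.\<close>
  then obtain Y where Y: "Y \<subseteq> X" "card Y = k - 1" "finite Y" using obtain_subset_with_card_n by metis
  have "Y \<subseteq> {0<..<1}" using Y(1) X(3) Z01 by fastforce
  then show ?thesis using many_regular[OF d1 Y(3)] Y X(3) by auto
qed

end

section \<open>Regularity of the radial solutions\<close>

lemma eventually_at_left_1: "y0 < 1 \<Longrightarrow> \<forall>\<^sub>F y in at_left (1::real). y0 < y \<and> y < 1"
  using eventually_at_left_real[of y0 1] by (auto elim!: eventually_mono)

lemma half_less_1: "1/2 < (1::real)"
  by simp

lemma eventually_at_right_0: "0 < y0 \<Longrightarrow> \<forall>\<^sub>F y in at_right (0::real). 0 < y \<and> y < y0"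
  using eventually_at_right_real[of 0 y0] by (auto elim!: eventually_mono)

lemma antiderivative_UNIV:
  fixes k :: "real \<Rightarrow> real"
  assumes "\<And>x. isCont k x"
  shows "\<exists>F. \<forall>x. (F has_real_derivative k x) (at x)"
  using einterval_antiderivative[of "-\<infinity>" "\<infinity>" k] assms
  by (auto simp: has_real_derivative_iff_has_vector_derivative)

text \<open>The second derivative is extended by constants and integrated back twice. Since the end
  limits of u'' alone are assumed, those of u and u' come for free.\<close>

lemma C2_extension:
  fixes u u1 u2 :: "real \<Rightarrow> real"
  assumes d1: "\<And>y. 0 < y \<Longrightarrow> y < 1 \<Longrightarrow> (u has_real_derivative u1 y) (at y)"
    and d2: "\<And>y. 0 < y \<Longrightarrow> y < 1 \<Longrightarrow> (u1 has_real_derivative u2 y) (at y)"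
    and c2: "\<And>y. 0 < y \<Longrightarrow> y < 1 \<Longrightarrow> isCont u2 y"
    and lim0: "(u2 \<longlongrightarrow> k0) (at_right 0)" and lim1: "(u2 \<longlongrightarrow> k1) (at_left 1)"
  obtains G G1 G2 where "\<And>x. (G has_real_derivative G1 x) (at x)" "\<And>x. (G1 has_real_derivative G2 x) (at x)"
    "\<And>x. isCont G2 x" "\<And>y. 0 < y \<Longrightarrow> y < 1 \<Longrightarrow> G y = u y \<and> G1 y = u1 y \<and> G2 y = u2 y"
proof -
  define G2 where "G2 t = (if t \<le> 0 then k0 else if t \<ge> 1 then k1 else u2 t)" for t
  have cont: "isCont G2 x" for x
  proof -
    consider "x < 0" | "x = 0" | "0 < x" "x < 1" | "x = 1" | "x > 1" by linarith
    then show ?thesis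
    proof cases
      case 1
      then have "\<forall>\<^sub>F t in nhds x. G2 t = k0"
        using eventually_nhds_in_open[of "{..<0}" x] by (auto simp: G2_def elim!: eventually_mono)
      then show ?thesis by (simp add: isCont_cong)
    next
      case 2
      have "(G2 \<longlongrightarrow> k0) (at_left 0)"
        by (rule tendsto_eventually) (auto simp: G2_def eventually_at_filter)
      moreover have "(G2 \<longlongrightarrow> k0) (at_right 0)"
        by (rule Lim_transform_eventually[OF lim0])
           (use eventually_at_right_0[of 1] in \<open>auto simp: G2_def elim!: eventually_mono\<close>)
      ultimately show ?thesis using 2 filterlim_split_at[of G2 "nhds k0" 0] by (simp add: isCont_def G2_def[of 0])
    next
      case 3
      then have "\<forall>\<^sub>F t in nhds x. G2 t = u2 t"
        using eventually_nhds_in_open[of "{0<..<1}" x] by (auto simp: G2_def elim!: eventually_mono)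
      then show ?thesis using c2[OF 3] by (simp add: isCont_cong)
    next
      case 4
      have "(G2 \<longlongrightarrow> k1) (at_right 1)"
        by (rule tendsto_eventually) (auto simp: G2_def eventually_at_filter)
      moreover have "(G2 \<longlongrightarrow> k1) (at_left 1)"
        by (rule Lim_transform_eventually[OF lim1])
           (use eventually_at_left_1[of 0] in \<open>auto simp: G2_def elim!: eventually_mono\<close>)
      ultimately show ?thesis using 4 filterlim_split_at[of G2 "nhds k1" 1] by (simp add: isCont_def G2_def[of 1])
    next
      case 5
      then have "\<forall>\<^sub>F t in nhds x. G2 t = k1"
        using eventually_nhds_in_open[of "{1<..}" x] by (auto simp: G2_def elim!: eventually_mono)
      then show ?thesis by (simp add: isCont_cong)
    qed
  qed
  \<comment> \<open>The antiderivatives are normalized at 1/2, an interior point where the original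
    functions are defined and differentiable.\<close>
  have same: "f y = g y" if "\<And>t. 0 < t \<Longrightarrow> t < 1 \<Longrightarrow> (f has_real_derivative k t) (at t)"
      "\<And>t. 0 < t \<Longrightarrow> t < 1 \<Longrightarrow> (g has_real_derivative k t) (at t)" "f (1/2) = g (1/2)" "0 < y" "y < 1"
    for f g k :: "real \<Rightarrow> real" and y
  proof -
    have "f y - g y = f (1/2) - g (1/2)"
    proof (rule DERIV_isconst3[of 0 1 y "1/2" "\<lambda>t. f t - g t"])
      show "((\<lambda>t. f t - g t) has_real_derivative 0) (at t)" if "t \<in> {0<..<1}" for t
        using DERIV_diff[OF \<open>\<And>t. 0 < t \<Longrightarrow> t < 1 \<Longrightarrow> (f has_real_derivative k t) (at t)\<close>
            \<open>\<And>t. 0 < t \<Longrightarrow> t < 1 \<Longrightarrow> (g has_real_derivative k t) (at t)\<close>, of t] that by simp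
    qed (use that in auto)
    then show ?thesis using that by simp
  qed
  obtain F1 where F1: "\<And>x. (F1 has_real_derivative G2 x) (at x)"
    using antiderivative_UNIV[OF cont] by blast
  define G1 where "G1 x = F1 x + (u1 (1/2) - F1 (1/2))" for x
  have G1: "(G1 has_real_derivative G2 x) (at x)" for x
    unfolding G1_def[abs_def] using F1 by (auto intro!: derivative_eq_intros)
  then have "isCont G1 x" for x by (rule DERIV_isCont)
  then obtain F where F: "\<And>x. (F has_real_derivative G1 x) (at x)"
    using antiderivative_UNIV[of G1] by blast
  define G where "G x = F x + (u (1/2) - F (1/2))" for x
  have G: "(G has_real_derivative G1 x) (at x)" for x
    unfolding G_def[abs_def] using F by (auto intro!: derivative_eq_intros)
  have e1: "G1 y = u1 y" if "0 < y" "y < 1" for y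
  proof (rule same[of G1 u2 u1])
    show "(G1 has_real_derivative u2 t) (at t)" if "0 < t" "t < 1" for t
      using G1[of t] that by (simp add: G2_def)
  qed (use that d2 in \<open>auto simp: G1_def\<close>)
  have e0: "G y = u y" if "0 < y" "y < 1" for y
  proof (rule same[of G u1 u])
    show "(G has_real_derivative u1 t) (at t)" if "0 < t" "t < 1" for t
      using G[of t] that e1 by simp
  qed (use that d1 in \<open>auto simp: G_def\<close>)
  show thesis
    by (rule that[of G G1 G2]) (use G G1 cont e0 e1 in \<open>auto simp: G2_def\<close>)
qed

text \<open>The profile is smooth on the whole line, so that composing it with the height function
  raises no question at y = 0 and y = 1; the equation and positivity matter only on [0, 1]. The
  initial value \<open>d\<close> is kept as a label that tells profiles apart.\<close>

definition radial_solution :: "nat \<Rightarrow> (real \<Rightarrow> real) \<Rightarrow> real \<Rightarrow> (real \<Rightarrow> real) \<Rightarrow> bool" where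
  "radial_solution n h d G \<longleftrightarrow> (\<exists>G1 G2.
     (\<forall>x. (G has_real_derivative G1 x) (at x)) \<and> (\<forall>x. (G1 has_real_derivative G2 x) (at x)) \<and>
     (\<forall>x. isCont G2 x) \<and> G 0 = d \<and>
     (\<forall>y\<in>{0..1}. 0 < G y \<and> y * (1 - y) * G2 y + (n / 2 - (n / 2 + 1) * y) * G1 y = h (G y)))"

context shooting
begin

text \<open>Vanishing flux at 1 removes the logarithm, so that all derivatives up to order two have
  limits at both singular ends. The bound \<open>M0 < M\<close> keeps the shot and its limit at 1
  where \<open>h\<close> is continuously differentiable.\<close>

lemma regular_solution_C2:
  assumes d: "0 < d" and reg: "(fl d \<longlongrightarrow> 0) (at_left 1)"
    and M: "\<And>y. 0 \<le> y \<Longrightarrow> y < 1 \<Longrightarrow> sol d y \<le> M0" "M0 < M"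
    and hd: "\<And>v. 0 < v \<Longrightarrow> v < M \<Longrightarrow> (h has_real_derivative h' v) (at v)"
    and hc: "\<And>v. 0 < v \<Longrightarrow> v < M \<Longrightarrow> isCont h' v"
  shows "\<exists>G. radial_solution n h d G \<and> (\<forall>y\<in>{0..1}. G y \<le> M0)"
proof -
  define u where "u = sol d"
  define m where "m = fl d"
  define a where "a = real n / 2"
  define m1 where "m1 y = (h (u y) - a * m y) / y" for y
  define u1 where "u1 y = m y / (1 - y)" for y
  define m2 where "m2 y = (h' (u y) * u1 y - a * m1 y - m1 y) / y" for y
  define u2 where "u2 y = (m1 y * (1 - y) + m y) / (1 - y)\<^sup>2" for y
  have upos: "0 < u y" "u y < M" if "0 \<le> y" "y < 1" for y
    using regular_imp_positive[OF d reg that] M(1)[OF that] M(2) by (auto simp: u_def)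
  have du: "(u has_real_derivative u1 y) (at y)" if "0 < y" "y < 1" for y
    unfolding u_def u1_def m_def by (rule sol_deriv[OF that])
  have dm: "(m has_real_derivative m1 y) (at y)" if "0 < y" "y < 1" for y
    unfolding m_def m1_def u_def a_def by (rule fl_deriv[OF that])
  have du1: "(u1 has_real_derivative u2 y) (at y)" if "0 < y" "y < 1" for y
    unfolding u1_def[abs_def] u2_def using that
    by (auto intro!: derivative_eq_intros dm simp: power2_eq_square)
  have dhu: "((\<lambda>y. h (u y)) has_real_derivative h' (u y) * u1 y) (at y)" if "0 < y" "y < 1" for y
    using that by (intro DERIV_chain2[OF hd du] upos) auto
  have dm1: "(m1 has_real_derivative m2 y) (at y)" if "0 < y" "y < 1" for y
  proof -
    have "(m1 has_real_derivative ((h' (u y) * u1 y - a * m1 y) * y - (h (u y) - a * m y) * 1) / (y * y)) (at y)"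
      unfolding m1_def[abs_def]
      by (intro DERIV_divide DERIV_diff dhu DERIV_cmult dm[unfolded m1_def] DERIV_ident that) (use that in auto)
    moreover have "((h' (u y) * u1 y - a * m1 y) * y - (h (u y) - a * m y) * 1) / (y * y) = m2 y"
      using that by (simp add: m2_def m1_def field_simps)
    ultimately show ?thesis by simp
  qed
  have cu2: "isCont u2 y" if "0 < y" "y < 1" for y
  proof -
    have "(u2 has_real_derivative ((m2 y * (1 - y) + (0 - 1) * m1 y + m1 y) * (1 - y)\<^sup>2 - (m1 y * (1 - y) + m y) *
        (of_nat 2 * ((0 - 1) * (1 - y) ^ (2 - Suc 0)))) / ((1 - y)\<^sup>2 * (1 - y)\<^sup>2)) (at y)"
      unfolding u2_def[abs_def]
      by (intro DERIV_divide DERIV_add DERIV_mult DERIV_diff DERIV_const DERIV_ident DERIV_power dm dm1 that) (use that in auto)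
    then show ?thesis by (rule DERIV_isCont)
  qed
  have within0: "at 0 within {0..<1} = at_right (0::real)"
    by (intro at_within_nhd[where S="{..<1}"]) auto
  have u0: "(u \<longlongrightarrow> d) (at_right 0)"
  proof -
    have "(u \<longlongrightarrow> u 0) (at 0 within {0..<1})"
      using sol_continuous[of d] unfolding continuous_on_def u_def by (rule bspec) simp
    then show ?thesis by (simp add: within0 u_def sol_0)
  qed
  have m0: "(m \<longlongrightarrow> h d / a) (at_right 0)"
  proof -
    have "(m \<longlongrightarrow> m 0) (at 0 within {0..<1})"
      using fl_continuous[of d] unfolding continuous_on_def m_def by (rule bspec) simp
    moreover have "m 0 = h d / a" by (simp add: m_def a_def flux_def sol_0 integral_power_n)
    ultimately show ?thesis by (simp add: within0)
  qed
  have dM: "0 < d" "d < M" using upos[of 0] by (auto simp: u_def sol_0)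
  have h_isCont: "isCont h v" for v
    using h_continuous[of UNIV] by (simp add: continuous_on_eq_continuous_at)
  have u1_0: "(u1 \<longlongrightarrow> h d / a) (at_right 0)"
  proof -
    have "((\<lambda>y. m y / (1 - y)) \<longlongrightarrow> h d / a / (1 - 0)) (at_right 0)"
      by (intro tendsto_intros m0) auto
    then show ?thesis by (simp add: u1_def[abs_def])
  qed
  have m1_0: "(m1 \<longlongrightarrow> h' d * (h d / a) / (a + 1)) (at_right 0)"
  proof -
    \<comment> \<open>L'Hospital applied directly to \<open>m1\<close> would bring \<open>m1\<close>
      back. After multiplying numerator and denominator by y^(n/2) the derivative of the numerator
      is \<open>W y * (h' (u y) * u1 y)\<close>, free of \<open>m1\<close>.\<close>
    define W where "W y = sqrt y ^ n" for y
    have dW: "(W has_real_derivative a * W y / y) (at y)" if "0 < y" for y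
      using sqrt_power_deriv[of y n] that n_ge by (simp add: W_def[abs_def] a_def)
    have W0: "(W \<longlongrightarrow> 0) (at_right 0)"
    proof -
      have "(W \<longlongrightarrow> sqrt 0 ^ n) (at_right 0)" unfolding W_def[abs_def] by (intro tendsto_intros)
      then show ?thesis using n_ge by (simp add: zero_power)
    qed
    have "((\<lambda>y. (W y * (h (u y) - a * m y)) / (y * W y)) \<longlongrightarrow> h' d * (h d / a) / (a + 1)) (at_right 0)"
    proof (rule lhopital_right)
      have "((\<lambda>y. W y * (h (u y) - a * m y)) \<longlongrightarrow> 0 * (h d - a * (h d / a))) (at_right 0)"
        by (intro tendsto_intros W0 m0 isCont_tendsto_compose[OF h_isCont] u0)
      then show "((\<lambda>y. W y * (h (u y) - a * m y)) \<longlongrightarrow> 0) (at_right 0)" by simp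
      have "((\<lambda>y. y * W y) \<longlongrightarrow> 0 * 0) (at_right 0)" by (intro tendsto_intros W0)
      then show "((\<lambda>y. y * W y) \<longlongrightarrow> 0) (at_right 0)" by simp
      show "\<forall>\<^sub>F y in at_right 0. y * W y \<noteq> 0"
        using eventually_at_right_0[of 1, OF zero_less_one] by eventually_elim (simp add: W_def)
      show "\<forall>\<^sub>F y in at_right 0. (a + 1) * W y \<noteq> 0"
        using eventually_at_right_0[of 1, OF zero_less_one] by eventually_elim (simp add: W_def a_def)
      show "\<forall>\<^sub>F y in at_right 0. ((\<lambda>y. W y * (h (u y) - a * m y)) has_real_derivative W y * (h' (u y) * u1 y)) (at y)"
        using eventually_at_right_0[of 1, OF zero_less_one]
      proof eventually_elim
        case (elim y)
        have "((\<lambda>y. W y * (h (u y) - a * m y)) has_real_derivative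
            a * W y / y * (h (u y) - a * m y) + (h' (u y) * u1 y - a * m1 y) * W y) (at y)"
          using elim by (intro DERIV_mult DERIV_diff DERIV_cmult dW dhu dm) auto
        moreover have "a * W y / y * (h (u y) - a * m y) + (h' (u y) * u1 y - a * m1 y) * W y = W y * (h' (u y) * u1 y)"
          using elim by (simp add: m1_def field_simps)
        ultimately show ?case by simp
      qed
      show "\<forall>\<^sub>F y in at_right 0. ((\<lambda>y. y * W y) has_real_derivative (a + 1) * W y) (at y)"
        using eventually_at_right_0[of 1, OF zero_less_one]
      proof eventually_elim
        case (elim y)
        have "((\<lambda>y. y * W y) has_real_derivative 1 * W y + a * W y / y * y) (at y)"
          using elim by (intro DERIV_mult DERIV_ident dW) auto
        then show ?case using elim by (simp add: algebra_simps)
      qed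
      have "((\<lambda>y. h' (u y) * u1 y / (a + 1)) \<longlongrightarrow> h' d * (h d / a) / (a + 1)) (at_right 0)"
        by (intro tendsto_intros u1_0 isCont_tendsto_compose[OF hc] dM u0) (simp add: a_def)
      then show "((\<lambda>y. W y * (h' (u y) * u1 y) / ((a + 1) * W y)) \<longlongrightarrow> h' d * (h d / a) / (a + 1)) (at_right 0)"
        by (rule Lim_transform_eventually)
           (use eventually_at_right_0[of 1, OF zero_less_one] in eventually_elim, simp add: W_def)
    qed
    then show ?thesis
      by (rule Lim_transform_eventually)
         (use eventually_at_right_0[of 1, OF zero_less_one] in eventually_elim, simp add: W_def m1_def)
  qed
  obtain k0 where k0: "(u2 \<longlongrightarrow> k0) (at_right 0)"
  proof
    show "(u2 \<longlongrightarrow> (h' d * (h d / a) / (a + 1) * (1 - 0) + h d / a) / (1 - 0)\<^sup>2) (at_right 0)"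
      unfolding u2_def[abs_def] by (intro tendsto_intros m1_0 m0) auto
  qed
  have reg': "(m \<longlongrightarrow> 0) (at_left 1)" using reg by (simp add: m_def)
  \<comment> \<open>The mean value theorem between y and x, then x tending to 1, where m vanishes.
    Linear decay of the flux beats the logarithm.\<close>
  have m_small: "\<bar>m y\<bar> \<le> 4 * B * (1 - y)" if y: "1/2 \<le> y" "y < 1" for y
  proof -
    have step: "\<bar>m y - m x\<bar> \<le> 4 * B * (1 - y)" if x: "y < x" "x < 1" for x
    proof -
      obtain z where z: "y < z" "z < x" "m x - m y = (x - y) * m1 z"
        using MVT2[of y x m m1] x y dm by force
      have "\<bar>m1 z\<bar> \<le> 2 * B / z"
        unfolding m1_def u_def m_def a_def using z x y by (intro fl_deriv_bound) auto
      also have "\<dots> \<le> 2 * B / (1/2)" using z y B_pos by (intro divide_left_mono) auto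
      finally have "\<bar>m1 z\<bar> \<le> 4 * B" by simp
      then have "(x - y) * \<bar>m1 z\<bar> \<le> (1 - y) * (4 * B)" using x y by (intro mult_mono) auto
      moreover have "\<bar>m y - m x\<bar> = (x - y) * \<bar>m1 z\<bar>"
        using z(3) x by (metis abs_minus_commute abs_mult abs_of_pos diff_gt_0_iff_gt)
      ultimately show ?thesis by (simp add: mult_ac)
    qed
    have "((\<lambda>x. \<bar>m y - m x\<bar>) \<longlongrightarrow> \<bar>m y - 0\<bar>) (at_left 1)" by (intro tendsto_intros reg')
    moreover have "\<forall>\<^sub>F x in at_left 1. \<bar>m y - m x\<bar> \<le> 4 * B * (1 - y)"
      using eventually_at_left_1[OF y(2)] by (auto elim!: eventually_mono intro: step)
    ultimately show ?thesis by (auto dest: tendsto_upperbound)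
  qed
  have lgm: "((\<lambda>y. lg y * m y) \<longlongrightarrow> 0) (at_left 1)"
  proof (rule Lim_null_comparison)
    show "\<forall>\<^sub>F y in at_left 1. norm (lg y * m y) \<le> 64 * B * sqrt (1 - y)"
      using eventually_at_left_1[OF half_less_1]
    proof eventually_elim
      case (elim y)
      then have l: "0 \<le> lg y" by simp
      have "1 + lg y \<le> (1 + lg y)\<^sup>2" using l by (intro self_le_power) auto
      then have "lg y \<le> 16 / sqrt (1 - y)" using ln_le_sqrt[of y] elim by simp
      then have "lg y * \<bar>m y\<bar> \<le> 16 / sqrt (1 - y) * (4 * B * (1 - y))"
        using m_small[of y] elim l by (intro mult_mono) auto
      also have "\<dots> = 64 * B * ((1 - y) / sqrt (1 - y))" by simp
      also have "(1 - y) / sqrt (1 - y) = sqrt (1 - y)" using elim by (simp add: real_div_sqrt)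
      finally show ?case using l by (simp add: abs_mult)
    qed
    have "((\<lambda>y. 64 * B * sqrt (1 - y)) \<longlongrightarrow> 64 * B * sqrt (1 - 1)) (at_left 1)" by (intro tendsto_intros)
    then show "((\<lambda>y. 64 * B * sqrt (1 - y)) \<longlongrightarrow> 0) (at_left 1)" by simp
  qed
  obtain l where l: "(u \<longlongrightarrow> l) (at_left 1)"
  proof -
    obtain E where E: "continuous_on ({0..1} \<times> UNIV) E"
      "\<And>y d. 0 \<le> y \<Longrightarrow> y < 1 \<Longrightarrow> E (y, d) = Complex (res d y) (fl d y)"
      using phase_extension by blast
    have "continuous_on {0..1} (\<lambda>y. E (y, d))"
      by (rule continuous_on_compose2[OF E(1)]) (auto intro!: continuous_intros)
    then have "((\<lambda>y. E (y, d)) \<longlongrightarrow> E (1, d)) (at 1 within {0..1})" by (auto simp: continuous_on_def)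
    then have "((\<lambda>y. E (y, d)) \<longlongrightarrow> E (1, d)) (at_left 1)" by (simp add: at_within_Icc_at_left)
    then have "((\<lambda>y. 1 - Re (E (y, d)) + lg y * m y) \<longlongrightarrow> 1 - Re (E (1, d)) + 0) (at_left 1)"
      by (intro tendsto_intros lgm)
    moreover have "\<forall>\<^sub>F y in at_left 1. 1 - Re (E (y, d)) + lg y * m y = u y"
      using eventually_at_left_1[of 0] E(2) by (auto simp: res_def u_def m_def elim!: eventually_mono)
    ultimately have "(u \<longlongrightarrow> 1 - Re (E (1, d)) + 0) (at_left 1)" by (rule Lim_transform_eventually)
    then show thesis by (rule that)
  qed
  \<comment> \<open>Positivity before 1 gives only l \<ge> 0; the case l = 0 is excluded by
    \<open>nondegenerate\<close> for the rest point 0.\<close>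
  have l_pos: "0 < l"
  proof -
    obtain c where c: "c > 0" "\<And>x. 1/2 \<le> x \<Longrightarrow> x < 1 \<Longrightarrow> (u x - 0 - lg x * m x)\<^sup>2 + (m x)\<^sup>2 \<ge> c"
      using nondegenerate[OF h_0, of d "1/2"] d unfolding u_def m_def by auto
    have "((\<lambda>x. (u x - 0 - lg x * m x)\<^sup>2 + (m x)\<^sup>2) \<longlongrightarrow> (l - 0 - 0)\<^sup>2 + 0\<^sup>2) (at_left 1)"
      by (intro tendsto_intros l lgm reg')
    moreover have "\<forall>\<^sub>F x in at_left 1. c \<le> (u x - 0 - lg x * m x)\<^sup>2 + (m x)\<^sup>2"
      using eventually_at_left_1[of "1/2"] c(2) by (auto elim!: eventually_mono)
    ultimately have "c \<le> (l - 0 - 0)\<^sup>2 + 0\<^sup>2" by (intro tendsto_lowerbound) auto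
    then have "l \<noteq> 0" using c(1) by auto
    moreover have "0 \<le> l"
      by (rule tendsto_lowerbound[OF l])
         (use eventually_at_left_1[of 0] upos in \<open>auto intro: less_imp_le elim!: eventually_mono\<close>)
    ultimately show ?thesis by simp
  qed
  have l_le: "l \<le> M0"
    by (rule tendsto_upperbound[OF l])
       (use eventually_at_left_1[of 0] M(1) in \<open>auto simp: u_def elim!: eventually_mono\<close>)
  have m1_1: "(m1 \<longlongrightarrow> h l) (at_left 1)"
  proof -
    have "((\<lambda>y. (h (u y) - a * m y) / y) \<longlongrightarrow> (h l - a * 0) / 1) (at_left 1)"
      by (intro tendsto_intros isCont_tendsto_compose[OF h_isCont] l reg') auto
    then show ?thesis by (simp add: m1_def[abs_def])
  qed
  have u1_1: "(u1 \<longlongrightarrow> - h l) (at_left 1)"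
    unfolding u1_def[abs_def]
  proof (rule lhopital_left[of m 1 "\<lambda>y. 1 - y" "\<lambda>_. - 1" m1])
    have "((\<lambda>y. 1 - y) \<longlongrightarrow> 1 - 1) (at_left (1::real))" by (intro tendsto_intros)
    then show "((\<lambda>y. 1 - y) \<longlongrightarrow> 0) (at_left (1::real))" by simp
    show "((\<lambda>y. m1 y / - 1) \<longlongrightarrow> - h l) (at_left 1)" using tendsto_minus[OF m1_1] by simp
    show "\<forall>\<^sub>F y in at_left 1. (m has_real_derivative m1 y) (at y)"
      using eventually_at_left_1[of 0] dm by (auto elim!: eventually_mono)
    show "\<forall>\<^sub>F y in at_left 1. 1 - y \<noteq> (0::real)"
      using eventually_at_left_1[of 0, OF zero_less_one] by eventually_elim simp
  qed (use reg' in \<open>auto intro!: derivative_eq_intros always_eventually\<close>)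
  have l_less: "l < M" using l_le M(2) by simp
  have m2_1: "(m2 \<longlongrightarrow> (h' l * - h l - a * h l - h l) / 1) (at_left 1)"
    unfolding m2_def[abs_def]
    by (intro tendsto_intros isCont_tendsto_compose[OF hc] l l_pos l_less u1_1 m1_1) auto
  \<comment> \<open>Differentiating the numerator m' (1 - y) + m cancels m', leaving m'' (1 - y)
    over - 2 (1 - y).\<close>
  have k1: "(u2 \<longlongrightarrow> (h' l * - h l - a * h l - h l) / 1 / - 2) (at_left 1)"
    unfolding u2_def[abs_def]
  proof (rule lhopital_left[of "\<lambda>y. m1 y * (1 - y) + m y" 1 "\<lambda>y. (1 - y)\<^sup>2" "\<lambda>y. - 2 * (1 - y)" "\<lambda>y. m2 y * (1 - y)"])
    have "((\<lambda>y. m1 y * (1 - y) + m y) \<longlongrightarrow> h l * (1 - 1) + 0) (at_left 1)" by (intro tendsto_intros m1_1 reg')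
    then show "((\<lambda>y. m1 y * (1 - y) + m y) \<longlongrightarrow> 0) (at_left 1)" by simp
    have "((\<lambda>y. (1 - y)\<^sup>2) \<longlongrightarrow> (1 - 1)\<^sup>2) (at_left (1::real))" by (intro tendsto_intros)
    then show "((\<lambda>y. (1 - y)\<^sup>2) \<longlongrightarrow> 0) (at_left (1::real))" by simp
    show "\<forall>\<^sub>F y in at_left 1. (1 - y)\<^sup>2 \<noteq> (0::real)"
      using eventually_at_left_1[of 0, OF zero_less_one] by eventually_elim simp
    show "\<forall>\<^sub>F y in at_left 1. - 2 * (1 - y) \<noteq> (0::real)"
      using eventually_at_left_1[of 0, OF zero_less_one] by eventually_elim simp
    show "\<forall>\<^sub>F y in at_left 1. ((\<lambda>y. m1 y * (1 - y) + m y) has_real_derivative m2 y * (1 - y)) (at y)"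
      using eventually_at_left_1[of 0, OF zero_less_one]
      by eventually_elim (auto intro!: derivative_eq_intros dm dm1)
    show "\<forall>\<^sub>F y in at_left 1. ((\<lambda>y. (1 - y)\<^sup>2) has_real_derivative - 2 * (1 - y)) (at (y::real))"
      by (auto intro!: derivative_eq_intros always_eventually)
    have "((\<lambda>y. m2 y / - 2) \<longlongrightarrow> (h' l * - h l - a * h l - h l) / 1 / - 2) (at_left 1)"
      by (intro tendsto_divide m2_1 tendsto_const) auto
    then show "((\<lambda>y. m2 y * (1 - y) / (- 2 * (1 - y))) \<longlongrightarrow> (h' l * - h l - a * h l - h l) / 1 / - 2) (at_left 1)"
    proof (rule Lim_transform_eventually)
      show "\<forall>\<^sub>F y in at_left 1. m2 y / - 2 = m2 y * (1 - y) / (- 2 * (1 - y))"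
        using eventually_at_left_1[of 0, OF zero_less_one] by eventually_elim (simp add: field_simps)
    qed
  qed
  have "\<exists>G G1 G2. (\<forall>x. (G has_real_derivative G1 x) (at x)) \<and> (\<forall>x. (G1 has_real_derivative G2 x) (at x)) \<and>
      (\<forall>x. isCont G2 x) \<and> (\<forall>y. 0 < y \<longrightarrow> y < 1 \<longrightarrow> G y = u y \<and> G1 y = u1 y \<and> G2 y = u2 y)"
    by (rule C2_extension[OF du du1 cu2 k0 k1]) blast+
  then obtain G G1 G2 where G: "\<And>x. (G has_real_derivative G1 x) (at x)" "\<And>x. (G1 has_real_derivative G2 x) (at x)"
    "\<And>x. isCont G2 x" and eq: "\<And>y. 0 < y \<Longrightarrow> y < 1 \<Longrightarrow> G y = u y \<and> G1 y = u1 y \<and> G2 y = u2 y"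
    by blast
  have cG: "isCont G x" "isCont G1 x" for x using G(1,2) by (auto intro: DERIV_isCont)
  have G0: "G 0 = d"
  proof (rule tendsto_unique[of "at_right 0"])
    show "(G \<longlongrightarrow> G 0) (at_right 0)"
      using cG(1)[of 0] by (auto simp: isCont_def intro: filterlim_at_split[THEN iffD1, THEN conjunct2])
    show "(G \<longlongrightarrow> d) (at_right 0)"
      by (rule Lim_transform_eventually[OF u0])
         (use eventually_at_right_0[of 1] eq in \<open>auto elim!: eventually_mono\<close>)
  qed simp
  have G1': "G 1 = l"
  proof (rule tendsto_unique[of "at_left 1"])
    show "(G \<longlongrightarrow> G 1) (at_left 1)"
      using cG(1)[of 1] by (auto simp: isCont_def intro: filterlim_at_split[THEN iffD1, THEN conjunct1])
    show "(G \<longlongrightarrow> l) (at_left 1)"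
      by (rule Lim_transform_eventually[OF l])
         (use eventually_at_left_1[of 0] eq in \<open>auto elim!: eventually_mono\<close>)
  qed simp
  have end_eq: "(0 < G y \<and> y * (1 - y) * G2 y + (n / 2 - (n / 2 + 1) * y) * G1 y = h (G y)) \<and> G y \<le> M0"
    if y: "0 \<le> y" "y \<le> 1" for y
  proof -
    \<comment> \<open>The residual vanishes on the open interval and is continuous, so the equation
      extends to the singular end points.\<close>
    define R where "R y = y * (1 - y) * G2 y + (n / 2 - (n / 2 + 1) * y) * G1 y - h (G y)" for y
    have R0: "R t = 0" if "t \<in> {0<..<1}" for t
    proof -
      have t: "0 < t" "t < 1" using that by auto
      have "t * (1 - t) * u2 t = h (u t) - a * m t + t * u1 t"
      proof -
        have "t * (1 - t) * ((X / t * (1 - t) + Y) / (1 - t)\<^sup>2) = X + t * (Y / (1 - t))" for X Y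
        proof -
          define s where "s = 1 - t"
          have "s > 0" using t by (simp add: s_def)
          then show ?thesis using t unfolding s_def[symmetric] by (simp add: field_simps power2_eq_square)
        qed
        then show ?thesis unfolding u2_def u1_def m1_def by simp
      qed
      moreover have "a * (1 - t) * u1 t = a * m t" using t by (simp add: u1_def)
      ultimately show ?thesis using eq[OF t] by (simp add: R_def a_def[symmetric] algebra_simps)
    qed
    have "continuous_on (closure {0<..<1}) R"
      unfolding R_def
      by (intro continuous_intros continuous_at_imp_continuous_on ballI cG G(3) isCont_o2[OF cG(1) h_isCont])
    then have "R y = 0"
      by (rule continuous_constant_on_closure) (use R0 y in auto)
    moreover have "0 < G y \<and> G y \<le> M0"
    proof -
      consider "y = 0" | "0 < y" "y < 1" | "y = 1" using y by linarith
      then show ?thesis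
        using G0 G1' eq[of y] upos[of y] M(1)[of y] M(1)[of 0] d l_pos l_le
        by cases (auto simp: u_def sol_0)
    qed
    ultimately show ?thesis by (simp add: R_def)
  qed
  have "radial_solution n h d G"
    unfolding radial_solution_def
    by (rule exI[of _ G1], rule exI[of _ G2]) (use G G0 end_eq in auto)
  then show ?thesis using end_eq by (intro exI[of _ G]) auto
qed

end

section \<open>The truncated nonlinearity\<close>

context shooting
begin

text \<open>An upper bound of the reaction bounds the flux, hence the slope by a multiple of 1 / (1
  - y): growth is at most logarithmic, however negative the reaction may be.\<close>

lemma sol_upper_bound:
  assumes C: "\<And>v. h v \<le> C" "C \<ge> 0" and d: "d \<le> 1" and y: "0 \<le> y" "y < 1"
  shows "sol d y \<le> 1 + 2 * C / n * lg y"
proof -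
  define K where "K = 2 * C / n"
  have "sol d y - K * lg y \<le> sol d 0 - K * lg 0"
  proof (rule DERIV_nonpos_imp_decreasing_open[OF y(1)])
    fix x assume x: "0 < x" "x < y"
    then have x1: "0 < x" "x < 1" using y by auto
    have "((\<lambda>y. sol d y - K * lg y) has_real_derivative fl d x / (1 - x) - K * (1 / (1 - x))) (at x)"
      by (intro DERIV_diff DERIV_cmult sol_deriv lg_deriv x1)
    moreover have "fl d x \<le> K" unfolding K_def
      by (rule flux_bound[OF sol_continuous]) (use x1 C in auto)
    then have "fl d x / (1 - x) - K * (1 / (1 - x)) \<le> 0"
      using x1 divide_right_mono[of "fl d x" K "1 - x"] by simp
    ultimately show "\<exists>D. ((\<lambda>y. sol d y - K * lg y) has_real_derivative D) (at x) \<and> D \<le> 0"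
      by blast
  next
    show "continuous_on {0..y} (\<lambda>y. sol d y - K * lg y)"
      using y by (intro continuous_intros continuous_on_subset[OF sol_continuous]) auto
  qed
  then show ?thesis using d by (simp add: sol_0 K_def)
qed

text \<open>The logarithmic bound makes the power term at most C / sqrt (1 - y). Integrating back
  from \<open>y = 1\<close>, where the flux of a regular shot is zero, improves the flux to order
  sqrt (1 - y) and the slope to order 1 / sqrt (1 - y), which is integrable. Only the two bounds on
  \<open>h\<close> enter, so the truncation level does not.\<close>

lemma regular_solution_bounded:
  fixes \<kappa> q :: real
  assumes \<kappa>: "\<kappa> > 0" and q: "q > 1" and hle: "\<And>v. h v \<le> \<kappa>"
    and hge: "\<And>v. 0 < v \<Longrightarrow> h v \<ge> - (\<kappa> * v powr q)"
    and d: "0 < d" "d \<le> 1" and reg: "(fl d \<longlongrightarrow> 0) (at_left 1)" and y: "0 \<le> y" "y < 1"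
  shows "sol d y \<le> 1 + 2 * \<kappa> / n * ln 2 + 2 ^ (n + 2) * (\<kappa> * ((1 + 2 * \<kappa> / n) * (2 * q)) powr q)"
proof -
  define K where "K = 2 * \<kappa> / n"
  define C where "C = \<kappa> * ((1 + K) * (2 * q)) powr q"
  have K: "K > 0" using \<kappa> n_ge by (simp add: K_def)
  have C: "C \<ge> 0" using \<kappa> by (simp add: C_def)
  have sb: "sol d x \<le> 1 + K * lg x" if "0 \<le> x" "x < 1" for x
    unfolding K_def using \<kappa> by (intro sol_upper_bound hle d that) auto
  have h_low: "- C / sqrt (1 - x) \<le> h (sol d x)" if x: "0 \<le> x" "x < 1" for x
  proof -
    define s where "s = lg x"
    have s: "s \<ge> 0" using x by (simp add: s_def)
    \<comment> \<open>The exponent 1 / (2 q) is chosen so that the q-th power becomes exp (s / 2) =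
      1 / sqrt (1 - x); this is the origin of the constant in \<open>C\<close>.\<close>
    have "1 + s \<le> 2 * q * (1 + s / (2 * q))" using q by (simp add: field_simps)
    also have "\<dots> \<le> 2 * q * exp (s / (2 * q))" using q by (intro mult_left_mono exp_ge_add_one_self) auto
    finally have "1 + s \<le> 2 * q * exp (s / (2 * q))" .
    then have "(1 + K) * (1 + s) \<le> (1 + K) * (2 * q * exp (s / (2 * q)))"
      using K by (intro mult_left_mono) auto
    moreover have "1 + K * s \<le> (1 + K) * (1 + s)" using K s by (simp add: algebra_simps)
    moreover have "sol d x \<le> 1 + K * s" using sb[OF x] by (simp only: s_def)
    ultimately have le: "sol d x \<le> (1 + K) * (2 * q) * exp (s / (2 * q))"
      by (simp only: mult.assoc)
    have pos: "sol d x > 0" by (rule regular_imp_positive[OF d(1) reg x])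
    have "sol d x powr q \<le> ((1 + K) * (2 * q) * exp (s / (2 * q))) powr q"
      using le pos q by (intro powr_mono2) auto
    also have "\<dots> = ((1 + K) * (2 * q)) powr q * exp (s / 2)"
      using K q by (subst powr_mult) (auto simp: powr_def)
    also have "exp (s / 2) = 1 / sqrt (1 - x)"
      using x by (simp add: s_def exp_minus inverse_eq_divide flip: ln_sqrt)
    finally have "\<kappa> * sol d x powr q \<le> \<kappa> * (((1 + K) * (2 * q)) powr q * (1 / sqrt (1 - x)))"
      using \<kappa> by (intro mult_left_mono) auto
    then have "\<kappa> * sol d x powr q \<le> C / sqrt (1 - x)" by (simp add: C_def)
    then show ?thesis using hge[OF pos] by simp
  qed
  define P where "P x = sqrt x ^ n * fl d x" for x
  have P_le: "P x \<le> 2 * C * sqrt (1 - x)" if x: "1/2 \<le> x" "x < 1" for x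
  proof -
    have mono: "P x - 2 * C * sqrt (1 - x) \<le> P z - 2 * C * sqrt (1 - z)" if z: "x < z" "z < 1" for z
    proof (rule DERIV_nonneg_imp_nondecreasing[OF less_imp_le[OF z(1)]])
      fix t assume t: "x \<le> t" "t \<le> z"
      have t1: "0 < t" "t < 1" using t x z by auto
      have dP: "(P has_real_derivative sqrt t ^ n / t * h (sol d t)) (at t)"
        unfolding P_def[abs_def] by (rule fl_weighted_deriv[OF t1])
      have "((\<lambda>x. P x - 2 * C * sqrt (1 - x)) has_real_derivative
          sqrt t ^ n / t * h (sol d t) + C / sqrt (1 - t)) (at t)"
        using t1 by (auto intro!: derivative_eq_intros dP simp: field_simps)
      moreover have "sqrt t ^ n / t * h (sol d t) \<ge> - (C / sqrt (1 - t))"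
      proof -
        define w where "w = sqrt t ^ n / t"
        have "sqrt t ^ n \<le> sqrt t ^ 2" using t1 n_ge by (intro power_decreasing) auto
        then have w: "0 \<le> w" "w \<le> 1" using t1 by (auto simp: w_def)
        have "w * (- (C / sqrt (1 - t))) \<le> w * h (sol d t)"
          using h_low[of t] t1 w by (intro mult_left_mono) auto
        moreover have "w * (C / sqrt (1 - t)) \<le> 1 * (C / sqrt (1 - t))"
          using w C t1 by (intro mult_right_mono) auto
        ultimately show ?thesis by (simp add: w_def)
      qed
      ultimately show "\<exists>D. ((\<lambda>x. P x - 2 * C * sqrt (1 - x)) has_real_derivative D) (at t) \<and> 0 \<le> D"
        by (intro exI[of _ "sqrt t ^ n / t * h (sol d t) + C / sqrt (1 - t)"]) auto
    qed
    have "((\<lambda>z. P z - 2 * C * sqrt (1 - z)) \<longlongrightarrow> sqrt 1 ^ n * 0 - 2 * C * sqrt (1 - 1)) (at_left 1)"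
      unfolding P_def by (intro tendsto_intros reg)
    moreover have "\<forall>\<^sub>F z in at_left 1. P x - 2 * C * sqrt (1 - x) \<le> P z - 2 * C * sqrt (1 - z)"
      using eventually_at_left_1[OF x(2)] mono by (auto elim!: eventually_mono)
    ultimately have "P x - 2 * C * sqrt (1 - x) \<le> sqrt 1 ^ n * 0 - 2 * C * sqrt (1 - 1)"
      by (intro tendsto_lowerbound) auto
    then show ?thesis by simp
  qed
  have half: "sol d x \<le> 1 + K * ln 2" if "0 \<le> x" "x \<le> 1/2" for x
  proof -
    have "ln (1/2) \<le> ln (1 - x)" using that by (intro ln_mono) auto
    then have "lg x \<le> ln 2" by (simp add: ln_div)
    then have "K * lg x \<le> K * ln 2" using K by (intro mult_left_mono) auto
    then show ?thesis using sb[of x] that by simp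
  qed
  have "sol d y \<le> 1 + K * ln 2 + 2 ^ (n + 2) * C"
  proof (cases "y \<le> 1/2")
    case True
    then show ?thesis using half[of y] y C by (simp add: add_increasing2)
  next
    case False
    \<comment> \<open>On [1/2, 1) the weight y^(n/2) is at least 2^(-n), so \<open>P_le\<close>
      bounds the flux by 2^(n+1) C sqrt (1 - t); integrating the resulting slope bound contributes
      another factor 2.\<close>
    have "sol d y + 2 ^ (n + 2) * C * sqrt (1 - y) \<le> sol d (1/2) + 2 ^ (n + 2) * C * sqrt (1 - 1/2)"
    proof (rule DERIV_nonpos_imp_nonincreasing[where f="\<lambda>y. sol d y + 2 ^ (n + 2) * C * sqrt (1 - y)"])
      show "1/2 \<le> y" using False by simp
      fix t assume t: "1/2 \<le> t" "t \<le> y"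
      then have t1: "0 < t" "t < 1" using y by auto
      have ds: "(sol d has_real_derivative fl d t / (1 - t)) (at t)" by (rule sol_deriv[OF t1])
      have "((\<lambda>y. sol d y + 2 ^ (n + 2) * C * sqrt (1 - y)) has_real_derivative
          fl d t / (1 - t) - 2 ^ (n + 1) * C / sqrt (1 - t)) (at t)"
        using t1 by (auto intro!: derivative_eq_intros ds simp: field_simps)
      moreover have "fl d t / (1 - t) \<le> 2 ^ (n + 1) * C / sqrt (1 - t)"
      proof -
        have "(1/2)\<^sup>2 \<le> t" using t by (simp add: power2_eq_square)
        then have "1/2 \<le> sqrt t" by (intro real_le_rsqrt)
        then have W: "(1/2) ^ n \<le> sqrt t ^ n" by (intro power_mono) auto
        have "fl d t \<le> 2 ^ (n + 1) * C * sqrt (1 - t)"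
        proof (cases "fl d t \<le> 0")
          case True
          then show ?thesis using C t1 by (meson mult_nonneg_nonneg order_trans real_sqrt_ge_zero zero_le_numeral zero_le_power less_imp_le diff_ge_0_iff_ge)
        next
          case False
          then have "(1/2) ^ n * fl d t \<le> P t" unfolding P_def using W by (intro mult_right_mono) auto
          also have "\<dots> \<le> 2 * C * sqrt (1 - t)" using P_le t t1 by auto
          finally show ?thesis by (simp add: power_divide field_simps)
        qed
        then have "fl d t / (1 - t) \<le> 2 ^ (n + 1) * C * sqrt (1 - t) / (1 - t)"
          using t1 by (intro divide_right_mono) auto
        also have "\<dots> = 2 ^ (n + 1) * C / sqrt (1 - t)"
        proof -
          have "sqrt (1 - t) * sqrt (1 - t) = 1 - t" using t1 by simp
          then show ?thesis using t1 by (simp add: frac_eq_eq mult.assoc)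
        qed
        finally show ?thesis .
      qed
      ultimately show "\<exists>D. ((\<lambda>y. sol d y + 2 ^ (n + 2) * C * sqrt (1 - y)) has_real_derivative D) (at t) \<and> D \<le> 0"
        by (intro exI[of _ "fl d t / (1 - t) - 2 ^ (n + 1) * C / sqrt (1 - t)"]) auto
    qed
    moreover have "2 ^ (n + 2) * C * sqrt (1 - 1/2) \<le> 2 ^ (n + 2) * C * 1"
      using C by (intro mult_left_mono) auto
    moreover have "0 \<le> 2 ^ (n + 2) * C * sqrt (1 - y)" using C y by simp
    moreover have "sol d (1/2) \<le> 1 + K * ln 2" by (rule half) auto
    ultimately show ?thesis by linarith
  qed
  then show ?thesis by (simp add: K_def C_def)
qed

end

section \<open>The truncated reaction\<close>

text \<open>The lower cut-off keeps the reaction negative below 0, which is what prevents a solution that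
  has become negative from being regular at \<open>y = 1\<close>.\<close>

definition clamp_to :: "real \<Rightarrow> real \<Rightarrow> real" where
  "clamp_to M v = max (- 1) (min M v)"

definition reaction :: "real \<Rightarrow> real \<Rightarrow> real \<Rightarrow> real \<Rightarrow> real" where
  "reaction \<kappa> q M v = \<kappa> * (clamp_to M v - max 0 (clamp_to M v) powr q)"

lemma powr_lipschitz:
  fixes q M :: real
  assumes "q > 1" "0 \<le> x" "x \<le> y" "y \<le> M"
  shows "y powr q - x powr q \<le> q * M powr (q - 1) * (y - x)"
proof -
  have "q * M powr (q - 1) * x - x powr q \<le> q * M powr (q - 1) * y - y powr q"
  proof (rule DERIV_nonneg_imp_increasing_open[OF assms(3)])
    fix t assume t: "x < t" "t < y"
    have "((\<lambda>x. q * M powr (q - 1) * x - x powr q) has_real_derivative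
        q * M powr (q - 1) - q * t powr (q - 1)) (at t)"
      using t assms by (auto intro!: derivative_eq_intros)
    moreover have "t powr (q - 1) \<le> M powr (q - 1)"
      using t assms by (intro powr_mono2) auto
    then have "0 \<le> q * M powr (q - 1) - q * t powr (q - 1)" using assms by simp
    ultimately show "\<exists>D. ((\<lambda>x. q * M powr (q - 1) * x - x powr q) has_real_derivative D) (at t) \<and> 0 \<le> D"
      by blast
  next
    show "continuous_on {x..y} (\<lambda>x. q * M powr (q - 1) * x - x powr q)"
      using assms by (intro continuous_intros continuous_on_powr') auto
  qed
  then show ?thesis by (simp add: algebra_simps)
qed

lemma reaction_eq: "0 < v \<Longrightarrow> v < M \<Longrightarrow> reaction \<kappa> q M v = \<kappa> * (v - v powr q)"
  by (simp add: reaction_def clamp_to_def)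

lemma reaction_deriv:
  assumes "0 < v" "v < M"
  shows "(reaction \<kappa> q M has_real_derivative \<kappa> * (1 - q * v powr (q - 1))) (at v)"
proof -
  have "((\<lambda>v. \<kappa> * (v - v powr q)) has_real_derivative \<kappa> * (1 - q * v powr (q - 1))) (at v)"
    using assms by (auto intro!: derivative_eq_intros)
  then show ?thesis
    by (rule has_field_derivative_transform_within_open[where S="{0<..<M}"])
       (use assms in \<open>auto simp: reaction_eq\<close>)
qed

lemma shooting_reaction:
  assumes n: "n \<ge> 2" and \<kappa>: "\<kappa> > 0" and q: "q > 1" and M: "M > 1"
  shows "shooting n (reaction \<kappa> q M) (\<kappa> * (M + M powr q)) (\<kappa> * (1 + q * M powr (q - 1)))"
proof
  show "n \<ge> 2" by fact
  show "0 < \<kappa> * (1 + q * M powr (q - 1))" using \<kappa> q by (intro mult_pos_pos) (auto intro: add_pos_nonneg)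
  show "0 < \<kappa> * (M + M powr q)" using \<kappa> M by (intro mult_pos_pos add_pos_nonneg) auto
  fix x y :: real
  have c: "-1 \<le> clamp_to M v" "clamp_to M v \<le> M" for v using M by (auto simp: clamp_to_def)
  show "\<bar>reaction \<kappa> q M x - reaction \<kappa> q M y\<bar> \<le> \<kappa> * (1 + q * M powr (q - 1)) * \<bar>x - y\<bar>"
  proof -
    define a b where "a = clamp_to M x" and "b = clamp_to M y"
    define L where "L = q * M powr (q - 1)"
    have L: "L \<ge> 0" using q by (simp add: L_def)
    have ab: "\<bar>a - b\<bar> \<le> \<bar>x - y\<bar>" unfolding a_def b_def clamp_to_def by (auto simp: max_def min_def)
    have lip: "\<bar>v powr q - w powr q\<bar> \<le> L * \<bar>v - w\<bar>" if "0 \<le> w" "w \<le> v" "v \<le> M" for v w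
    proof -
      have "w powr q \<le> v powr q" using that q by (intro powr_mono2) auto
      then show ?thesis using powr_lipschitz[OF q that] that by (simp add: L_def)
    qed
    have "a \<le> M" "b \<le> M" using c by (auto simp: a_def b_def)
    then have "\<bar>max 0 a powr q - max 0 b powr q\<bar> \<le> L * \<bar>max 0 a - max 0 b\<bar>"
      using lip[of "max 0 a" "max 0 b"] lip[of "max 0 b" "max 0 a"] M
      by (cases "max 0 a \<le> max 0 b") (auto simp: abs_minus_commute max_def split: if_splits)
    also have "\<dots> \<le> L * \<bar>a - b\<bar>" using L by (intro mult_left_mono) (auto simp: max_def)
    finally have "\<bar>(a - max 0 a powr q) - (b - max 0 b powr q)\<bar> \<le> \<bar>a - b\<bar> + L * \<bar>a - b\<bar>"
      by linarith
    also have "\<dots> = (1 + L) * \<bar>a - b\<bar>" by (simp add: ring_distribs)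
    also have "\<dots> \<le> (1 + L) * \<bar>x - y\<bar>" using ab L by (intro mult_left_mono) auto
    finally have "\<kappa> * \<bar>(a - max 0 a powr q) - (b - max 0 b powr q)\<bar> \<le> \<kappa> * ((1 + L) * \<bar>x - y\<bar>)"
      using \<kappa> by simp
    moreover have "\<bar>reaction \<kappa> q M x - reaction \<kappa> q M y\<bar> = \<kappa> * \<bar>(a - max 0 a powr q) - (b - max 0 b powr q)\<bar>"
      using \<kappa> by (simp add: reaction_def a_def b_def abs_mult flip: right_diff_distrib)
    ultimately show ?thesis by (simp add: L_def)
  qed
  show "\<bar>reaction \<kappa> q M x\<bar> \<le> \<kappa> * (M + M powr q)"
  proof -
    define a where "a = clamp_to M x"
    have "max 0 a powr q \<le> M powr q" using c[of x] q M by (intro powr_mono2) (auto simp: a_def)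
    moreover have "\<bar>a\<bar> \<le> M" using c[of x] M by (auto simp: a_def)
    moreover have "0 \<le> max 0 a powr q" by simp
    ultimately have "\<bar>a - max 0 a powr q\<bar> \<le> M + M powr q" by linarith
    then show ?thesis using \<kappa> by (simp add: reaction_def a_def abs_mult)
  qed
  show "reaction \<kappa> q M 0 = 0" "reaction \<kappa> q M 1 = 0" using M by (auto simp: reaction_def clamp_to_def)
  show "0 < reaction \<kappa> q M x" if "0 < x" "x < 1"
  proof -
    have "x powr q < x powr 1" using that q by (intro powr_less_mono') auto
    then show ?thesis using that M \<kappa> by (simp add: reaction_eq)
  qed
  show "reaction \<kappa> q M x < 0" if "x < 0 \<or> 1 < x"
  proof (cases "x < 0")
    case True
    then have "clamp_to M x < 0" using M by (auto simp: clamp_to_def)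
    then show ?thesis using \<kappa> by (simp add: reaction_def max_def mult_pos_neg)
  next
    case False
    define a where "a = clamp_to M x"
    have a: "1 < a" using that False M by (auto simp: a_def clamp_to_def)
    then have "a powr 1 < a powr q" using q by (intro powr_less_mono) auto
    then show ?thesis using \<kappa> a by (simp add: reaction_def a_def[symmetric] mult_pos_neg)
  qed
qed

text \<open>The function \<open>g\<close> vanishes at 1 with derivative K - \<kappa> (q - 1) < 0, so
  it has the sign opposite to v - 1 nearby. For K the k-th eigenvalue this is the hypothesis of the
  Sturm comparison.\<close>

lemma reaction_faster:
  assumes \<kappa>: "\<kappa> > 0" and q: "q > 1" and M: "M > 1" and K: "K < \<kappa> * (q - 1)"
  shows "\<exists>\<epsilon>>0. \<forall>v. v \<noteq> 1 \<longrightarrow> \<bar>v - 1\<bar> < \<epsilon> \<longrightarrow> (v - 1) * (reaction \<kappa> q M v + K * (v - 1)) < 0"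
proof -
  define g where "g v = reaction \<kappa> q M v + K * (v - 1)" for v
  have "(g has_real_derivative \<kappa> * (1 - q * 1 powr (q - 1)) + K * (1 - 0)) (at 1)"
    unfolding g_def[abs_def] by (intro DERIV_add DERIV_cmult DERIV_diff DERIV_ident DERIV_const reaction_deriv) (use M in auto)
  then have dg: "(g has_real_derivative K - \<kappa> * (q - 1)) (at 1)" by (simp add: algebra_simps)
  have neg: "K - \<kappa> * (q - 1) < 0" using K by simp
  have g1: "g 1 = 0" using M by (simp add: g_def reaction_eq)
  obtain e1 where e1: "e1 > 0" "\<And>k. 0 < k \<Longrightarrow> k < e1 \<Longrightarrow> g (1 + k) < 0"
    using DERIV_neg_dec_right[OF dg neg] g1 by auto
  obtain e2 where e2: "e2 > 0" "\<And>k. 0 < k \<Longrightarrow> k < e2 \<Longrightarrow> g (1 - k) > 0"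
    using DERIV_neg_dec_left[OF dg neg] g1 by auto
  have "(v - 1) * g v < 0" if "v \<noteq> 1" "\<bar>v - 1\<bar> < min e1 e2" for v
    using e1(2)[of "v - 1"] e2(2)[of "1 - v"] that
    by (cases "v < 1") (auto intro: mult_neg_pos mult_pos_neg)
  then show ?thesis using e1 e2 by (intro exI[of _ "min e1 e2"]) (auto simp: g_def)
qed

theorem radial_solutions:
  fixes n k :: nat and \<kappa> q :: real
  assumes n: "n \<ge> 2" and \<kappa>: "\<kappa> > 0" and q: "q > 1" and k: "k \<ge> 1" and K: "k * (k + n / 2) < \<kappa> * (q - 1)"
  shows "\<exists>D. finite D \<and> card D = k \<and> (\<forall>d\<in>D. \<exists>G. radial_solution n (\<lambda>v. \<kappa> * (v - v powr q)) d G)"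
proof -
  \<comment> \<open>The bound of \<open>regular_solution_bounded\<close>, which depends on \<kappa>,
    q and n alone. Hence the cut-off M may be placed above it afterwards, and no regular shot
    reaches the truncated range.\<close>
  define M0 where "M0 = 1 + 2 * \<kappa> / n * ln 2 + 2 ^ (n + 2) * (\<kappa> * ((1 + 2 * \<kappa> / n) * (2 * q)) powr q)"
  define M where "M = M0 + 1"
  have "M0 \<ge> 1" using \<kappa> n by (simp add: M0_def)
  then have M: "M > 1" by (simp add: M_def)
  interpret shooting n "reaction \<kappa> q M" "\<kappa> * (M + M powr q)" "\<kappa> * (1 + q * M powr (q - 1))"
    by (rule shooting_reaction[OF n \<kappa> q M])
  have le: "reaction \<kappa> q M v \<le> \<kappa>" for v
  proof (cases "0 < v \<and> v < 1")
    case True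
    have "0 \<le> v powr q" by simp
    then have "v - v powr q \<le> 1" using True by linarith
    then show ?thesis using True M \<kappa> by (simp add: reaction_eq)
  next
    case False
    then consider "v = 0" | "v = 1" | "v < 0 \<or> 1 < v" by linarith
    then have "reaction \<kappa> q M v \<le> 0" by cases (auto simp: h_0 h_1 intro: less_imp_le h_neg)
    then show ?thesis using \<kappa> by simp
  qed
  have ge: "- (\<kappa> * v powr q) \<le> reaction \<kappa> q M v" if "0 < v" for v
  proof -
    define a where "a = clamp_to M v"
    have a: "0 < a" "a \<le> v" using that M by (auto simp: a_def clamp_to_def)
    have "a powr q \<le> v powr q" using a q by (intro powr_mono2) auto
    then have "- (v powr q) \<le> a - a powr q" using a by linarith
    then have "\<kappa> * - (v powr q) \<le> \<kappa> * (a - a powr q)" using \<kappa> by (intro mult_left_mono) auto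
    then show ?thesis using a by (simp add: reaction_def a_def[symmetric])
  qed
  obtain \<epsilon> where \<epsilon>: "\<epsilon> > 0" "\<And>v. v \<noteq> 1 \<Longrightarrow> \<bar>v - 1\<bar> < \<epsilon> \<Longrightarrow>
      (v - 1) * (reaction \<kappa> q M v + jac_eigenvalue n k * (v - 1)) < 0"
    using reaction_faster[OF \<kappa> q M, of "jac_eigenvalue n k"] K unfolding jac_eigenvalue_def by blast
  obtain D where D: "finite D" "card D = k - 1" "D \<subseteq> {0<..<1}" "\<And>d. d \<in> D \<Longrightarrow> (fl d \<longlongrightarrow> 0) (at_left 1)"
    using regular_solutions[OF k \<epsilon>] by blast
  have solve: "\<exists>G. radial_solution n (\<lambda>v. \<kappa> * (v - v powr q)) d G" if d: "d \<in> D" for d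
  proof -
    have d01: "0 < d" "d < 1" using d D(3) by auto
    have bound: "sol d y \<le> M0" if "0 \<le> y" "y < 1" for y
      unfolding M0_def by (rule regular_solution_bounded[OF \<kappa> q le ge d01(1) less_imp_le[OF d01(2)] D(4)[OF d] that])
    have cont: "isCont (\<lambda>v. \<kappa> * (1 - q * v powr (q - 1))) v" if "0 < v" for v
      using that by (intro continuous_intros) auto
    have "\<exists>G. radial_solution n (reaction \<kappa> q M) d G \<and> (\<forall>y\<in>{0..1}. G y \<le> M0)"
      by (rule regular_solution_C2[OF d01(1) D(4)[OF d] bound, where M=M and h'="\<lambda>v. \<kappa> * (1 - q * v powr (q - 1))"])
         (use reaction_deriv cont in \<open>auto simp: M_def\<close>)
    then obtain G where G: "radial_solution n (reaction \<kappa> q M) d G" "\<And>y. y \<in> {0..1} \<Longrightarrow> G y \<le> M0"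
      by blast
    have "reaction \<kappa> q M (G y) = \<kappa> * (G y - G y powr q)" if "y \<in> {0..1}" "0 < G y" for y
      using G(2)[OF that(1)] that(2) by (intro reaction_eq) (auto simp: M_def)
    moreover obtain G1 G2 where "\<forall>x. (G has_real_derivative G1 x) (at x)" "\<forall>x. (G1 has_real_derivative G2 x) (at x)"
      "\<forall>x. isCont G2 x" "G 0 = d"
      "\<forall>y\<in>{0..1}. 0 < G y \<and> y * (1 - y) * G2 y + (n / 2 - (n / 2 + 1) * y) * G1 y = reaction \<kappa> q M (G y)"
      using G(1) unfolding radial_solution_def by blast
    ultimately have "radial_solution n (\<lambda>v. \<kappa> * (v - v powr q)) d G"
      unfolding radial_solution_def by - (rule exI[of _ G1], rule exI[of _ G2], simp)
    then show ?thesis by blast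
  qed
  \<comment> \<open>The constant solution has initial value 1, distinct from all of
    \<open>D\<close>, and raises the count from k - 1 to k.\<close>
  have one: "radial_solution n (\<lambda>v. \<kappa> * (v - v powr q)) 1 (\<lambda>_. 1)"
    unfolding radial_solution_def by (intro exI[of _ "\<lambda>_. 0"]) auto
  have "card (insert 1 D) = k" using D k by (subst card_insert_disjoint) auto
  then show ?thesis using D(1) solve one by (intro exI[of _ "insert 1 D"]) auto
qed

section \<open>The quadric height on projective space\<close>

lemma C2_fun_const: "C2_fun (\<lambda>_. c)"
  unfolding C2_fun_def
  by (rule exI[of _ "\<lambda>_. 0"], rule exI[of _ "\<lambda>_. 0"]) (auto intro!: derivative_eq_intros simp: zero_blinfun.rep_eq)

lemma C2_fun_linear:
  assumes "bounded_linear f"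
  shows "C2_fun f"
  unfolding C2_fun_def
  by (rule exI[of _ "\<lambda>_. Blinfun f"], rule exI[of _ "\<lambda>_. 0"])
     (use assms in \<open>auto simp: bounded_linear_Blinfun_apply bounded_linear_imp_has_derivative zero_blinfun.rep_eq
      intro!: derivative_eq_intros\<close>)

lemma C2_fun_add:
  assumes "C2_fun f" "C2_fun g"
  shows "C2_fun (\<lambda>x. f x + g x)"
proof -
  obtain f' f'' where f: "\<And>x. (f has_derivative blinfun_apply (f' x)) (at x)"
    "\<And>x. (f' has_derivative blinfun_apply (f'' x)) (at x)" "continuous_on UNIV f''"
    using assms(1) by (auto simp: C2_fun_def)
  obtain g' g'' where g: "\<And>x. (g has_derivative blinfun_apply (g' x)) (at x)"
    "\<And>x. (g' has_derivative blinfun_apply (g'' x)) (at x)" "continuous_on UNIV g''"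
    using assms(2) by (auto simp: C2_fun_def)
  show ?thesis
    unfolding C2_fun_def
  proof (intro exI conjI allI)
    fix x
    show "((\<lambda>x. f x + g x) has_derivative blinfun_apply (f' x + g' x)) (at x)"
      using has_derivative_add[OF f(1) g(1)] by (simp add: plus_blinfun.rep_eq)
    show "((\<lambda>x. f' x + g' x) has_derivative blinfun_apply (f'' x + g'' x)) (at x)"
      using has_derivative_add[OF f(2) g(2)] by (simp add: plus_blinfun.rep_eq)
  qed (intro continuous_intros f g)
qed

text \<open>The outer function is needed only on a set containing the range, so that 1 / t^2 can be
  used on positive numbers.\<close>

lemma C2_fun_compose:
  fixes g g1 g2 :: "real \<Rightarrow> real"
  assumes "C2_fun f" and fS: "\<And>x. f x \<in> S"
    and g: "\<And>t. t \<in> S \<Longrightarrow> (g has_real_derivative g1 t) (at t)" "\<And>t. t \<in> S \<Longrightarrow> (g1 has_real_derivative g2 t) (at t)"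
      "continuous_on S g2"
  shows "C2_fun (\<lambda>x. g (f x))"
proof -
  obtain f' f'' where f: "\<And>x. (f has_derivative blinfun_apply (f' x)) (at x)"
    "\<And>x. (f' has_derivative blinfun_apply (f'' x)) (at x)" "continuous_on UNIV f''"
    using assms(1) by (auto simp: C2_fun_def)
  have cf: "continuous_on UNIV f" "continuous_on UNIV f'"
    using f(1,2) has_derivative_continuous by (auto simp: continuous_on_eq_continuous_at) blast+
  have cg1: "continuous_on S g1"
    using g(2) DERIV_isCont by (blast intro: continuous_at_imp_continuous_on)
  have chain: "((\<lambda>x. k (f x)) has_derivative (\<lambda>v. k' * f' x v)) (at x)"
    if "(k has_real_derivative k') (at (f x))" for k k' x
    using has_derivative_compose[OF f(1) that[unfolded has_field_derivative_def]] by simp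
  show ?thesis
    unfolding C2_fun_def
  proof (intro exI conjI allI)
    fix x
    show "((\<lambda>x. g (f x)) has_derivative blinfun_apply (g1 (f x) *\<^sub>R f' x)) (at x)"
      using chain[OF g(1)[OF fS]] by (simp add: scaleR_blinfun.rep_eq)
    have "((\<lambda>x. g1 (f x) *\<^sub>R f' x) has_derivative (\<lambda>v. g1 (f x) *\<^sub>R f'' x v + (g2 (f x) * f' x v) *\<^sub>R f' x)) (at x)"
      by (rule has_derivative_scaleR[OF chain[OF g(2)[OF fS]] f(2)])
    then show "((\<lambda>x. g1 (f x) *\<^sub>R f' x) has_derivative
        blinfun_apply (g1 (f x) *\<^sub>R f'' x + (blinfun_scaleR_left (f' x) o\<^sub>L (g2 (f x) *\<^sub>R f' x)))) (at x)"
      by (simp add: scaleR_blinfun.rep_eq plus_blinfun.rep_eq)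
  next
    have "continuous_on UNIV (\<lambda>x. g1 (f x))" "continuous_on UNIV (\<lambda>x. g2 (f x))"
      using fS by (auto intro: continuous_on_compose2[OF cg1 cf(1)] continuous_on_compose2[OF g(3) cf(1)])
    moreover have "continuous_on UNIV (\<lambda>x. blinfun_scaleR_left (f' x))"
      by (rule bounded_linear.continuous_on[OF bounded_linear_blinfun_scaleR_left cf(2)])
    ultimately show "continuous_on UNIV (\<lambda>x. g1 (f x) *\<^sub>R f'' x + (blinfun_scaleR_left (f' x) o\<^sub>L (g2 (f x) *\<^sub>R f' x)))"
      by (intro continuous_intros f(3) cf bounded_bilinear.continuous_on[OF bounded_bilinear_blinfun_compose])
  qed
qed

lemma C2_fun_square: "C2_fun f \<Longrightarrow> C2_fun (\<lambda>x. (f x)\<^sup>2)"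
  by (rule C2_fun_compose[of f UNIV "\<lambda>t. t\<^sup>2" "\<lambda>t. 2 * t" "\<lambda>_. 2"]) (auto intro!: derivative_eq_intros)

lemma C2_fun_cmult: "C2_fun f \<Longrightarrow> C2_fun (\<lambda>x. c * f x)"
  by (rule C2_fun_compose[of f UNIV "\<lambda>t. c * t" "\<lambda>t. c" "\<lambda>_. 0"]) (auto intro!: derivative_eq_intros)

lemma C2_fun_diff: "C2_fun f \<Longrightarrow> C2_fun g \<Longrightarrow> C2_fun (\<lambda>x. f x - g x)"
  using C2_fun_add[OF _ C2_fun_cmult, of f g "-1"] by simp

text \<open>By polarization, which reduces products to sums and squares and avoids a second
  calculation with bounded bilinear maps.\<close>

lemma C2_fun_mult:
  assumes "C2_fun f" "C2_fun g"
  shows "C2_fun (\<lambda>x. f x * g x)"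
proof -
  have "(\<lambda>x. f x * g x) = (\<lambda>x. 1 / 2 * ((f x + g x)\<^sup>2 - ((f x)\<^sup>2 + (g x)\<^sup>2)))"
    by (auto simp: power2_sum)
  then show ?thesis
    using assms by (simp only:) (intro C2_fun_cmult C2_fun_diff C2_fun_add C2_fun_square)
qed

lemma C2_fun_sum: "(\<And>i. i \<in> I \<Longrightarrow> C2_fun (f i)) \<Longrightarrow> C2_fun (\<lambda>x. \<Sum>i\<in>I. f i x)"
  by (induction I rule: infinite_finite_induct) (auto intro: C2_fun_const C2_fun_add)

section \<open>Invariance of Hermitian products and sums of squares\<close>

text \<open>The form is bilinear, with two matrices. \<open>B\<close> the conjugate of
  \<open>A\<close> gives the Hermitian product for unitary matrices; \<open>A = B\<close> gives the
  sum of squares for real orthogonal ones.\<close>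

lemma matrix_product_invariance:
  fixes A B :: "complex ^ 'n ^ ('n :: finite)"
  assumes "\<And>i j. (\<Sum>k\<in>UNIV. A $ k $ i * B $ k $ j) = (if i = j then 1 else 0)"
  shows "(\<Sum>k\<in>UNIV. (A *v v) $ k * (B *v w) $ k) = (\<Sum>i\<in>UNIV. v $ i * w $ i)"
proof -
  have "(\<Sum>k\<in>UNIV. (A *v v) $ k * (B *v w) $ k) =
      (\<Sum>k\<in>UNIV. \<Sum>i\<in>UNIV. \<Sum>j\<in>UNIV. (v $ i * w $ j) * (A $ k $ i * B $ k $ j))"
    by (simp add: matrix_vector_mult_def sum_product mult_ac)
  also have "\<dots> = (\<Sum>i\<in>UNIV. \<Sum>k\<in>UNIV. \<Sum>j\<in>UNIV. (v $ i * w $ j) * (A $ k $ i * B $ k $ j))"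
    by (rule sum.swap)
  also have "\<dots> = (\<Sum>i\<in>UNIV. \<Sum>j\<in>UNIV. \<Sum>k\<in>UNIV. (v $ i * w $ j) * (A $ k $ i * B $ k $ j))"
    by (intro sum.cong refl sum.swap)
  also have "\<dots> = (\<Sum>i\<in>UNIV. \<Sum>j\<in>UNIV. (v $ i * w $ j) * (if i = j then 1 else 0))"
    by (simp only: sum_distrib_left[symmetric] assms)
  also have "\<dots> = (\<Sum>i\<in>UNIV. v $ i * w $ i)"
    by (simp add: if_distrib[of "\<lambda>x. _ * x"] cong: if_cong)
  finally show ?thesis .
qed

lemma unitary_columns:
  assumes "unitary_matrix A"
  shows "(\<Sum>k\<in>UNIV. cnj (A $ k $ i) * A $ k $ j) = (if i = j then 1 else 0)"
  using assms by (auto simp: unitary_matrix_def vec_eq_iff matrix_matrix_mult_def mat_def)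

lemma herm_unitary:
  assumes "unitary_matrix A"
  shows "herm (A *v v) (A *v w) = herm v w"
proof -
  have "(\<Sum>k\<in>UNIV. A $ k $ i * (\<chi> i j. cnj (A $ i $ j)) $ k $ j) = (if i = j then 1 else 0)" for i j
    using unitary_columns[OF assms, of j i] by (auto simp: mult.commute)
  from matrix_product_invariance[OF this, of v "\<chi> i. cnj (w $ i)"]
  show ?thesis by (simp add: herm_def matrix_vector_mult_def)
qed

lemma inner_eq_Re_herm: "v \<bullet> w = Re (herm v w)"
  by (simp add: herm_def inner_vec_def inner_complex_def)

lemma herm_self: "herm v v = complex_of_real ((norm v)\<^sup>2)"
  unfolding norm_square_herm herm_def by (simp add: mult.commute)

lemma norm_unitary: "unitary_matrix A \<Longrightarrow> norm (A *v v) = norm v"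
  using herm_unitary[of A v v] unfolding herm_self by (metis norm_ge_zero of_real_eq_iff power2_eq_iff_nonneg)

lemma norm_vscale: "norm (c *s z) = cmod c * norm (z :: complex ^ 'n :: finite)"
  by (simp add: norm_vec_def L2_set_right_distrib norm_mult)

section \<open>The invariant height function\<close>

definition sumsq :: "complex ^ ('n :: finite) \<Rightarrow> complex" where
  "sumsq z = (\<Sum>i\<in>UNIV. (z $ i)\<^sup>2)"

lemma sumsq_scale: "sumsq (c *s z) = c\<^sup>2 * sumsq z"
  by (simp add: sumsq_def power_mult_distrib sum_distrib_left)

lemma cmod_sumsq_le: "cmod (sumsq z) \<le> (norm z)\<^sup>2"
proof -
  have "cmod (sumsq z) \<le> (\<Sum>i\<in>UNIV. (cmod (z $ i))\<^sup>2)"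
    unfolding sumsq_def by (rule order_trans[OF norm_sum]) (simp add: norm_power)
  also have "\<dots> = (norm z)\<^sup>2" by (simp add: norm_vec_def L2_set_def sum_nonneg)
  finally show ?thesis .
qed

text \<open>This is 1 - y in the notation of the radial equation: 0 on the quadric, 1 on the real
  projective space. Numerator and denominator are homogeneous of the same degree, so the
  representative is immaterial.\<close>

definition quadric_height :: "('n :: finite) cproj \<Rightarrow> real" where
  "quadric_height p = (let z = SOME z. z \<noteq> 0 \<and> p = proj z in (cmod (sumsq z))\<^sup>2 / (norm z) ^ 4)"

lemma line_of_proj: "z \<noteq> 0 \<Longrightarrow> line_of (proj z) = vec.span {z}"
  unfolding proj_def by (rule Cproj_inverse) auto

lemma proj_eqD:
  assumes "proj z = proj w" "z \<noteq> 0" "w \<noteq> 0"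
  obtains c where "c \<noteq> 0" "w = c *s z"
proof -
  have "vec.span {z} = vec.span {w}" using assms line_of_proj by metis
  then have "w \<in> vec.span {z}" by (simp add: vec.span_base)
  then obtain c where "w = c *s z" by (auto simp: vec.span_singleton)
  then show thesis using that[of c] assms(3) by auto
qed

lemma quadric_height_proj:
  assumes "z \<noteq> 0"
  shows "quadric_height (proj z) = (cmod (sumsq z))\<^sup>2 / (norm z) ^ 4"
proof -
  define w where "w = (SOME w. w \<noteq> 0 \<and> proj z = proj w)"
  have "w \<noteq> 0 \<and> proj z = proj w"
    unfolding w_def by (rule someI[of _ z]) (use assms in simp)
  then obtain c where c: "c \<noteq> 0" "w = c *s z" using proj_eqD assms by metis
  have "quadric_height (proj z) = (cmod (sumsq w))\<^sup>2 / (norm w) ^ 4"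
    by (simp add: quadric_height_def w_def Let_def)
  also have "\<dots> = (cmod (sumsq z))\<^sup>2 / (norm z) ^ 4"
    using c(1) unfolding c(2) sumsq_scale norm_vscale norm_mult norm_power
    by (simp add: power_mult_distrib flip: power_mult)
  finally show ?thesis .
qed

lemma quadric_height_bounds: "0 \<le> quadric_height p" "quadric_height p \<le> 1"
proof -
  obtain z where z: "z \<noteq> 0" "p = proj z" by (rule proj_cases)
  have "(cmod (sumsq z))\<^sup>2 \<le> ((norm z)\<^sup>2)\<^sup>2" by (intro power_mono cmod_sumsq_le) simp
  then have "(cmod (sumsq z))\<^sup>2 \<le> (norm z) ^ 4" by simp
  then show "0 \<le> quadric_height p" "quadric_height p \<le> 1"
    using z by (auto simp: quadric_height_proj)
qed

lemma cproj_map_proj: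
  assumes "z \<noteq> 0"
  shows "cproj_map A (proj z) = proj (A *v z)"
proof -
  have "(*v) A ` vec.span {z} = vec.span {A *v z}"
    by (auto simp: vec.span_singleton image_image vector_scalar_commute)
  then show ?thesis using assms by (simp add: cproj_map_def line_of_proj) (simp add: proj_def)
qed

text \<open>A real orthogonal matrix is also unitary when read over the complex numbers, so it
  preserves both the sum of squares and the norm.\<close>

lemma quadric_height_rotation:
  fixes R :: "real ^ 'n ^ ('n :: finite)"
  assumes "rotation_matrix R"
  shows "quadric_height (cproj_map (complex_matrix R) p) = quadric_height p"
proof -
  obtain z where z: "z \<noteq> 0" "p = proj z" by (rule proj_cases)
  define A where "A = complex_matrix R"
  have "transpose R ** R = mat 1" using assms by (simp add: rotation_matrix_def orthogonal_matrix)
  then have "(\<Sum>k\<in>UNIV. R $ k $ i * R $ k $ j) = (if i = j then 1 else 0)" for i j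
    by (auto simp: vec_eq_iff matrix_matrix_mult_def mat_def transpose_def)
  then have "complex_of_real (\<Sum>k\<in>UNIV. R $ k $ i * R $ k $ j) = (if i = j then 1 else 0)" for i j
    by simp
  then have cols: "(\<Sum>k\<in>UNIV. A $ k $ i * A $ k $ j) = (if i = j then 1 else 0)" for i j
    by (simp add: A_def complex_matrix_def)
  have sq: "sumsq (A *v z) = sumsq z"
    using matrix_product_invariance[OF cols, of z z] by (simp add: sumsq_def power2_eq_square)
  have "unitary_matrix A"
    unfolding unitary_matrix_def using cols
    by (simp add: vec_eq_iff matrix_matrix_mult_def mat_def A_def complex_matrix_def)
  then have nrm: "norm (A *v z) = norm z" by (rule norm_unitary)
  then have "A *v z \<noteq> 0" using z(1) by auto
  then have "quadric_height (proj (A *v z)) = quadric_height (proj z)"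
    using z(1) by (simp add: quadric_height_proj sq nrm)
  then show ?thesis using z by (simp add: cproj_map_proj A_def)
qed

lemma sum_option: "(\<Sum>i\<in>UNIV. f i) = f None + (\<Sum>j\<in>UNIV. f (Some j))" for f :: "('m :: finite) option \<Rightarrow> 'a :: comm_monoid_add"
  by (simp add: UNIV_option_conv sum.reindex)

lemma sum_plus: "(\<Sum>i\<in>UNIV. f i) = (\<Sum>j\<in>UNIV. f (Inl j)) + (\<Sum>j\<in>UNIV. f (Inr j))"
  for f :: "('m :: finite) + ('k :: finite) \<Rightarrow> 'a :: comm_monoid_add"
  using sum.Plus[of "UNIV :: 'm set" "UNIV :: 'k set" f] by (simp add: o_def)

lemma affine_vec_None [simp]: "affine_vec x $ None = 1"
  and affine_vec_Some [simp]: "affine_vec x $ Some j = Complex (x $ Inl j) (x $ Inr j)"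
  by (simp_all add: affine_vec_def)

lemma norm_affine_vec: "(norm (affine_vec x))\<^sup>2 = 1 + x \<bullet> x"
  by (simp add: power2_norm_eq_inner inner_vec_def sum_option sum_plus inner_complex_def sum.distrib)

lemma affine_vec_nonzero [simp]: "affine_vec x \<noteq> 0"
  by (metis affine_vec_None zero_index zero_neq_one)

lemma unitary_affine_nonzero: "unitary_matrix A \<Longrightarrow> A *v affine_vec x \<noteq> 0"
  using norm_unitary[of A "affine_vec x"] by auto

lemma quadric_height_chart:
  assumes "unitary_matrix A"
  shows "quadric_height (chart A x) =
    ((Re (sumsq (A *v affine_vec x)))\<^sup>2 + (Im (sumsq (A *v affine_vec x)))\<^sup>2) / (1 + x \<bullet> x)\<^sup>2"
proof -
  have "norm (affine_vec x) ^ 4 = ((norm (affine_vec x))\<^sup>2)\<^sup>2" by simp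
  then have "norm (affine_vec x) ^ 4 = (1 + x \<bullet> x)\<^sup>2" by (simp only: norm_affine_vec)
  then show ?thesis
    using assms by (simp add: chart_def quadric_height_proj unitary_affine_nonzero norm_unitary cmod_power2)
qed

lemma C2_quadric_height_chart:
  assumes "unitary_matrix (A :: complex ^ ('m :: finite) option ^ 'm option)"
  shows "C2_fun (\<lambda>x. quadric_height (chart A x))"
proof -
  have co: "C2_fun (\<lambda>x :: real ^ ('m + 'm). x $ a)" for a
    by (rule C2_fun_linear) (rule bounded_linear_vec_nth)
  have re: "C2_fun (\<lambda>x. Re ((A *v affine_vec x) $ i))" for i
    by (simp add: matrix_vector_mult_def sum_option)
       (intro C2_fun_add C2_fun_sum C2_fun_diff C2_fun_cmult C2_fun_const co)
  have im: "C2_fun (\<lambda>x. Im ((A *v affine_vec x) $ i))" for i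
    by (simp add: matrix_vector_mult_def sum_option)
       (intro C2_fun_add C2_fun_sum C2_fun_diff C2_fun_cmult C2_fun_const co)
  have resq: "C2_fun (\<lambda>x. Re (sumsq (A *v affine_vec x)))"
    by (simp add: sumsq_def power2_eq_square) (intro C2_fun_sum C2_fun_diff C2_fun_mult re im)
  have imsq: "C2_fun (\<lambda>x. Im (sumsq (A *v affine_vec x)))"
    by (simp add: sumsq_def power2_eq_square) (intro C2_fun_sum C2_fun_add C2_fun_mult C2_fun_const re im)
  have "C2_fun (\<lambda>x :: real ^ ('m + 'm). 1 + x \<bullet> x)"
    unfolding inner_vec_def inner_real_def by (intro C2_fun_add C2_fun_const C2_fun_sum C2_fun_mult co)
  then have "C2_fun (\<lambda>x :: real ^ ('m + 'm). (\<lambda>t. 1 / t\<^sup>2) (1 + x \<bullet> x))"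
  proof (rule C2_fun_compose[of "\<lambda>x. 1 + x \<bullet> x" "{0<..}" "\<lambda>t. 1 / t\<^sup>2" "\<lambda>t. - 2 / t ^ 3" "\<lambda>t. 6 / t ^ 4"])
    show "1 + x \<bullet> x \<in> {0<..}" for x :: "real ^ ('m + 'm)" by (simp add: add_pos_nonneg)
  qed (auto intro!: derivative_eq_intros continuous_intros simp: field_simps eval_nat_numeral)
  then have "C2_fun (\<lambda>x. ((Re (sumsq (A *v affine_vec x)))\<^sup>2 + (Im (sumsq (A *v affine_vec x)))\<^sup>2) * (1 / (1 + x \<bullet> x)\<^sup>2))"
    by (intro C2_fun_mult[OF C2_fun_add] C2_fun_square resq imsq)
  then show ?thesis by (simp add: quadric_height_chart[OF assms])
qed

section \<open>The Laplacian in a centred chart\<close>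

text \<open>The linear part of the affine parametrization \<open>affine_vec\<close>, that is, its
  derivative at every point.\<close>

definition affine_dir :: "real ^ ('m + 'm) \<Rightarrow> complex ^ (('m :: finite) option)" where
  "affine_dir x = (\<chi> i. case i of None \<Rightarrow> 0 | Some j \<Rightarrow> Complex (x $ Inl j) (x $ Inr j))"

lemma affine_dir_None [simp]: "affine_dir x $ None = 0"
  and affine_dir_Some [simp]: "affine_dir x $ Some j = Complex (x $ Inl j) (x $ Inr j)"
  by (simp_all add: affine_dir_def)

lemma affine_vec_eq: "affine_vec x = axis None 1 + affine_dir x"
proof -
  have "affine_vec x $ i = (axis None 1 + affine_dir x) $ i" for i
    by (cases i) (auto simp: axis_def)
  then show ?thesis by (simp add: vec_eq_iff)
qed

lemma linear_affine_dir: "linear affine_dir"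
proof (rule linearI)
  fix x y :: "real ^ ('a + 'a)" and c :: real
  have "affine_dir (x + y) $ i = (affine_dir x + affine_dir y) $ i"
    "affine_dir (c *\<^sub>R x) $ i = (c *\<^sub>R affine_dir x) $ i" for i
    by (cases i; simp add: complex_eq_iff)+
  then show "affine_dir (x + y) = affine_dir x + affine_dir y" "affine_dir (c *\<^sub>R x) = c *\<^sub>R affine_dir x"
    by (simp_all add: vec_eq_iff)
qed

lemma linear_matrix_complex: "linear ((*v) (A :: complex ^ 'n ^ ('k :: finite)))"
  by (rule linearI) (simp_all add: vec_eq_iff matrix_vector_mult_def scaleR_sum_right sum.distrib distrib_left)

lemma herm_add_left: "herm (v + v') w = herm v w + herm v' w"
  and herm_diff_left: "herm (v - v') w = herm v w - herm v' w"
  and herm_diff_right: "herm v (w - w') = herm v w - herm v w'"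
  and herm_scale_left: "herm (c *s v) w = c * herm v w"
  and herm_scale_right: "herm v (c *s w) = cnj c * herm v w"
  and herm_cnj: "cnj (herm v w) = herm w v"
  by (simp_all add: herm_def sum.distrib sum_subtractf sum_distrib_left algebra_simps)

lemma scaleR_eq_vscale: "r *\<^sub>R v = complex_of_real r *s (v :: complex ^ 'n)"
  by (simp add: vec_eq_iff) (simp add: scaleR_conv_of_real)

section \<open>The metric in affine coordinates and its inverse\<close>

lemma hopf_horizontal_inner:
  assumes "herm z z = 1"
  shows "hopf_horizontal z v \<bullet> hopf_horizontal z w = Re (herm v w - herm v z * cnj (herm w z))"
proof -
  have "herm (v - herm v z *s z) (w - herm w z *s z) = herm v w - herm v z * cnj (herm w z)"
    using assms herm_cnj[of w z]
    by (simp add: herm_diff_left herm_diff_right herm_scale_left herm_scale_right algebra_simps)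
  then show ?thesis by (simp add: hopf_horizontal_def inner_eq_Re_herm)
qed

text \<open>Imaginary parts of the Hermitian products of the coordinate directions with the point; the
  real parts are the coordinates themselves.\<close>

definition quarter_turn :: "real ^ ('m + 'm) \<Rightarrow> real ^ (('m :: finite) + 'm)" where
  "quarter_turn x = (\<chi> a. case a of Inl j \<Rightarrow> - (x $ Inr j) | Inr j \<Rightarrow> x $ Inl j)"

lemma herm_axis_affine: "herm (affine_dir (axis a 1)) (affine_vec x) = Complex (x $ a) (quarter_turn x $ a)"
proof (cases a)
  case (Inl j)
  have "affine_dir (axis a 1 :: real ^ ('a + 'a)) = axis (Some j) 1"
  proof -
    have "affine_dir (axis a 1 :: real ^ ('a + 'a)) $ i = axis (Some j) 1 $ i" for i
      using Inl by (cases i) (auto simp: axis_def complex_eq_iff)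
    then show ?thesis by (simp add: vec_eq_iff)
  qed
  then show ?thesis
    using Inl by (simp add: herm_def axis_def if_distrib[of "\<lambda>y. y * _"] quarter_turn_def complex_eq_iff cong: if_cong)
next
  case (Inr j)
  have "affine_dir (axis a 1 :: real ^ ('a + 'a)) = axis (Some j) \<i>"
  proof -
    have "affine_dir (axis a 1 :: real ^ ('a + 'a)) $ i = axis (Some j) \<i> $ i" for i
      using Inr by (cases i) (auto simp: axis_def complex_eq_iff)
    then show ?thesis by (simp add: vec_eq_iff)
  qed
  then show ?thesis
    using Inr by (simp add: herm_def axis_def if_distrib[of "\<lambda>y. y * _"] quarter_turn_def complex_eq_iff cong: if_cong)
qed

lemma inner_affine_dir: "affine_dir v \<bullet> affine_dir w = v \<bullet> w"
  by (simp add: inner_vec_def sum_option sum_plus inner_complex_def sum.distrib)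

lemma partial_eqI: "(f has_derivative D) (at x) \<Longrightarrow> partial a f x = D (axis a 1)"
  using frechet_derivative_at[of f D x] by (simp add: partial_def)

text \<open>Independent of \<open>A\<close>, because only Hermitian products of vectors multiplied
  by \<open>A\<close> enter.\<close>

lemma fubini_study_formula:
  assumes A: "unitary_matrix A"
  shows "fubini_study A x $ a $ b =
    ((if a = b then 1 else 0) - (x $ a * x $ b + quarter_turn x $ a * quarter_turn x $ b) / (1 + x \<bullet> x)) / (1 + x \<bullet> x)"
proof -
  define \<rho> where "\<rho> = 1 + x \<bullet> x"
  define N where "N = sqrt \<rho>"
  have \<rho>: "\<rho> > 0" by (simp add: \<rho>_def add_pos_nonneg)
  then have N: "N > 0" "N * N = \<rho>" by (auto simp: N_def)
  have nrm: "norm (A *v affine_vec y) = sqrt (1 + y \<bullet> y)" for y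
    using norm_affine_vec[of y] norm_unitary[OF A] by (metis norm_ge_zero real_sqrt_unique)
  define \<zeta> where "\<zeta> = A *v affine_vec x"
  define z where "z = hopf_section A x"
  have z: "z = complex_of_real (1 / N) *s \<zeta>"
    by (simp add: z_def hopf_section_def nrm N_def \<rho>_def \<zeta>_def scaleR_eq_vscale)
  have hz: "herm z z = 1"
  proof -
    have "norm z = 1" using N nrm[of x] by (simp add: z norm_vscale norm_divide \<zeta>_def N_def \<rho>_def)
    then show ?thesis by (simp add: herm_self)
  qed
  define e where "e a = A *v affine_dir (axis a 1)" for a :: "'a + 'a"
  have horiz: "\<exists>k. partial a (hopf_section A) x = complex_of_real (1 / N) *s e a + k *s z" for a
  proof -
    have "(\<lambda>y :: real ^ ('a + 'a). 1 / sqrt (1 + y \<bullet> y)) differentiable (at x)"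
      using \<rho> unfolding \<rho>_def by (intro differentiableI derivative_eq_intros refl) auto
    then obtain D where D: "((\<lambda>y :: real ^ ('a + 'a). 1 / sqrt (1 + y \<bullet> y)) has_derivative D) (at x)"
      by (auto simp: differentiable_def)
    have aff: "((\<lambda>y. A *v affine_vec y) has_derivative (\<lambda>v. A *v affine_dir v)) (at x)"
    proof -
      have lin: "bounded_linear (\<lambda>v :: real ^ ('a + 'a). A *v affine_dir v)"
        using linear_compose[OF linear_affine_dir linear_matrix_complex[of A]]
        by (simp add: linear_conv_bounded_linear o_def)
      have "(\<lambda>y. A *v affine_vec y) = (\<lambda>y. A *v axis None 1 + A *v affine_dir y)"
        by (simp add: affine_vec_eq matrix_vector_right_distrib)
      then show ?thesis
        using has_derivative_add[OF has_derivative_const bounded_linear_imp_has_derivative[OF lin]] by simp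
    qed
    have "(hopf_section A has_derivative (\<lambda>v. (1 / sqrt (1 + x \<bullet> x)) *\<^sub>R (A *v affine_dir v) + D v *\<^sub>R (A *v affine_vec x))) (at x)"
      unfolding hopf_section_def[abs_def] nrm by (rule has_derivative_scaleR[OF D aff])
    from partial_eqI[OF this, of a]
    have "partial a (hopf_section A) x = (1 / N) *\<^sub>R e a + D (axis a 1) *\<^sub>R \<zeta>"
      by (simp add: N_def \<rho>_def e_def \<zeta>_def)
    also have "D (axis a 1) *\<^sub>R \<zeta> = complex_of_real (D (axis a 1) * N) *s z"
      using N by (simp add: z scaleR_eq_vscale vector_smult_assoc)
    finally show ?thesis by (auto simp: scaleR_eq_vscale)
  qed
  have shift: "hopf_horizontal z (v + k *s z) = hopf_horizontal z v" for v k
    using hz by (simp add: hopf_horizontal_def herm_add_left herm_scale_left vec_eq_iff algebra_simps)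
  have hh: "hopf_horizontal z (partial a (hopf_section A) x) = hopf_horizontal z (complex_of_real (1 / N) *s e a)" for a
    using horiz[of a] shift by auto
  have ez: "herm (complex_of_real (1 / N) *s e a) z = Complex (x $ a) (quarter_turn x $ a) / complex_of_real \<rho>" for a
    using N by (simp add: herm_scale_left herm_scale_right z e_def \<zeta>_def herm_unitary[OF A] herm_axis_affine
        divide_simps flip: of_real_mult)
  have ee: "Re (herm (complex_of_real (1 / N) *s e a) (complex_of_real (1 / N) *s e b)) = (if a = b then 1 else 0) / \<rho>" for a b
  proof -
    have "Re (herm (e a) (e b)) = (if a = b then 1 else 0)"
      using inner_affine_dir[of "axis a 1" "axis b 1"]
      by (simp add: e_def herm_unitary[OF A] inner_eq_Re_herm[symmetric] inner_axis_axis)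
    moreover have "herm (complex_of_real (1 / N) *s e a) (complex_of_real (1 / N) *s e b) = complex_of_real (1 / \<rho>) * herm (e a) (e b)"
      using N(2) by (simp add: herm_scale_left herm_scale_right flip: N(2))
    ultimately show ?thesis by simp
  qed
  have "fubini_study A x $ a $ b = hopf_horizontal z (partial a (hopf_section A) x) \<bullet> hopf_horizontal z (partial b (hopf_section A) x)"
    by (simp add: fubini_study_def z_def)
  also have "\<dots> = (if a = b then 1 else 0) / \<rho> - Re (Complex (x $ a) (quarter_turn x $ a) / complex_of_real \<rho> *
      cnj (Complex (x $ b) (quarter_turn x $ b) / complex_of_real \<rho>))"
    unfolding hh hopf_horizontal_inner[OF hz] ez by (simp only: minus_complex.sel ee)
  also have "\<dots> = ((if a = b then 1 else 0) - (x $ a * x $ b + quarter_turn x $ a * quarter_turn x $ b) / \<rho>) / \<rho>"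
    by (simp add: diff_divide_distrib add_divide_distrib)
  finally show ?thesis by (simp add: \<rho>_def)
qed

lemma quarter_turn_inner:
  "(\<Sum>a\<in>UNIV. x $ a * quarter_turn x $ a) = 0"
  "(\<Sum>a\<in>UNIV. quarter_turn x $ a * quarter_turn x $ a) = x \<bullet> x"
  by (simp_all add: sum_plus quarter_turn_def inner_vec_def sum.distrib flip: sum_negf)
     (simp_all add: sum_negf mult.commute)

text \<open>With \<rho> = 1 + |x|^2 and T = x x^t + q q^t for the quarter turn q of x, the metric is
  (I - T/\<rho>) / \<rho>. Since q is orthogonal to x and of the same length, T^2 = (\<rho> - 1) T,
  whence (I - T/\<rho>)^(-1) = I + T.\<close>

definition metric_inverse :: "real ^ ('m + 'm) \<Rightarrow> real ^ ('m + 'm) ^ (('m :: finite) + 'm)" where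
  "metric_inverse x = (\<chi> a b. (1 + x \<bullet> x) *
     ((if a = b then 1 else 0) + (x $ a * x $ b + quarter_turn x $ a * quarter_turn x $ b)))"

lemma matrix_inv_eqI:
  fixes A B :: "real ^ 'n ^ ('n :: finite)"
  assumes "A ** B = mat 1"
  shows "matrix_inv A = B"
proof -
  have BA: "B ** A = mat 1" using assms matrix_left_right_inverse by blast
  have "A ** matrix_inv A = mat 1 \<and> matrix_inv A ** A = mat 1"
    unfolding matrix_inv_def by (rule someI[of _ B]) (use assms BA in simp)
  then have "matrix_inv A = matrix_inv A ** (A ** B)" using assms by simp
  also have "\<dots> = B" using \<open>_ \<and> _\<close> by (simp add: matrix_mul_assoc)
  finally show ?thesis .
qed

lemma matrix_inv_fubini_study:
  assumes A: "unitary_matrix A"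
  shows "matrix_inv (fubini_study A x) = metric_inverse x"
proof (rule matrix_inv_eqI)
  define q where "q = quarter_turn x"
  define \<rho> where "\<rho> = 1 + x \<bullet> x"
  have \<rho>: "\<rho> > 0" by (simp add: \<rho>_def add_pos_nonneg)
  define T where "T a b = x $ a * x $ b + q $ a * q $ b" for a b
  have TT: "(\<Sum>c\<in>UNIV. T a c * T c b) = (\<rho> - 1) * T a b" for a b
  proof -
    have "(\<Sum>c\<in>UNIV. T a c * T c b) = x $ a * x $ b * (\<Sum>c\<in>UNIV. x $ c * x $ c) + x $ a * q $ b * (\<Sum>c\<in>UNIV. x $ c * q $ c)
        + q $ a * x $ b * (\<Sum>c\<in>UNIV. x $ c * q $ c) + q $ a * q $ b * (\<Sum>c\<in>UNIV. q $ c * q $ c)"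
      by (simp add: T_def sum_distrib_left algebra_simps flip: sum.distrib)
    also have "(\<Sum>c\<in>UNIV. x $ c * x $ c) = x \<bullet> x" by (simp add: inner_vec_def)
    finally show ?thesis by (simp add: q_def quarter_turn_inner T_def \<rho>_def algebra_simps)
  qed
  have "(\<Sum>c\<in>UNIV. fubini_study A x $ a $ c * metric_inverse x $ c $ b) = (if a = b then 1 else 0)" for a b
  proof -
    have "fubini_study A x $ a $ c * metric_inverse x $ c $ b =
        ((if a = c then 1 else 0) - T a c / \<rho>) * ((if c = b then 1 else 0) + T c b)" for c
      using \<rho> by (simp add: fubini_study_formula[OF A] metric_inverse_def T_def q_def \<rho>_def)
    also have "\<dots> c = (if c = a then (if a = b then 1 else 0) + T a b else 0)
        - (if c = b then T a b / \<rho> else 0) - T a c * T c b / \<rho>" for c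
      by (auto simp: algebra_simps)
    finally have "(\<Sum>c\<in>UNIV. fubini_study A x $ a $ c * metric_inverse x $ c $ b) =
        (if a = b then 1 else 0) + T a b - T a b / \<rho> - (\<Sum>c\<in>UNIV. T a c * T c b) / \<rho>"
      by (simp add: sum_subtractf sum_divide_distrib)
    also have "\<dots> = (if a = b then 1 else 0)"
      unfolding TT using \<rho> by (simp add: field_simps)
    finally show ?thesis .
  qed
  then show "fubini_study A x ** metric_inverse x = mat 1"
    by (simp add: vec_eq_iff matrix_matrix_mult_def mat_def)
qed

section \<open>Reduction to the flat Laplacian at the centre\<close>

lemma even_has_derivative_0:
  fixes f :: "'a :: real_normed_vector \<Rightarrow> real"
  assumes "f differentiable (at 0)" "\<And>x. f (- x) = f x"
  shows "(f has_derivative (\<lambda>_. 0)) (at 0)"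
proof -
  obtain D where D: "(f has_derivative D) (at 0)" using assms(1) by (auto simp: differentiable_def)
  have "((\<lambda>x. f (- x)) has_derivative (\<lambda>v. D (- v))) (at 0)"
    by (rule has_derivative_compose[of uminus uminus]) (use D in \<open>auto intro!: derivative_eq_intros\<close>)
  then have "(f has_derivative (\<lambda>v. D (- v))) (at 0)" using assms(2) by simp
  then have "D v = D (- v)" for v using has_derivative_unique[OF D] by metis
  moreover have "D (- v) = - D v" for v using D has_derivative_linear linear_neg by blast
  ultimately have "D = (\<lambda>_. 0)" by (auto simp: fun_eq_iff)
  then show ?thesis using D by simp
qed

lemma quarter_turn_minus: "quarter_turn (- x) $ a = - (quarter_turn x $ a)"
  by (cases a) (auto simp: quarter_turn_def)

lemma differentiable_vec_nth: "(\<lambda>x :: real ^ ('n :: finite). x $ a) differentiable (at y)"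
  using bounded_linear_imp_differentiable[OF bounded_linear_vec_nth] .

lemma differentiable_quarter_turn: "(\<lambda>x. quarter_turn x $ a) differentiable (at y)"
  by (cases a) (auto simp: quarter_turn_def intro!: differentiable_vec_nth derivative_intros)

lemma fubini_study_0: "unitary_matrix A \<Longrightarrow> fubini_study A 0 = mat 1"
  by (auto simp: vec_eq_iff fubini_study_formula mat_def quarter_turn_def split: sum.split)

text \<open>The metric is even in x, so every coefficient built from it is stationary at the centre.
  Only differentiability has to be checked; no determinant away from 0 is computed.\<close>

lemma metric_coefficient_stationary:
  assumes A: "unitary_matrix A"
  shows "((\<lambda>y. sqrt (det (fubini_study A y)) * matrix_inv (fubini_study A y) $ a $ b) has_derivative (\<lambda>_. 0)) (at 0)"
proof (rule even_has_derivative_0)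
  show "sqrt (det (fubini_study A (- x))) * matrix_inv (fubini_study A (- x)) $ a $ b =
      sqrt (det (fubini_study A x)) * matrix_inv (fubini_study A x) $ a $ b" for x
  proof -
    have "fubini_study A (- x) = fubini_study A x"
      by (simp add: vec_eq_iff fubini_study_formula[OF A] quarter_turn_minus)
    then show ?thesis by simp
  qed
  have coord: "(\<lambda>y. fubini_study A y $ c $ d) differentiable (at 0)" for c d
    unfolding fubini_study_formula[OF A]
    by (intro differentiable_divide differentiable_diff differentiable_add differentiable_mult differentiable_const
        differentiable_vec_nth differentiable_quarter_turn differentiable_inner differentiable_ident) auto
  have dprod: "(\<lambda>y. \<Prod>i\<in>UNIV. fubini_study A y $ i $ p i) differentiable (at 0)" for p
  proof -
    have "\<forall>i. \<exists>D. ((\<lambda>y. fubini_study A y $ i $ p i) has_derivative D) (at 0)"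
      using coord unfolding differentiable_def by blast
    then obtain D where "\<And>i. ((\<lambda>y. fubini_study A y $ i $ p i) has_derivative D i) (at 0)" by metis
    then have "((\<lambda>y. \<Prod>i\<in>UNIV. fubini_study A y $ i $ p i) has_derivative
        (\<lambda>v. \<Sum>i\<in>UNIV. D i v * (\<Prod>j\<in>UNIV - {i}. fubini_study A 0 $ j $ p j))) (at 0)"
      by (intro has_derivative_prod)
    then show ?thesis by (rule differentiableI)
  qed
  have ddet: "(\<lambda>y. det (fubini_study A y)) differentiable (at 0)"
    unfolding det_def
  proof (intro differentiable_sum ballI)
    fix p
    show "(\<lambda>y. of_int (sign p) * (\<Prod>i\<in>UNIV. fubini_study A y $ i $ p i)) differentiable (at 0)"
      by (rule differentiable_mult[OF differentiable_const dprod])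
  qed (simp add: finite_permutations)
  then obtain D where D: "((\<lambda>y. det (fubini_study A y)) has_derivative D) (at 0)" by (auto simp: differentiable_def)
  have "det (fubini_study A 0) = 1" by (simp add: fubini_study_0[OF A])
  then have "(\<lambda>y. sqrt (det (fubini_study A y))) differentiable (at 0)"
    using has_derivative_real_sqrt[OF _ D] by (auto simp: differentiable_def)
  moreover have "(\<lambda>y. matrix_inv (fubini_study A y) $ a $ b) differentiable (at 0)"
    unfolding matrix_inv_fubini_study[OF A] metric_inverse_def vec_lambda_beta
    by (intro differentiable_diff differentiable_add differentiable_mult differentiable_const
        differentiable_vec_nth differentiable_quarter_turn differentiable_inner differentiable_ident)
  ultimately show "(\<lambda>y. sqrt (det (fubini_study A y)) * matrix_inv (fubini_study A y) $ a $ b) differentiable (at 0)"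
    by (rule differentiable_mult)
qed

text \<open>At the centre the metric is the identity and its coefficients are stationary, so the
  first-order terms drop out and the trace of the Hessian is left.\<close>

lemma laplace_beltrami_centre:
  assumes A: "unitary_matrix (A :: complex ^ ('m :: finite) option ^ 'm option)"
    and f: "\<And>x. (f has_derivative blinfun_apply (f' x)) (at x)" "\<And>x. (f' has_derivative blinfun_apply (f'' x)) (at x)"
  shows "laplace_beltrami (fubini_study A) f 0 = (\<Sum>a\<in>UNIV. f'' 0 (axis a 1) (axis a 1))"
proof -
  define F where "F a b y = sqrt (det (fubini_study A y)) * matrix_inv (fubini_study A y) $ a $ b" for a b y
  have F0: "F a b 0 = (if a = b then 1 else 0)" for a b
  proof -
    have "quarter_turn 0 $ c = 0" for c :: "'m + 'm" by (cases c) (auto simp: quarter_turn_def)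
    then show ?thesis
      unfolding F_def matrix_inv_fubini_study[OF A] by (simp add: fubini_study_0[OF A] metric_inverse_def)
  qed
  have pf: "partial b f y = f' y (axis b 1)" for b y
    by (rule partial_eqI[OF f(1)])
  have "partial a (\<lambda>y. F a b y * partial b f y) 0 = F a b 0 * f'' 0 (axis a 1) (axis b 1)" for a b
  proof -
    have "((\<lambda>y. f' y (axis b 1)) has_derivative (\<lambda>v. f'' 0 v (axis b 1))) (at 0)"
      using bounded_linear.has_derivative[OF bounded_linear_apply_blinfun f(2)] .
    from has_derivative_mult[OF metric_coefficient_stationary[OF A, of a b, folded F_def] this]
    have "((\<lambda>y. F a b y * partial b f y) has_derivative (\<lambda>v. F a b 0 * f'' 0 v (axis b 1))) (at 0)"
      by (simp add: pf)
    then show ?thesis by (rule partial_eqI)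
  qed
  then show ?thesis
    unfolding laplace_beltrami_def F_def[symmetric]
    by (simp add: F0 fubini_study_0[OF A] if_distrib[of "\<lambda>x. x * _"] cong: if_cong)
qed

section \<open>Second derivatives along coordinate lines\<close>

text \<open>\<open>X\<close> is the height along a coordinate line through the centre, where the sum
  of squares is the quadratic polynomial c + 2 s t + r t^2. The two terms are the chain rule: X'(0)
  = 4 Re (cnj c * s), and the factor of G1 is X''(0).\<close>

lemma second_derivative_on_line:
  fixes c s r :: complex and G G1 G2 :: "real \<Rightarrow> real"
  assumes G: "\<And>x. (G has_real_derivative G1 x) (at x)" "\<And>x. (G1 has_real_derivative G2 x) (at x)"
  defines "X t \<equiv> ((Re (c + 2 * s * of_real t + r * (of_real t)\<^sup>2))\<^sup>2 + (Im (c + 2 * s * of_real t + r * (of_real t)\<^sup>2))\<^sup>2) / (1 + t\<^sup>2)\<^sup>2"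
  shows "\<exists>D. (\<forall>t. ((\<lambda>t. G (1 - X t)) has_real_derivative D t) (at t)) \<and>
    (D has_real_derivative
      G2 (1 - (cmod c)\<^sup>2) * (4 * Re (cnj c * s))\<^sup>2
      - G1 (1 - (cmod c)\<^sup>2) * (8 * (cmod s)\<^sup>2 + 4 * Re (cnj c * r) - 4 * (cmod c)\<^sup>2)) (at 0)"
proof -
  define p where "p t = Re c + 2 * Re s * t + Re r * t\<^sup>2" for t
  define q where "q t = Im c + 2 * Im s * t + Im r * t\<^sup>2" for t
  define p' where "p' t = 2 * Re s + 2 * Re r * t" for t
  define q' where "q' t = 2 * Im s + 2 * Im r * t" for t
  have Xeq: "X = (\<lambda>t. ((p t)\<^sup>2 + (q t)\<^sup>2) / (1 + t\<^sup>2)\<^sup>2)"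
    by (auto simp: X_def p_def q_def fun_eq_iff simp flip: of_real_power)
  have dp: "(p has_real_derivative p' t) (at t)" "(p' has_real_derivative 2 * Re r) (at t)"
    "(q has_real_derivative q' t) (at t)" "(q' has_real_derivative 2 * Im r) (at t)" for t
    unfolding p_def p'_def q_def q'_def by (auto intro!: derivative_eq_intros)
  define N where "N t = (2 * p t * p' t + 2 * q t * q' t) * (1 + t\<^sup>2) - 4 * t * ((p t)\<^sup>2 + (q t)\<^sup>2)" for t
  have dX: "(X has_real_derivative N t / (1 + t\<^sup>2) ^ 3) (at t)" for t
  proof -
    have pos: "1 + t\<^sup>2 > 0" by (simp add: add_pos_nonneg)
    have d: "((\<lambda>t. ((p t)\<^sup>2 + (q t)\<^sup>2) / (1 + t\<^sup>2)\<^sup>2) has_real_derivative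
        ((2 * p t * p' t + 2 * q t * q' t) * (1 + t\<^sup>2)\<^sup>2 - ((p t)\<^sup>2 + (q t)\<^sup>2) * (2 * (1 + t\<^sup>2) * (2 * t))) / ((1 + t\<^sup>2)\<^sup>2 * (1 + t\<^sup>2)\<^sup>2)) (at t)"
      using pos by (auto intro!: derivative_eq_intros dp simp: algebra_simps)
    have alg: "(a * w\<^sup>2 - b * (2 * w * (2 * t))) / (w\<^sup>2 * w\<^sup>2) = (a * w - 4 * t * b) / w ^ 3" if "w > 0" for a b w :: real
      using that by (simp add: field_simps eval_nat_numeral)
    show ?thesis using d unfolding alg[OF pos] by (simp only: Xeq N_def)
  qed
  have dN: "(N has_real_derivative 8 * (cmod s)\<^sup>2 + 4 * Re (cnj c * r) - 4 * (cmod c)\<^sup>2) (at 0)"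
    unfolding N_def[abs_def]
    by (auto intro!: derivative_eq_intros dp simp: p_def q_def p'_def q'_def cmod_power2)
       (simp add: power2_eq_square algebra_simps)
  have X0: "X 0 = (cmod c)\<^sup>2" by (simp add: X_def cmod_power2)
  have N0: "N 0 = 4 * Re (cnj c * s)" by (simp add: N_def p_def q_def p'_def q'_def algebra_simps)
  define D where "D t = G1 (1 - X t) * - (N t / (1 + t\<^sup>2) ^ 3)" for t
  have "((\<lambda>t. G (1 - X t)) has_real_derivative D t) (at t)" for t
  proof -
    have "((\<lambda>t. 1 - X t) has_real_derivative - (N t / (1 + t\<^sup>2) ^ 3)) (at t)"
      using DERIV_diff[OF DERIV_const dX] by simp
    from DERIV_chain2[OF G(1) this] show ?thesis by (simp add: D_def)
  qed
  moreover have "(D has_real_derivative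
      G2 (1 - (cmod c)\<^sup>2) * (4 * Re (cnj c * s))\<^sup>2
      - G1 (1 - (cmod c)\<^sup>2) * (8 * (cmod s)\<^sup>2 + 4 * Re (cnj c * r) - 4 * (cmod c)\<^sup>2)) (at 0)"
  proof -
    have "((\<lambda>t. 1 - X t) has_real_derivative - N 0) (at 0)"
      using DERIV_diff[OF DERIV_const dX[of 0]] by simp
    from DERIV_chain2[OF G(2) this]
    have 1: "((\<lambda>t. G1 (1 - X t)) has_real_derivative G2 (1 - X 0) * - N 0) (at 0)" .
    have 2: "((\<lambda>t. - (N t / (1 + t\<^sup>2) ^ 3)) has_real_derivative
        - (8 * (cmod s)\<^sup>2 + 4 * Re (cnj c * r) - 4 * (cmod c)\<^sup>2)) (at 0)"
      by (auto intro!: derivative_eq_intros dN)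
    show ?thesis
      unfolding D_def[abs_def]
      by (rule DERIV_cong[OF DERIV_mult[OF 1 2]]) (simp add: X0 N0 power2_eq_square algebra_simps)
  qed
  ultimately show ?thesis by blast
qed

text \<open>The direction w is 1 or \<i> according to whether the coordinate is the real or the
  imaginary part of the j-th affine coordinate.\<close>

lemma sumsq_on_line:
  fixes A :: "complex ^ ('m :: finite) option ^ 'm option"
  shows "sumsq (A *v affine_vec (t *\<^sub>R axis a 1)) =
    (let w = (case a of Inl _ \<Rightarrow> 1 | Inr _ \<Rightarrow> \<i>); j = (case a of Inl j \<Rightarrow> j | Inr j \<Rightarrow> j) in
     (\<Sum>k\<in>UNIV. (A $ k $ None)\<^sup>2) + 2 * (w * (\<Sum>k\<in>UNIV. A $ k $ None * A $ k $ Some j)) * of_real t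
     + (w\<^sup>2 * (\<Sum>k\<in>UNIV. (A $ k $ Some j)\<^sup>2)) * (of_real t)\<^sup>2)"
proof -
  define w where "w = (case a of Inl _ \<Rightarrow> 1 | Inr _ \<Rightarrow> \<i>)"
  define j where "j = (case a of Inl j \<Rightarrow> j | Inr j \<Rightarrow> j)"
  have comp: "(A *v affine_vec (t *\<^sub>R axis a 1)) $ k = A $ k $ None + w * of_real t * A $ k $ Some j" for k
  proof -
    have "affine_vec (t *\<^sub>R axis a 1) $ Some i = (if i = j then w * of_real t else 0)" for i
      by (cases a) (auto simp: w_def j_def axis_def complex_eq_iff)
    then show ?thesis
      by (simp add: matrix_vector_mult_def sum_option if_distrib[of "\<lambda>y. _ * y"] mult.commute cong: if_cong)
  qed
  have "sumsq (A *v affine_vec (t *\<^sub>R axis a 1)) =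
      (\<Sum>k\<in>UNIV. (A $ k $ None)\<^sup>2 + 2 * (w * (A $ k $ None * A $ k $ Some j)) * of_real t + w\<^sup>2 * (A $ k $ Some j)\<^sup>2 * (of_real t)\<^sup>2)"
    unfolding sumsq_def comp by (intro sum.cong refl) (simp add: power2_eq_square algebra_simps)
  then show ?thesis
    unfolding Let_def w_def[symmetric] j_def[symmetric]
    by (simp add: sum.distrib sum_distrib_left sum_distrib_right)
qed

text \<open>The transpose of a unitary matrix is unitary, so it preserves the norm 1 of the first
  column; the entries of the image are the sums in the statement.\<close>

lemma unitary_gram_row:
  fixes A :: "complex ^ ('m :: finite) option ^ 'm option"
  assumes A: "unitary_matrix A"
  shows "(cmod (\<Sum>k\<in>UNIV. (A $ k $ None)\<^sup>2))\<^sup>2 + (\<Sum>j\<in>UNIV. (cmod (\<Sum>k\<in>UNIV. A $ k $ None * A $ k $ Some j))\<^sup>2) = 1"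
proof -
  define C where "C = (\<chi> i j. cnj (A $ j $ i))"
  have "C ** A = mat 1" using A by (simp add: unitary_matrix_def C_def)
  then have "A ** C = mat 1" using matrix_left_right_inverse by blast
  then have rows: "(\<Sum>k\<in>UNIV. A $ i $ k * cnj (A $ j $ k)) = (if i = j then 1 else 0)" for i j
    by (auto simp: vec_eq_iff matrix_matrix_mult_def mat_def C_def)
  have "unitary_matrix (transpose A)"
    using rows by (auto simp: unitary_matrix_def vec_eq_iff matrix_matrix_mult_def mat_def transpose_def mult.commute)
  then have "norm (transpose A *v (\<chi> k. A $ k $ None)) = norm (\<chi> k. A $ k $ None)" by (rule norm_unitary)
  moreover have "herm (\<chi> k. A $ k $ None) (\<chi> k. A $ k $ None) = 1"
    using unitary_columns[OF A, of None None] by (simp add: herm_def mult.commute)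
  then have "(norm (\<chi> k. A $ k $ None))\<^sup>2 = 1" by (metis herm_self of_real_1 of_real_eq_iff)
  ultimately have "(norm (transpose A *v (\<chi> k. A $ k $ None)))\<^sup>2 = 1" by simp
  moreover have "(norm v)\<^sup>2 = (\<Sum>i\<in>UNIV. (cmod (v $ i))\<^sup>2)" for v :: "complex ^ 'm option"
    by (simp add: norm_vec_def L2_set_def sum_nonneg)
  ultimately show ?thesis
    by (simp add: sum_option matrix_vector_mult_def transpose_def power2_eq_square mult.commute)
qed

theorem laplace_FS_quadric_height:
  fixes p :: "('m :: finite) option cproj" and G G1 G2 :: "real \<Rightarrow> real"
  assumes G: "\<And>x. (G has_real_derivative G1 x) (at x)" "\<And>x. (G1 has_real_derivative G2 x) (at x)" "\<And>x. isCont G2 x"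
  shows "C2_cproj (\<lambda>p :: 'm option cproj. G (1 - quadric_height p))"
    and "laplace_FS (\<lambda>p. G (1 - quadric_height p)) p =
      (let n = CARD('m); y = 1 - quadric_height p in
       16 * (y * (1 - y) * G2 y + (n / 2 - (n / 2 + 1) * y) * G1 y))"
proof -
  define u where "u = (\<lambda>p :: 'm option cproj. G (1 - quadric_height p))"
  have C2: "C2_fun (u \<circ> chart A)" if "unitary_matrix A" for A
  proof -
    have "C2_fun (\<lambda>x. (\<lambda>t. G (1 - t)) (quadric_height (chart A x)))"
    proof (rule C2_fun_compose[OF C2_quadric_height_chart[OF that], of UNIV _ "\<lambda>t. - G1 (1 - t)" "\<lambda>t. G2 (1 - t)"])
      fix t :: real
      have d: "((\<lambda>t. 1 - t) has_real_derivative - 1) (at t)" by (auto intro!: derivative_eq_intros)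
      show "((\<lambda>t. G (1 - t)) has_real_derivative - G1 (1 - t)) (at t)"
        using DERIV_chain2[OF G(1) d] by simp
      show "((\<lambda>t. - G1 (1 - t)) has_real_derivative G2 (1 - t)) (at t)"
        using DERIV_minus[OF DERIV_chain2[OF G(2) d]] by simp
    next
      have "continuous_on UNIV G2" using G(3) by (simp add: continuous_on_eq_continuous_at)
      then show "continuous_on UNIV (\<lambda>t. G2 (1 - t))"
        by (rule continuous_on_compose2) (auto intro!: continuous_intros)
    qed auto
    then show ?thesis by (simp add: u_def o_def)
  qed
  then show "C2_cproj (\<lambda>p :: 'm option cproj. G (1 - quadric_height p))"
    by (simp add: C2_cproj_def u_def)
  define A where "A = (SOME A. unitary_matrix A \<and> chart A 0 = p)"
  have A: "unitary_matrix A" "chart A 0 = p"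
    using someI_ex[OF ex_centred_chart[of p]] by (auto simp: A_def)
  obtain f' f'' where f: "\<And>x. (u \<circ> chart A has_derivative blinfun_apply (f' x)) (at x)"
    "\<And>x. (f' has_derivative blinfun_apply (f'' x)) (at x)"
    using C2[OF A(1)] by (auto simp: C2_fun_def)
  define c where "c = (\<Sum>k\<in>UNIV. (A $ k $ None)\<^sup>2)"
  define s where "s j = (\<Sum>k\<in>UNIV. A $ k $ None * A $ k $ Some j)" for j
  define r where "r j = (\<Sum>k\<in>UNIV. (A $ k $ Some j)\<^sup>2)" for j
  define V where "V w j = G2 (1 - (cmod c)\<^sup>2) * (4 * Re (cnj c * (w * s j)))\<^sup>2
      - G1 (1 - (cmod c)\<^sup>2) * (8 * (cmod (w * s j))\<^sup>2 + 4 * Re (cnj c * (w\<^sup>2 * r j)) - 4 * (cmod c)\<^sup>2)" for w j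
  have second: "f'' 0 (axis a 1) (axis a 1) = V (case a of Inl _ \<Rightarrow> 1 | Inr _ \<Rightarrow> \<i>) (case a of Inl j \<Rightarrow> j | Inr j \<Rightarrow> j)" for a
  proof -
    define w where "w = (case a of Inl _ \<Rightarrow> 1 | Inr _ \<Rightarrow> \<i>)"
    define j where "j = (case a of Inl j \<Rightarrow> j | Inr j \<Rightarrow> j)"
    define e where "e = (axis a 1 :: real ^ ('m + 'm))"
    have line: "((\<lambda>t. t *\<^sub>R e) has_derivative (\<lambda>h. h *\<^sub>R e)) (at t)" for t :: real
      by (auto intro!: derivative_eq_intros)
    have d1: "((\<lambda>t. (u \<circ> chart A) (t *\<^sub>R e)) has_real_derivative f' (t *\<^sub>R e) e) (at t)" for t
      using has_derivative_compose[OF line f(1)]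
      by (simp add: has_field_derivative_def blinfun.scaleR_right mult_commute_abs)
    have "((\<lambda>t. f' (t *\<^sub>R e)) has_derivative (\<lambda>h. f'' (0 *\<^sub>R e) (h *\<^sub>R e))) (at 0)"
      using has_derivative_compose[OF line f(2), of 0] by simp
    then have "((\<lambda>t. f' (t *\<^sub>R e) e) has_derivative (\<lambda>h. f'' (0 *\<^sub>R e) (h *\<^sub>R e) e)) (at 0)"
      by (rule bounded_linear.has_derivative[OF bounded_linear_apply_blinfun])
    then have d2: "((\<lambda>t. f' (t *\<^sub>R e) e) has_real_derivative f'' 0 e e) (at 0)"
      by (simp add: has_field_derivative_def blinfun.scaleR_right blinfun.scaleR_left mult_commute_abs)
    have ee: "(t *\<^sub>R e) \<bullet> (t *\<^sub>R e) = t\<^sup>2" for t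
      by (simp add: e_def inner_axis_axis power2_eq_square)
    have expl: "(u \<circ> chart A) (t *\<^sub>R e) =
        G (1 - ((Re (c + 2 * (w * s j) * of_real t + (w\<^sup>2 * r j) * (of_real t)\<^sup>2))\<^sup>2 +
          (Im (c + 2 * (w * s j) * of_real t + (w\<^sup>2 * r j) * (of_real t)\<^sup>2))\<^sup>2) / (1 + t\<^sup>2)\<^sup>2)" for t
      unfolding u_def o_def quadric_height_chart[OF A(1)] ee
      unfolding e_def sumsq_on_line Let_def c_def s_def r_def w_def[symmetric] j_def[symmetric] by simp
    obtain D where D: "\<And>t. ((\<lambda>t. (u \<circ> chart A) (t *\<^sub>R e)) has_real_derivative D t) (at t)"
      "(D has_real_derivative V w j) (at 0)"
      using second_derivative_on_line[OF G(1,2), where c=c and s="w * s j" and r="w\<^sup>2 * r j"]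
      unfolding expl V_def by blast
    have "D = (\<lambda>t. f' (t *\<^sub>R e) e)" using DERIV_unique[OF D(1) d1] by auto
    then show ?thesis using DERIV_unique[OF d2] D(2) by (simp add: e_def w_def j_def)
  qed
  define m where "m = (\<Sum>j\<in>UNIV. (cmod (s j))\<^sup>2)"
  have m: "m = 1 - (cmod c)\<^sup>2"
    using unitary_gram_row[OF A(1)] by (simp add: c_def s_def m_def)
  \<comment> \<open>Adding the directions 1 and \<i> combines real and imaginary parts into a
    modulus, and the terms with r cancel because \<i>^2 = - 1. What is left depends on the point
    only through |c|^2 and, after summing over j, through \<open>m\<close>.\<close>
  have pair: "V 1 j + V \<i> j = G2 (1 - (cmod c)\<^sup>2) * (16 * (cmod c)\<^sup>2 * (cmod (s j))\<^sup>2)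
      - G1 (1 - (cmod c)\<^sup>2) * (16 * (cmod (s j))\<^sup>2 - 8 * (cmod c)\<^sup>2)" for j
  proof -
    have "(4 * Re (cnj c * s j))\<^sup>2 + (4 * Re (cnj c * (\<i> * s j)))\<^sup>2 = 16 * ((cmod c)\<^sup>2 * (cmod (s j))\<^sup>2)"
      unfolding cmod_power2 by (simp add: power2_eq_square algebra_simps)
    moreover have "Re (cnj c * (\<i>\<^sup>2 * r j)) = - Re (cnj c * r j)" by simp
    ultimately show ?thesis by (simp add: V_def norm_mult algebra_simps flip: distrib_left)
  qed
  have "laplace_FS u p = laplace_beltrami (fubini_study A) (u \<circ> chart A) 0"
    by (simp add: laplace_FS_def A_def Let_def)
  also have "\<dots> = (\<Sum>j\<in>UNIV. V 1 j + V \<i> j)"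
    by (simp add: laplace_beltrami_centre[OF A(1) f] second sum_plus sum.distrib)
  also have "\<dots> = G2 (1 - (cmod c)\<^sup>2) * (16 * (cmod c)\<^sup>2 * m) - G1 (1 - (cmod c)\<^sup>2) * (16 * m - CARD('m) * (8 * (cmod c)\<^sup>2))"
    unfolding pair by (simp add: sum_subtractf m_def flip: sum_distrib_left)
  also have "(cmod c)\<^sup>2 = quadric_height p"
  proof -
    have "sumsq (A *v affine_vec 0) = c"
      using sumsq_on_line[of A 0 "Inl undefined"] by (simp add: c_def)
    then show ?thesis using quadric_height_chart[OF A(1), of 0] by (simp add: A(2) cmod_power2)
  qed
  finally have "laplace_FS u p = G2 (1 - quadric_height p) * (16 * quadric_height p * (1 - quadric_height p))
      - G1 (1 - quadric_height p) * (16 * (1 - quadric_height p) - CARD('m) * (8 * quadric_height p))"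
    using m \<open>(cmod c)\<^sup>2 = quadric_height p\<close> by simp
  then show "laplace_FS (\<lambda>p. G (1 - quadric_height p)) p =
      (let n = CARD('m); y = 1 - quadric_height p in
       16 * (y * (1 - y) * G2 y + (n / 2 - (n / 2 + 1) * y) * G1 y))"
    by (simp add: u_def Let_def algebra_simps)
qed

section \<open>From radial profiles to solutions on projective space\<close>

lemma ex_quadric_height_1: "\<exists>p :: ('m :: finite) option cproj. quadric_height p = 1"
proof
  have "(axis None 1 :: complex ^ 'm option) \<noteq> 0" by (simp add: axis_eq_0_iff)
  moreover have "sumsq (axis None 1 :: complex ^ 'm option) = 1"
    by (simp add: sumsq_def sum_option axis_def)
  ultimately show "quadric_height (proj (axis None 1 :: complex ^ 'm option)) = 1"
    by (simp add: quadric_height_proj norm_axis_1)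
qed

lemma positive_solution_radial:
  assumes "radial_solution CARD('m :: finite) (\<lambda>v. lam / 16 * (v - v powr q)) d G"
  shows "positive_solution lam q (\<lambda>p :: 'm option cproj. G (1 - quadric_height p))"
proof -
  obtain G1 G2 where der: "\<And>x. (G has_real_derivative G1 x) (at x)" "\<And>x. (G1 has_real_derivative G2 x) (at x)"
      "\<And>x. isCont G2 x"
    and ode: "\<And>y. y \<in> {0..1} \<Longrightarrow> 0 < G y \<and>
      y * (1 - y) * G2 y + (CARD('m) / 2 - (CARD('m) / 2 + 1) * y) * G1 y = lam / 16 * (G y - G y powr q)"
    using assms unfolding radial_solution_def by blast
  show ?thesis
    unfolding positive_solution_def
  proof (intro conjI allI)
    show "C2_cproj (\<lambda>p :: 'm option cproj. G (1 - quadric_height p))"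
      by (rule laplace_FS_quadric_height(1)[OF der])
    fix p :: "'m option cproj"
    define y where "y = 1 - quadric_height p"
    have y: "y \<in> {0..1}" using quadric_height_bounds[of p] by (auto simp: y_def)
    show "G (1 - quadric_height p) > 0" using ode[OF y] by (simp add: y_def)
    have "laplace_FS (\<lambda>p. G (1 - quadric_height p)) p = lam * (G y - G y powr q)"
      using ode[OF y] unfolding laplace_FS_quadric_height(2)[OF der] Let_def y_def[symmetric] by simp
    then show "- laplace_FS (\<lambda>p. G (1 - quadric_height p)) p + lam * G (1 - quadric_height p) =
        lam * G (1 - quadric_height p) powr q"
      by (simp add: y_def algebra_simps)
  qed
qed

theorem corollary7p1:
  fixes n k :: nat and q lam :: real
  assumes "n = CARD('m :: finite)" and "n \<ge> 2"
    and "q > 1" and "n > 2 \<longrightarrow> q < (real n + 2) / (real n - 2)"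
    and "k \<ge> 1"
    and "lam \<in> {4 * real k * (4 * real k + 2 * real n) / (q - 1) <..
                4 * (real k + 1) * (4 * (real k + 1) + 2 * real n) / (q - 1)}"
  shows "\<exists>S :: (('m option) cproj \<Rightarrow> real) set.
           finite S \<and> card S = k \<and>
           (\<forall>u\<in>S. positive_solution lam q u \<and> SO_invariant u)"
proof -
  define \<kappa> where "\<kappa> = lam / 16"
  have low: "4 * real k * (4 * real k + 2 * real n) < lam * (q - 1)"
    using assms(3,6) by (simp add: pos_divide_less_eq)
  \<comment> \<open>Here 4k(4k + 2n) = 16 k (k + n/2), and \<kappa> absorbs the factor 16 of the
    radial Laplacian.\<close>
  then have K: "k * (k + n / 2) < \<kappa> * (q - 1)" by (simp add: \<kappa>_def algebra_simps)
  have "0 < \<kappa> * (q - 1)" by (rule le_less_trans[OF _ K]) simp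
  then have \<kappa>: "\<kappa> > 0" using assms(3) by (simp add: zero_less_mult_iff)
  obtain D :: "real set" where D: "finite D" "card D = k"
    and "\<forall>d\<in>D. \<exists>G. radial_solution n (\<lambda>v. \<kappa> * (v - v powr q)) d G"
    using radial_solutions[OF assms(2) \<kappa> assms(3,5) K] by blast
  then obtain G where G: "\<And>d. d \<in> D \<Longrightarrow> radial_solution n (\<lambda>v. \<kappa> * (v - v powr q)) d (G d)"
    by metis
  define u where "u d = (\<lambda>p :: 'm option cproj. G d (1 - quadric_height p))" for d
  have "positive_solution lam q (u d)" if "d \<in> D" for d
    unfolding u_def using G[OF that] unfolding \<kappa>_def assms(1) by (rule positive_solution_radial)
  moreover have "SO_invariant (u d)" for d
    unfolding u_def SO_invariant_def by (simp add: quadric_height_rotation)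
  moreover have "inj_on u D"
  proof (rule inj_onI)
    fix d e assume de: "d \<in> D" "e \<in> D" "u d = u e"
    \<comment> \<open>At a real point y = 0, so the solution takes the initial value of its profile
      there; distinct labels give distinct functions.\<close>
    obtain p :: "'m option cproj" where "quadric_height p = 1" using ex_quadric_height_1 by blast
    then have "G d 0 = G e 0" using fun_cong[OF de(3), of p] by (simp add: u_def)
    then show "d = e" using G[OF de(1)] G[OF de(2)] by (auto simp: radial_solution_def)
  qed
  ultimately show ?thesis
    using D card_image[of u D] by (intro exI[of _ "u ` D"]) auto
qed

end
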